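(* Let $n\ge 2$ and $p,q\in[1,\infty]$. Suppose that for some $\alpha\in\mathbb{C}$ there is a constant $C$ (independent of $f$) such that $$\big\|\mathfrak{M}^{\alpha}_{[1,2]}f\big\|_{L^{q}(\mathbb{R}^n)}\le C\|f\|_{L^{p}(\mathbb{R}^n)}$$ holds for all $f$. Then $q\ge p$ and $$\operatorname{Re}\alpha\ \ge\ \sigma_n(p,q):=\max\left\{\frac1p-\frac nq,\ \ \frac{n+1}{2p}-\frac{n-1}{2}\Big(\frac1q+1\Big),\ \ \frac np-n+1\right\}.$$
   Context: For $\operatorname{Re}\alpha>0$ and $t>0$, $$\mathfrak{M}^\alpha_tf(x)=\frac{1}{\Gamma(\alpha)}\int_{|y|\le1}(1-|y|^2)^{\alpha-1}f(x-ty)\,dy,$$ and the definition is extended to all $\alpha\in\mathbb{C}$ by analytic continuation in $\alpha$. Equivalently, for every $\alpha\in\mathbb{C}$ and Schwartz $f$, $\widehat{\mathfrak{M}^\alpha_tf}(\xi)=\widehat{m_\alpha}(t\xi)\hat f(\xi)$ with $\widehat{m_\alpha}(\xi)=\pi^{-\alpha+1}|\xi|^{-n/2-\alpha+1}J_{n/2+\alpha-1}(2\pi|\xi|)$, where $J_\beta$ is the Bessel function of order $\beta$ and $\hat f(\xi)=\int_{\mathbb{R}^n}e^{-2\pi i x\cdot\xi}f(x)\,dx$. Set $\mathfrak{M}^\alpha_{[1,2]}f(x)=\sup_{t\in[1,2]}|\mathfrak{M}^\alpha_tf(x)|$. Norm inequalities are understood as a priori inequalities for all Schwartz functions $f$ on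 $\mathbb{R}^n$. Conventions: $1/\infty=0$. *)

theory Defs
  imports "HOL-Complex_Analysis.Complex_Analysis" "HOL-Probability.Essential_Supremum"
begin

section \<open>Schwartz functions\<close>

definition partial_deriv :: "'n::finite \<Rightarrow> (real^'n \<Rightarrow> complex) \<Rightarrow> real^'n \<Rightarrow> complex" where
  "partial_deriv i f x = frechet_derivative f (at x) (axis i 1)"

primrec iter_partial :: "'n::finite list \<Rightarrow> (real^'n \<Rightarrow> complex) \<Rightarrow> real^'n \<Rightarrow> complex" where
  "iter_partial [] f = f"
| "iter_partial (i # is) f = partial_deriv i (iter_partial is f)"

text \<open>Multi-indices are represented by lists of coordinate directions. Requiring every iterated
  partial derivative to be (totally) differentiable everywhere is the same as f being smooth.\<close>
definition schwartz :: "(real^'n::finite \<Rightarrow> complex) \<Rightarrow> bool" where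
  "schwartz f \<longleftrightarrow>
     (\<forall>is x. iter_partial is f differentiable (at x)) \<and>
     (\<forall>is (N::nat). bounded (range (\<lambda>x. (1 + norm x) ^ N *\<^sub>R iter_partial is f x)))"

section \<open>Lebesgue norms with exponent in the extended reals\<close>

definition ennreal_pow :: "ennreal \<Rightarrow> real \<Rightarrow> ennreal" where
  "ennreal_pow a r = (if a = \<infinity> then \<infinity> else ennreal (enn2real a powr r))"

text \<open>The norm is defined on nonnegative extended real-valued functions, so that it applies to
  maximal functions without presupposing their finiteness. It is only used for exponents
  at least 1.\<close>
definition Lnorm :: "ennreal \<Rightarrow> (real^'n::finite \<Rightarrow> ennreal) \<Rightarrow> ennreal" where
  "Lnorm p g =
     (if p = \<infinity> then esssup lborel g
      else ennreal_pow (\<integral>\<^sup>+ x. ennreal_pow (g x) (enn2real p) \<partial>lborel) (1 / enn2real p))"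

section \<open>Stein's spherical means and the local maximal function\<close>

definition ball_mean :: "complex \<Rightarrow> real \<Rightarrow> (real^'n::finite \<Rightarrow> complex) \<Rightarrow> real^'n \<Rightarrow> complex" where
  "ball_mean \<alpha> t f x =
     1 / Gamma \<alpha> * (LINT y:cball 0 1|lborel.
        complex_of_real (1 - (norm y)\<^sup>2) powr (\<alpha> - 1) * f (x - t *\<^sub>R y))"

text \<open>The analytic continuation in \<open>\<alpha>\<close> is the unique entire function agreeing with the integral
  on the right half plane. It exists for every Schwartz function f, every t > 0 and every x.\<close>
definition stein_mean :: "complex \<Rightarrow> real \<Rightarrow> (real^'n::finite \<Rightarrow> complex) \<Rightarrow> real^'n \<Rightarrow> complex" where
  "stein_mean \<alpha> t f x =
     (THE F. F holomorphic_on UNIV \<and> (\<forall>\<beta>. Re \<beta> > 0 \<longrightarrow> F \<beta> = ball_mean \<beta> t f x)) \<alpha>"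

definition stein_maximal :: "complex \<Rightarrow> (real^'n::finite \<Rightarrow> complex) \<Rightarrow> real^'n \<Rightarrow> ennreal" where
  "stein_maximal \<alpha> f x = (SUP t\<in>{1..2}. ennreal (norm (stein_mean \<alpha> t f x)))"

section \<open>The critical exponent\<close>

text \<open>Here \<open>1 / \<infinity> = 0\<close> in the extended nonnegative reals.\<close>
definition sigma_exponent :: "nat \<Rightarrow> ennreal \<Rightarrow> ennreal \<Rightarrow> real" where
  "sigma_exponent n p q =
     (let a = enn2real (1 / p); b = enn2real (1 / q)
      in Max {a - real n * b,
              (real n + 1) / 2 * a - (real n - 1) / 2 * (b + 1),
              real n * a - real n + 1})"

end

(*
For x at distance at least one from the support of f >= 0, let V(s) be the integral of f over the
ball of radius sqrt s around x. The mean of order alpha at time t is t^(-n-2 alpha+2) times the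
fractional integral of order alpha of V' at s = t^2, and V is smooth because V' is again a
ball integral, of the divergence of a smooth field; integrating by parts continues the fractional
integral to all orders, and the means Phi_alpha satisfy d/ds Phi_(alpha+1) = Phi_alpha.

If the mass of f near x lies in a shell of squared radii within w of B, then Phi_(alpha+m)
vanishes below B - 2w. For large m it is an absolutely convergent integral, of size at least
c w^(Re alpha+m-1) times the mass at s = B + Lw, where L is so large that the oscillation of the
kernel is harmless; integrating a bound for Phi_alpha m times gives at most a constant times
w^m sup |Phi_alpha|. Hence the maximal function at x is at least c w^(Re alpha-1) times the mass.

Thin spherical shells give the first lower bound for Re alpha, balls of radius d the third,
plates of size d x sqrt d x ... x sqrt d the second, and N distant translates give p <= q.
*)

theory Submission
  imports Defs "HOL-Real_Asymp.Real_Asymp"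
begin

section \<open>Smooth functions\<close>

text \<open>For small Re \<alpha> the mean is not an absolutely convergent integral: its
  continuation involves derivatives of \<open>f\<close> and has no sign, and non-real \<alpha> adds
  oscillation. So nothing can be bounded from below at order \<alpha> itself. Raising the order by
  \<open>m\<close> restores an honest kernel whose argument hardly varies across the shell. The
  price is exact: \<open>m\<close> integrations over a length comparable to \<open>w\<close> cost
  \<open>w ^ m\<close>, and the raised kernel has size \<open>w powr (Re \<alpha> - 1)\<close> times
  that same \<open>w ^ m\<close>. This needs a starting point at which all raised means vanish,
  hence the empty gap between the centre and the shell. Mass beyond distance 2 is invisible because
  t <= 2.

  The range 5/4 <= B <= 3 leaves room for [B - 2w, B + Lw] inside [1, 4], the squares of the
  admissible t.

  Every example is fed to one inequality, \<open>w powr (Re \<alpha> - 1) * J * |A| powr (1/q) <= C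
  * |D| powr (1/p)\<close>, where \<open>A\<close> is a set of centres, \<open>J\<close> a lower
  bound for the mass seen from them and \<open>D\<close> a set carrying the test function, which is
  at most 1. Comparing powers of the small parameter gives each condition.\<close>

definition cderiv :: "'n::finite \<Rightarrow> (real^'n \<Rightarrow> 'b::real_normed_vector) \<Rightarrow> real^'n \<Rightarrow> 'b" where
  "cderiv i f x = frechet_derivative f (at x) (axis i 1)"

text \<open>A finite order is carried along so that the product and chain rules can be proved by
  induction on \<open>k\<close>; \<open>smooth\<close> alone offers no induction. The codomain is
  general because the geometry uses real-valued functions while \<open>schwartz\<close> concerns
  complex-valued ones.\<close>

primrec Ck :: "nat \<Rightarrow> (real^'n::finite \<Rightarrow> 'b::real_normed_vector) \<Rightarrow> bool" where
  "Ck 0 f \<longleftrightarrow> continuous_on UNIV f"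
| "Ck (Suc k) f \<longleftrightarrow> (\<forall>x. f differentiable (at x)) \<and> (\<forall>i. Ck k (cderiv i f))"

definition smooth :: "(real^'n::finite \<Rightarrow> 'b::real_normed_vector) \<Rightarrow> bool" where
  "smooth f \<longleftrightarrow> (\<forall>k. Ck k f)"

section \<open>Closure properties of functions of finite order and of smooth functions\<close>

lemma cderiv_eq: "(f has_derivative f') (at x) \<Longrightarrow> cderiv i f x = f' (axis i 1)"
  by (simp add: cderiv_def frechet_derivative_at[symmetric])

lemma Ck_continuous: "Ck k f \<Longrightarrow> continuous_on UNIV f"
  by (cases k) (auto intro!: continuous_at_imp_continuous_on differentiable_imp_continuous_within)

lemma Ck_Suc_D: "Ck (Suc k) f \<Longrightarrow> Ck k f"
proof (induction k arbitrary: f)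
  case 0
  then show ?case using Ck_continuous by fastforce
next
  case (Suc k)
  then show ?case by (metis Ck.simps(2))
qed

lemma Ck_differentiable: "Ck (Suc k) f \<Longrightarrow> f differentiable (at x)"
  by simp

lemma Ck_SucI:
  assumes "\<And>x. (f has_derivative f' x) (at x)" "\<And>i. Ck k (\<lambda>x. f' x (axis i 1))"
  shows "Ck (Suc k) f"
proof -
  have "cderiv i f = (\<lambda>x. f' x (axis i 1))" for i
    using cderiv_eq[OF assms(1)] by blast
  then show ?thesis using assms by (auto simp: differentiable_def)
qed

lemma Ck_const: "Ck k (\<lambda>x. c)"
proof (induction k arbitrary: c)
  case (Suc k)
  show ?case by (rule Ck_SucI[where f'="\<lambda>x h. 0"]) (auto intro: Suc)
qed simp

lemma has_frechet: "f differentiable (at x) \<Longrightarrow> (f has_derivative frechet_derivative f (at x)) (at x)"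
  using frechet_derivative_works by blast

lemma Ck_add: "Ck k f \<Longrightarrow> Ck k g \<Longrightarrow> Ck k (\<lambda>x. f x + g x)"
proof (induction k arbitrary: f g)
  case (Suc k)
  show ?case
    by (rule Ck_SucI[where f'="\<lambda>x h. frechet_derivative f (at x) h + frechet_derivative g (at x) h"])
      (use Suc in \<open>auto intro!: has_derivative_add has_frechet simp: cderiv_def[symmetric]\<close>)
qed (auto intro!: continuous_intros)

lemma Ck_mult:
  fixes f g :: "real^'n::finite \<Rightarrow> 'b::real_normed_algebra"
  shows "Ck k f \<Longrightarrow> Ck k g \<Longrightarrow> Ck k (\<lambda>x. f x * g x)"
proof (induction k arbitrary: f g)
  case (Suc k)
  show ?case
  proof (rule Ck_SucI)
    fix x show "((\<lambda>x. f x * g x) has_derivative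
        (\<lambda>h. f x * frechet_derivative g (at x) h + frechet_derivative f (at x) h * g x)) (at x)"
      using Suc.prems by (intro has_derivative_mult has_frechet) auto
  next
    fix i
    show "Ck k (\<lambda>x. f x * frechet_derivative g (at x) (axis i 1) +
         frechet_derivative f (at x) (axis i 1) * g x)"
      unfolding cderiv_def[symmetric]
      using Suc.prems by (intro Ck_add Suc.IH) (auto dest: Ck_Suc_D simp del: Ck.simps(2), auto)
  qed
qed (auto intro!: continuous_intros)

lemma Ck_bounded_linear: "bounded_linear f \<Longrightarrow> Ck k f"
proof (cases k)
  case (Suc l)
  assume f: "bounded_linear f"
  show ?thesis unfolding Suc
    by (rule Ck_SucI[where f'="\<lambda>x. f"]) (auto intro: f bounded_linear_imp_has_derivative Ck_const)
qed (auto intro: linear_continuous_on)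

lemma Ck_linear_compose:
  assumes l: "bounded_linear l"
  shows "Ck k f \<Longrightarrow> Ck k (\<lambda>x. l (f x))"
proof (induction k arbitrary: f)
  case 0
  then show ?case using l by (auto intro: bounded_linear.continuous_on)
next
  case (Suc k)
  show ?case
    by (rule Ck_SucI[where f'="\<lambda>x h. l (frechet_derivative f (at x) h)"])
      (use Suc l in \<open>auto intro!: bounded_linear.has_derivative[OF l] has_frechet Suc.IH simp: cderiv_def[symmetric]\<close>)
qed

lemma Ck_sum: "(\<And>j. j \<in> A \<Longrightarrow> Ck k (f j)) \<Longrightarrow> Ck k (\<lambda>x. \<Sum>j\<in>A. f j x)"
  by (induction A rule: infinite_finite_induct) (auto intro: Ck_const Ck_add)

text \<open>The outer function comes with the whole sequence \<open>D\<close> of its derivatives,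
  because the chain rule replaces \<open>D j\<close> by \<open>D (Suc j)\<close>; the induction on
  \<open>k\<close> therefore needs every \<open>j\<close> at once.\<close>

lemma Ck_compose_real:
  fixes h :: "real^'n::finite \<Rightarrow> real" and D :: "nat \<Rightarrow> real \<Rightarrow> real"
  assumes D: "\<And>j x. (D j has_real_derivative D (Suc j) x) (at x)"
  shows "Ck k h \<Longrightarrow> Ck k (\<lambda>x. D j (h x))"
proof (induction k arbitrary: j)
  case 0
  have "continuous_on UNIV (D j)"
    using D by (intro continuous_at_imp_continuous_on) (auto intro: DERIV_isCont)
  then show ?case using 0 by (auto intro: continuous_on_compose2)
next
  case (Suc k)
  show ?case
  proof (rule Ck_SucI)
    fix x show "((\<lambda>x. D j (h x)) has_derivative (\<lambda>y. D (Suc j) (h x) * frechet_derivative h (at x) y)) (at x)"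
      using has_derivative_compose[OF has_frechet[of h x] D[unfolded has_field_derivative_def, of j "h x"]] Suc.prems
      by auto
  next
    fix i
    show "Ck k (\<lambda>x. D (Suc j) (h x) * frechet_derivative h (at x) (axis i 1))"
      unfolding cderiv_def[symmetric]
      using Suc.prems Ck_Suc_D[OF Suc.prems] by (intro Ck_mult Suc.IH) auto
  qed
qed

lemma Ck_compose_affine:
  fixes f :: "real^'n::finite \<Rightarrow> 'b::real_normed_vector"
  shows "Ck k f \<Longrightarrow> Ck k (\<lambda>x. f (a + c *\<^sub>R x))"
proof (induction k arbitrary: f)
  case 0
  then show ?case by (auto intro!: continuous_on_compose2[of UNIV f] continuous_intros)
next
  case (Suc k)
  show ?case
  proof (rule Ck_SucI)
    fix x
    have "((\<lambda>x. a + c *\<^sub>R x) has_derivative (\<lambda>h. c *\<^sub>R h)) (at x)"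
      by (auto intro!: derivative_eq_intros)
    from has_derivative_compose[OF this has_frechet]
    show "((\<lambda>x. f (a + c *\<^sub>R x)) has_derivative (\<lambda>h. frechet_derivative f (at (a + c *\<^sub>R x)) (c *\<^sub>R h))) (at x)"
      using Suc.prems by auto
  next
    fix i
    have "frechet_derivative f (at (a + c *\<^sub>R x)) (c *\<^sub>R axis i 1) = c *\<^sub>R cderiv i f (a + c *\<^sub>R x)" for x
      unfolding cderiv_def using Suc.prems
      by (auto intro!: linear_cmul linear_frechet_derivative)
    then show "Ck k (\<lambda>x. frechet_derivative f (at (a + c *\<^sub>R x)) (c *\<^sub>R axis i 1))"
      using Suc by (auto intro!: Ck_linear_compose[OF bounded_linear_scaleR_right])
  qed
qed

lemma smooth_continuous: "smooth f \<Longrightarrow> continuous_on UNIV f"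
  using Ck_continuous smooth_def by blast

lemma smooth_differentiable: "smooth f \<Longrightarrow> f differentiable (at x)"
  using Ck_differentiable smooth_def by blast

lemma smooth_cderiv: "smooth f \<Longrightarrow> smooth (cderiv i f)"
  unfolding smooth_def using Ck.simps(2) by blast

lemma smooth_const: "smooth (\<lambda>x. c)" by (simp add: smooth_def Ck_const)

lemma smooth_add: "smooth f \<Longrightarrow> smooth g \<Longrightarrow> smooth (\<lambda>x. f x + g x)"
  by (simp add: smooth_def Ck_add)

lemma smooth_mult:
  fixes f g :: "real^'n::finite \<Rightarrow> 'b::real_normed_algebra"
  shows "smooth f \<Longrightarrow> smooth g \<Longrightarrow> smooth (\<lambda>x. f x * g x)"
  by (simp add: smooth_def Ck_mult)

lemma smooth_sum: "(\<And>j. j \<in> A \<Longrightarrow> smooth (f j)) \<Longrightarrow> smooth (\<lambda>x. \<Sum>j\<in>A. f j x)"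
  by (simp add: smooth_def Ck_sum)

lemma smooth_component: "smooth (\<lambda>x::real^'n::finite. x $ i)"
  by (simp add: smooth_def Ck_bounded_linear bounded_linear_vec_nth)

lemma smooth_compose_affine: "smooth f \<Longrightarrow> smooth (\<lambda>x. f (a + c *\<^sub>R x))"
  by (simp add: smooth_def Ck_compose_affine)

lemma smooth_of_real:
  fixes f :: "real^'n::finite \<Rightarrow> real"
  shows "smooth f \<Longrightarrow> smooth (\<lambda>x. of_real (f x) :: 'b::{real_normed_algebra_1})"
  by (simp add: smooth_def Ck_linear_compose[OF bounded_linear_of_real])

lemma frechet_derivative_eq_sum_cderiv:
  fixes f :: "real^'n::finite \<Rightarrow> real"
  assumes "f differentiable (at x)"
  shows "frechet_derivative f (at x) h = (\<Sum>i\<in>UNIV. h $ i * cderiv i f x)"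
proof -
  have l: "linear (frechet_derivative f (at x))"
    using assms by (rule linear_frechet_derivative)
  have "h = (\<Sum>i\<in>UNIV. h $ i *\<^sub>R axis i 1)"
    by (simp add: vec_eq_iff axis_def if_distrib cong: if_cong)
  then have "frechet_derivative f (at x) h = frechet_derivative f (at x) (\<Sum>i\<in>UNIV. h $ i *\<^sub>R axis i 1)"
    by simp
  also have "\<dots> = (\<Sum>i\<in>UNIV. h $ i * cderiv i f x)"
    by (simp add: linear_sum[OF l] linear_cmul[OF l] cderiv_def)
  finally show ?thesis .
qed

lemma cderiv_zero_open:
  assumes "open S" "x \<in> S" "\<And>y. y \<in> S \<Longrightarrow> f y = 0"
  shows "cderiv i f x = 0"
proof -
  have "(f has_derivative (\<lambda>h. 0)) (at x)"
    by (rule has_derivative_transform_within_open[OF _ assms(1,2), of "\<lambda>x. 0"]) (auto simp: assms(3))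
  then show ?thesis by (rule cderiv_eq)
qed

lemma continuous_compact_support_bounded:
  fixes f :: "real^'n::finite \<Rightarrow> 'b::real_normed_vector"
  assumes "continuous_on UNIV f" "\<And>x. norm x > R \<Longrightarrow> f x = 0"
  shows "bounded (range f)"
proof -
  have "compact (f ` cball 0 R)"
    by (rule compact_continuous_image) (auto intro: continuous_on_subset[OF assms(1)])
  then have "bounded (insert 0 (f ` cball 0 R))" by (simp add: compact_imp_bounded)
  moreover have "range f \<subseteq> insert 0 (f ` cball 0 R)"
    using assms(2) by (force simp: not_less[symmetric])
  ultimately show ?thesis by (rule bounded_subset)
qed

text \<open>Vanishing outside a fixed ball passes to partial derivatives because the complement of
  the ball is open. Each weighted derivative is then continuous with compact support, hence
  bounded.\<close>

lemma schwartz_compact_support: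
  fixes f :: "real^'n::finite \<Rightarrow> complex"
  assumes f: "smooth f" and R: "\<And>x. norm x > R \<Longrightarrow> f x = 0"
  shows "schwartz f"
proof -
  have *: "smooth (iter_partial is f) \<and> (\<forall>x. norm x > R \<longrightarrow> iter_partial is f x = 0)" for "is"
  proof (induction "is")
    case Nil
    then show ?case using assms by simp
  next
    case (Cons i "is")
    have eq: "partial_deriv i (iter_partial is f) = cderiv i (iter_partial is f)"
      by (simp add: fun_eq_iff partial_deriv_def cderiv_def)
    have "cderiv i (iter_partial is f) x = 0" if "norm x > R" for x
      by (rule cderiv_zero_open[of "- cball 0 R"]) (use that Cons in auto)
    then show ?case using Cons eq by (simp add: smooth_cderiv)
  qed
  show ?thesis unfolding schwartz_def
  proof (intro conjI allI)
    fix "is" x show "iter_partial is f differentiable (at x)"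
      using * smooth_differentiable by blast
  next
    fix "is" N show "bounded (range (\<lambda>x. (1 + norm x) ^ N *\<^sub>R iter_partial is f x))"
      by (rule continuous_compact_support_bounded[where R=R])
        (use * in \<open>auto intro!: continuous_intros smooth_continuous[of "iter_partial is f"]\<close>)
  qed
qed

subsection \<open>A smooth cutoff\<close>

text \<open>Products of exp(-1/x) with polynomials in 1/x, extended by zero: a class that contains
  the standard flat function and is closed under differentiation, so one derivative rule yields all
  of them.\<close>

definition flat_poly :: "real poly \<Rightarrow> real \<Rightarrow> real" where
  "flat_poly p x = (if x > 0 then poly p (1 / x) * exp (- 1 / x) else 0)"

text \<open>With y = 1/x, the derivative of p(y) exp(-y) in x is y^2 (p(y) - p'(y)) exp(-y).\<close>

definition flat_deriv :: "real poly \<Rightarrow> real poly" where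
  "flat_deriv p = [:0, 0, 1:] * (p - pderiv p)"

lemma poly_times_exp_minus_tendsto_0:
  fixes p :: "real poly"
  shows "((\<lambda>y. poly p y * exp (- y)) \<longlongrightarrow> 0) at_top"
proof (induction p)
  case 0
  then show ?case by simp
next
  case (pCons a p)
  have "((\<lambda>y. y ^ i * exp (- y)) \<longlongrightarrow> (0::real)) at_top" for i
    using tendsto_power_div_exp_0[of i] by (simp add: exp_minus field_simps)
  then have "((\<lambda>y. \<Sum>i\<le>degree (pCons a p). coeff (pCons a p) i * (y ^ i * exp (- y))) \<longlongrightarrow> (\<Sum>i\<le>degree (pCons a p). coeff (pCons a p) i * 0)) at_top"
    by (intro tendsto_sum tendsto_mult tendsto_const)
  then show ?case
    by (simp add: poly_altdef sum_distrib_right mult.assoc del: mult_pCons_left)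
qed

lemma flat_poly_deriv: "(flat_poly p has_real_derivative flat_poly (flat_deriv p) x) (at x)"
proof -
  consider "x > 0" | "x < 0" | "x = 0" by linarith
  then show ?thesis
  proof cases
    case 1
    have "((\<lambda>x. poly p (1 / x) * exp (- 1 / x)) has_real_derivative flat_poly (flat_deriv p) x) (at x)"
      using 1 by (auto intro!: derivative_eq_intros DERIV_chain2[OF poly_DERIV] simp: flat_poly_def flat_deriv_def field_simps power2_eq_square)
    then show ?thesis
      by (rule has_field_derivative_transform_within_open[where S="{0<..}"])
        (use 1 in \<open>auto simp: flat_poly_def\<close>)
  next
    case 2
    have "((\<lambda>x. 0) has_real_derivative flat_poly (flat_deriv p) x) (at x)"
      using 2 by (simp add: flat_poly_def)
    then show ?thesis
      by (rule has_field_derivative_transform_within_open[where S="{..<0}"])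
        (use 2 in \<open>auto simp: flat_poly_def\<close>)
  next
    case 3
    \<comment> \<open>The difference quotient at 0 from the right is again of the flat form, with
      the polynomial multiplied by its variable.\<close>
    have "((\<lambda>h. flat_poly p h / h) \<longlongrightarrow> 0) (at_right 0)"
    proof -
      have "((\<lambda>h. poly ([:0,1:] * p) (inverse h) * exp (- (inverse h))) \<longlongrightarrow> 0) (at_right 0)"
        by (rule filterlim_compose[OF poly_times_exp_minus_tendsto_0 filterlim_inverse_at_top_right])
      then show ?thesis
        by (rule Lim_transform_eventually)
          (auto simp: eventually_at_filter flat_poly_def field_simps)
    qed
    moreover have "((\<lambda>h. flat_poly p h / h) \<longlongrightarrow> 0) (at_left 0)"
      by (rule Lim_transform_eventually[of "\<lambda>_. 0"])
        (auto simp: eventually_at_filter flat_poly_def)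
    ultimately have "((\<lambda>h. flat_poly p h / h) \<longlongrightarrow> 0) (at 0)"
      using filterlim_split_at by blast
    then show ?thesis using 3
      by (simp add: DERIV_def flat_poly_def)
  qed
qed

text \<open>This is exp(-1/x) for x > 0. It is no plateau function: the tests use only that it is at
  most 1, vanishes for x <= 0 and is at least \<open>exp (-2)\<close> from 1/2 on.\<close>

definition cutoff :: "real \<Rightarrow> real" where
  "cutoff = flat_poly 1"

lemma cutoff_nonneg: "0 \<le> cutoff x" and cutoff_le_1: "cutoff x \<le> 1"
  and cutoff_eq_0: "x \<le> 0 \<Longrightarrow> cutoff x = 0"
  by (auto simp: cutoff_def flat_poly_def)

lemma cutoff_ge: "x \<ge> 1/2 \<Longrightarrow> cutoff x \<ge> exp (-2)"
  by (simp add: cutoff_def flat_poly_def field_simps)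

lemma smooth_cutoff_compose:
  assumes "smooth h"
  shows "smooth (\<lambda>x. cutoff (h x))"
proof -
  define D where "D j = flat_poly ((flat_deriv ^^ j) 1)" for j
  have "(D j has_real_derivative D (Suc j) x) (at x)" for j x
    by (simp add: D_def flat_poly_deriv)
  from Ck_compose_real[where D=D, OF this, of _ h 0] assms
  show ?thesis by (simp add: smooth_def D_def cutoff_def)
qed


section \<open>Integrals over balls\<close>

text \<open>Here the origin is the point at which the mean is evaluated. The hole of radius
  \<open>r\<close> keeps the singularity of 1/|y|^2 away; \<open>R\<close> may be arbitrarily large
  and never enters a constant.\<close>

definition annular :: "real \<Rightarrow> real \<Rightarrow> (real^'n::finite \<Rightarrow> real) \<Rightarrow> bool" where
  "annular r R g \<longleftrightarrow> smooth g \<and> (\<forall>y. norm y < r \<longrightarrow> g y = 0) \<and> (\<forall>y. norm y > R \<longrightarrow> g y = 0)"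

text \<open>Using the squared radius as the variable turns the weight (t^2 - |y|^2)^(\<gamma>-1)
  into the kernel of a one-dimensional convolution.\<close>

definition ball_int :: "(real^'n::finite \<Rightarrow> real) \<Rightarrow> real \<Rightarrow> real" where
  "ball_int g s = (LINT y|lborel. indicator {y. (norm y)\<^sup>2 \<le> s} y * g y)"

definition cone_int :: "(real^'n::finite \<Rightarrow> real) \<Rightarrow> real \<Rightarrow> real" where
  "cone_int g s = (LINT y|lborel. max 0 (s - (norm y)\<^sup>2) * g y)"

lemma integrable_mult_compact_support:
  fixes h :: "real^'n::finite \<Rightarrow> real" and \<phi> :: "real^'n \<Rightarrow> real"
  assumes h: "continuous_on UNIV h" "\<And>y. norm y > R \<Longrightarrow> h y = 0"
    and \<phi>: "\<phi> \<in> borel_measurable borel" "\<And>y. norm y \<le> R \<Longrightarrow> \<bar>\<phi> y\<bar> \<le> M"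
  shows "integrable lborel (\<lambda>y. \<phi> y * h y)"
proof -
  obtain C where C: "\<And>y. \<bar>h y\<bar> \<le> C"
    using continuous_compact_support_bounded[OF h] by (auto simp: bounded_iff)
  show ?thesis
  proof (rule Bochner_Integration.integrable_bound)
    show "integrable lborel (\<lambda>y::real^'n. \<bar>M\<bar> * C * indicator (cball 0 R) y :: real)"
      by (intro integrable_mult_right integrable_real_indicator) (use emeasure_lborel_cball_finite[of "0::real^'n" R] in \<open>auto simp: infinity_ennreal_def\<close>)
    show "(\<lambda>y. \<phi> y * h y) \<in> borel_measurable lborel"
      using \<phi>(1) borel_measurable_continuous_onI[OF h(1)] by simp
    show "AE y in lborel. norm (\<phi> y * h y) \<le> norm (\<bar>M\<bar> * C * indicator (cball 0 R) y)"
    proof (rule AE_I2)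
      fix y
      have "C \<ge> 0" using C[of 0] by linarith
      show "norm (\<phi> y * h y) \<le> norm (\<bar>M\<bar> * C * indicator (cball 0 R) y)"
      proof (cases "norm y \<le> R")
        case True
        then show ?thesis using C[of y] \<phi>(2)[OF True] \<open>C \<ge> 0\<close>
          by (auto simp: abs_mult intro!: mult_mono)
      qed (use h(2) in auto)
    qed
  qed
qed

lemma AE_norm_sq_neq: "AE y in (lborel :: (real^'n::finite) measure). (norm y)\<^sup>2 \<noteq> s"
proof -
  have "{y::real^'n. (norm y)\<^sup>2 = s} \<subseteq> sphere 0 (sqrt s)"
    by (auto simp: real_sqrt_unique)
  moreover have "sphere (0::real^'n) (sqrt s) \<in> null_sets lborel"
    using negligible_sphere[of "0::real^'n" "sqrt s"]
    by (simp add: negligible_iff_null_sets null_sets_completion_iff)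
  ultimately show ?thesis
    by (intro AE_I[where N="sphere 0 (sqrt s)"]) (auto simp: null_sets_def)
qed

context
  fixes h :: "real^'n::finite \<Rightarrow> real" and R :: real
  assumes cont: "continuous_on UNIV h" and supp: "\<And>y. norm y > R \<Longrightarrow> h y = 0"
begin

text \<open>Dominated convergence: the indicators can fail to converge only on the sphere |y|^2 = s,
  which is a null set.\<close>

lemma isCont_ball_int: "isCont (ball_int h) s"
  unfolding continuous_at_sequentially comp_def
proof (intro allI impI)
  fix X assume X: "X \<longlonglongrightarrow> s"
  have meas[measurable]: "h \<in> borel_measurable borel"
    using cont by (rule borel_measurable_continuous_onI)
  show "(\<lambda>n. ball_int h (X n)) \<longlonglongrightarrow> ball_int h s"
    unfolding ball_int_def
  proof (rule integral_dominated_convergence[where w="\<lambda>y. \<bar>h y\<bar>"])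
    show "integrable lborel (\<lambda>y. \<bar>h y\<bar>)"
      using integrable_mult_compact_support[OF cont supp, where \<phi>="\<lambda>_. 1" and M=1] by simp
    show "AE y in lborel. (\<lambda>n. indicator {y. (norm y)\<^sup>2 \<le> X n} y * h y) \<longlonglongrightarrow> indicator {y. (norm y)\<^sup>2 \<le> s} y * h y"
      using AE_norm_sq_neq[of s]
    proof eventually_elim
      fix y :: "real^'n" assume "(norm y)\<^sup>2 \<noteq> s"
      then consider "(norm y)\<^sup>2 < s" | "(norm y)\<^sup>2 > s" by linarith
      then have "eventually (\<lambda>n. indicator {y. (norm y)\<^sup>2 \<le> X n} y = (indicator {y. (norm y)\<^sup>2 \<le> s} y :: real)) sequentially"
      proof cases
        case 1
        then show ?thesis using order_tendstoD(1)[OF X 1] by (auto elim!: eventually_mono)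
      next
        case 2
        then show ?thesis using order_tendstoD(2)[OF X 2] by (auto elim!: eventually_mono simp: indicator_def)
      qed
      then show "(\<lambda>n. indicator {y. (norm y)\<^sup>2 \<le> X n} y * h y) \<longlonglongrightarrow> indicator {y. (norm y)\<^sup>2 \<le> s} y * h y"
        by (intro tendsto_mult tendsto_const tendsto_eventually)
    qed
    show "AE y in lborel. norm (indicator {y. (norm y)\<^sup>2 \<le> X n} y * h y) \<le> \<bar>h y\<bar>" for n
      by (auto simp: indicator_def)
  qed measurable
qed

text \<open>Fubini: \<open>max 0 (s - |y|^2)\<close> is the length of the set of \<open>u\<close> in
  [0, s] with |y|^2 <= u. So \<open>cone_int\<close> is a primitive of \<open>ball_int\<close>, and
  a ball integral is known to be differentiable once it is rewritten as a cone integral.\<close>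

lemma cone_int_eq_integral:
  assumes "s \<ge> 0"
  shows "cone_int h s = integral {0..s} (ball_int h)"
proof -
  have meas[measurable]: "h \<in> borel_measurable borel"
    using cont by (rule borel_measurable_continuous_onI)
  obtain C where C: "\<And>y. \<bar>h y\<bar> \<le> C"
    using continuous_compact_support_bounded[OF cont supp] by (auto simp: bounded_iff)
  define f where "f u y = indicator {0..s} u * (indicator {y. (norm y)\<^sup>2 \<le> u} y * h y)" for u and y :: "real^'n"
  have fm: "case_prod f \<in> borel_measurable (lborel \<Otimes>\<^sub>M lborel)"
  proof -
    have "case_prod f = (\<lambda>z. (if fst z \<in> {0..s} \<and> (norm (snd z))\<^sup>2 \<le> fst z then h (snd z) else 0))"
      by (auto simp: f_def fun_eq_iff indicator_def)
    then show ?thesis by simp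
  qed
  have int: "integrable (lborel \<Otimes>\<^sub>M lborel) (case_prod f)"
  proof (rule Bochner_Integration.integrable_bound[OF _ fm])
    have "emeasure (lborel \<Otimes>\<^sub>M lborel) ({0..s} \<times> cball (0::real^'n) R) < \<infinity>"
      by (subst lborel.emeasure_pair_measure_Times)
        (use emeasure_lborel_cball_finite[of "0::real^'n" R] in \<open>auto simp: infinity_ennreal_def ennreal_mult_less_top emeasure_lborel_Icc_eq\<close>)
    then show "integrable (lborel \<Otimes>\<^sub>M lborel) (\<lambda>z. C * indicator ({0..s} \<times> cball (0::real^'n) R) z :: real)"
      by (intro integrable_mult_right) (auto intro!: pair_measureI integrable_real_indicator)
    show "AE z in lborel \<Otimes>\<^sub>M lborel. norm (case z of (x, xa) \<Rightarrow> f x xa) \<le> norm (C * indicator ({0..s} \<times> cball (0::real^'n) R) z :: real)"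
    proof (rule AE_I2, clarify)
      fix u and y :: "real^'n"
      show "norm (f u y) \<le> norm (C * indicator ({0..s} \<times> cball (0::real^'n) R) (u, y) :: real)"
        using C[of y] supp[of y] by (cases "norm y \<le> R") (auto simp: f_def indicator_def)
    qed
  qed
  have inner: "(LINT u|lborel. f u y) = max 0 (s - (norm y)\<^sup>2) * h y" for y
  proof -
    have "(LINT u|lborel. f u y) = (LINT u|lborel. indicator {(norm y)\<^sup>2..s} u * h y)"
    proof (rule Bochner_Integration.integral_cong[OF refl])
      fix u show "f u y = indicator {(norm y)\<^sup>2..s} u * h y"
        by (auto simp: f_def indicator_def intro: order_trans[of 0 "(norm y)\<^sup>2" u])
    qed
    also have "\<dots> = measure lborel {(norm y)\<^sup>2..s} * h y" by simp
    also have "\<dots> = max 0 (s - (norm y)\<^sup>2) * h y"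
      by (auto simp: max_def)
    finally show ?thesis .
  qed
  have "cone_int h s = (LINT y|lborel. LINT u|lborel. f u y)"
    by (simp add: cone_int_def inner)
  also have "\<dots> = (LINT u|lborel. LINT y|lborel. f u y)"
    by (rule lborel_pair.Fubini_integral[OF int])
  also have "\<dots> = (LINT u:{0..s}|lborel. ball_int h u)"
    by (simp add: f_def ball_int_def set_lebesgue_integral_def)
  also have "\<dots> = integral {0..s} (ball_int h)"
    by (intro set_borel_integral_eq_integral borel_integrable_atLeastAtMost')
      (auto intro!: continuous_at_imp_continuous_on isCont_ball_int)
  finally show ?thesis .
qed

lemma cone_int_deriv:
  assumes "s > 0"
  shows "(cone_int h has_real_derivative ball_int h s) (at s)"
proof -
  have "((\<lambda>s. integral {0..s} (ball_int h)) has_real_derivative ball_int h s) (at s within {0..s+1})"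
    by (rule integral_has_real_derivative)
      (use assms in \<open>auto intro!: continuous_at_imp_continuous_on isCont_ball_int\<close>)
  then have "((\<lambda>s. integral {0..s} (ball_int h)) has_real_derivative ball_int h s) (at s)"
    using assms by (simp add: at_within_Icc_at)
  then show ?thesis
    by (rule has_field_derivative_transform_within_open[where S="{0<..}"])
      (use assms in \<open>auto simp: cone_int_eq_integral\<close>)
qed

end

section \<open>Differentiation of ball integrals with respect to the squared radius\<close>

lemma lborel_integral_scale:
  fixes F :: "real^'n::finite \<Rightarrow> 'b::{banach, second_countable_topology}"
  assumes [measurable]: "F \<in> borel_measurable borel" and c: "c > 0"
  shows "(LINT z|lborel. F z) = c ^ CARD('n) *\<^sub>R (LINT y|lborel. F (c *\<^sub>R y))"
proof -
  have "(LINT z|lborel. F z) = (LINT z|density (distr lborel borel (\<lambda>x::real^'n. 0 + c *\<^sub>R x)) (\<lambda>_. ennreal (c ^ CARD('n))). F z)"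
    using lborel_affine[of c "0::real^'n"] c by simp
  also have "\<dots> = (LINT z|distr lborel borel (\<lambda>x::real^'n. 0 + c *\<^sub>R x). c ^ CARD('n) *\<^sub>R F z)"
    using c by (subst integral_density) auto
  also have "\<dots> = (LINT y|lborel. c ^ CARD('n) *\<^sub>R F (0 + c *\<^sub>R y))"
    by (subst integral_distr) auto
  finally show ?thesis by simp
qed

text \<open>Near the origin the product is identically zero, whatever value \<open>inverse 0\<close>
  has. The induction must cover all powers of 1/|y|^2, since differentiating the \<open>j\<close>-th
  one produces the next, times a coordinate that is absorbed into \<open>g\<close>.\<close>

lemma smooth_mult_inverse_norm_sq:
  fixes g :: "real^'n::finite \<Rightarrow> real"
  assumes "smooth g" "\<And>y. norm y < 1 \<Longrightarrow> g y = 0"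
  shows "smooth (\<lambda>y. inverse ((norm y)\<^sup>2) * g y)"
proof -
  define q where "q j y = inverse (y \<bullet> y) ^ j" for j and y :: "real^'n"
  have "Ck k (\<lambda>y. q j y * g y)" if "Ck k g" "\<And>y. norm y < 1 \<Longrightarrow> g y = 0" for k j g
    using that
  proof (induction k arbitrary: j g)
    case (0 j g)
    show ?case unfolding Ck.simps
    proof (rule continuous_at_imp_continuous_on, rule ballI)
      fix y :: "real^'n"
      show "isCont (\<lambda>y. q j y * g y) y"
      proof (cases "y = 0")
        case True
        have "isCont (\<lambda>y. 0::real) y" by simp
        moreover have "eventually (\<lambda>y. q j y * g y = 0) (nhds y)"
          using 0 True by (intro eventually_nhds_in_open[of "ball 0 1" y, THEN eventually_mono]) auto
        ultimately show ?thesis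
          using isCont_cong[of "\<lambda>y. q j y * g y" "\<lambda>_. 0" y] by simp
      next
        case False
        then show ?thesis using 0 unfolding q_def
          by (auto intro!: continuous_intros simp: continuous_on_eq_continuous_at)
      qed
    qed
  next
    case (Suc k j g)
    show ?case
    proof (rule Ck_SucI)
      fix y :: "real^'n"
      show "((\<lambda>y. q j y * g y) has_derivative
        (\<lambda>h. q j y * frechet_derivative g (at y) h - 2 * real j * (q (Suc j) y * (g y * (y \<bullet> h))))) (at y)"
      proof (cases "y = 0")
        case True
        have z: "(g has_derivative (\<lambda>h. 0)) (at y)"
          by (rule has_derivative_transform_within_open[of "\<lambda>_. 0" _ _ _ "ball 0 1"]) (use Suc True in auto)
        have fz: "frechet_derivative g (at y) = (\<lambda>h. 0)"
          using frechet_derivative_at[OF z] by simp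
        have "((\<lambda>y. q j y * g y) has_derivative (\<lambda>h. 0)) (at y)"
          by (rule has_derivative_transform_within_open[of "\<lambda>_. 0" _ _ _ "ball 0 1"]) (use Suc True in auto)
        then show ?thesis using fz True Suc.prems(2)[of 0] by simp
      next
        case False
        have "((\<lambda>y. q j y * g y) has_derivative
          (\<lambda>h. q j y * frechet_derivative g (at y) h + (real j * (- (inverse (y \<bullet> y) * (y \<bullet> h + h \<bullet> y) * inverse (y \<bullet> y))) * inverse (y \<bullet> y) ^ (j - 1)) * g y)) (at y)"
        proof -
          have "((\<lambda>y. inverse (y \<bullet> y)) has_derivative (\<lambda>h. - (inverse (y \<bullet> y) * (y \<bullet> h + h \<bullet> y) * inverse (y \<bullet> y)))) (at y)"
            by (intro Deriv.has_derivative_inverse has_derivative_inner has_derivative_ident) (use False in auto)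
          from has_derivative_mult[OF has_derivative_power[OF this, of j] has_frechet[of g y]] Suc.prems(1)
          show ?thesis unfolding q_def by (simp add: mult_ac add_ac)
        qed
        then show ?thesis
          by (rule has_derivative_eq_rhs) (cases j; auto simp: q_def fun_eq_iff inner_commute algebra_simps)
      qed
    next
      fix i
      have eq: "(\<lambda>y. q j y * frechet_derivative g (at y) (axis i 1) - 2 * real j * (q (Suc j) y * (g y * (y \<bullet> axis i 1)))) =
        (\<lambda>y. q j y * cderiv i g y + (- 2 * real j) * (q (Suc j) y * (g y * (y $ i))))"
        by (simp add: cderiv_def fun_eq_iff inner_axis)
      have "cderiv i g y = 0" if "norm y < 1" for y
        by (rule cderiv_zero_open[of "ball 0 1"]) (use that Suc.prems in auto)
      then have 1: "Ck k (\<lambda>y. q j y * cderiv i g y)"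
        using Suc.prems(1) by (intro Suc.IH) auto
      have "Ck k (\<lambda>y. g y * y $ i)"
        using Ck_Suc_D[OF Suc.prems(1)] by (intro Ck_mult Ck_bounded_linear[OF bounded_linear_vec_nth])
      then have 2: "Ck k (\<lambda>y. q (Suc j) y * (g y * y $ i))"
        using Suc.prems(2) by (intro Suc.IH) auto
      show "Ck k (\<lambda>y. q j y * frechet_derivative g (at y) (axis i 1) - 2 * real j * (q (Suc j) y * (g y * (y \<bullet> axis i 1))))"
        unfolding eq by (rule Ck_add[OF 1 Ck_mult[OF Ck_const 2]])
    qed
  qed
  from this[where j=1] show ?thesis using assms by (simp add: smooth_def q_def power2_norm_eq_inner)
qed

definition euler :: "(real^'n::finite \<Rightarrow> real) \<Rightarrow> real^'n \<Rightarrow> real" where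
  "euler h y = (\<Sum>i\<in>UNIV. y $ i * cderiv i h y)"

text \<open>This stands in for the divergence theorem. The integral \<open>H l\<close> of
  \<open>K y * h (l y)\<close>, with \<open>K\<close> the cone weight, is differentiated at l = 1 in
  two ways: under the integral sign, giving \<open>euler h\<close>, and after the substitution z = l
  y, giving powers of \<open>l\<close> times \<open>cone_int h (s * l^2)\<close>.\<close>

lemma euler_cone_int:
  fixes h :: "real^'n::finite \<Rightarrow> real"
  assumes h: "smooth h" "\<And>y. norm y > R \<Longrightarrow> h y = 0" and s: "s > 0"
  shows "2 * s * ball_int h s = cone_int (euler h) s + (real CARD('n) + 2) * cone_int h s"
proof -
  define K where "K y = max 0 (s - (norm y)\<^sup>2)" for y :: "real^'n"
  have contK: "continuous_on A K" for A unfolding K_def by (intro continuous_intros)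
  have conth: "continuous_on A h" for A using smooth_continuous[OF h(1)] continuous_on_subset by blast
  have contd: "continuous_on A (cderiv i h)" for A i
    using smooth_continuous[OF smooth_cderiv[OF h(1)]] continuous_on_subset by blast
  have contE: "continuous_on A (euler h)" for A
    unfolding euler_def by (intro continuous_intros contd)
  obtain a where a: "cball (0::real^'n) (sqrt s) \<subseteq> cbox (-a) a"
    using bounded_subset_cbox_symmetric[OF bounded_cball] by blast
  have K0: "K y = 0" if "y \<notin> cbox (-a) a" for y
  proof -
    have "norm y > sqrt s" using a that by (force simp: not_less[symmetric])
    then have "(norm y)\<^sup>2 > s"
      using real_sqrt_less_iff[of s "(norm y)\<^sup>2"] by simp
    then show ?thesis by (simp add: K_def)
  qed
  \<comment> \<open>The box contains the support of \<open>K\<close> and does not depend on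
    \<open>l\<close>, so the Leibniz rule for integrals over a fixed box applies.\<close>
  have lint: "(LINT y|lborel. K y * F y) = integral (cbox (-a) a) (\<lambda>y. K y * F y)" if "continuous_on UNIV F" for F
  proof -
    have "(LINT y|lborel. K y * F y) = (LINT y:cbox (-a) a|lborel. K y * F y)"
      unfolding set_lebesgue_integral_def
      by (rule Bochner_Integration.integral_cong) (auto simp: indicator_def K0)
    also have "\<dots> = integral (cbox (-a) a) (\<lambda>y. K y * F y)"
      by (intro set_borel_integral_eq_integral borel_integrable_compact[unfolded set_integrable_def[symmetric]])
        (auto simp: set_integrable_def intro!: borel_integrable_compact continuous_intros contK continuous_on_subset[OF that])
    finally show ?thesis .
  qed
  define H where "H l = integral (cbox (-a) a) (\<lambda>y. K y * h (l *\<^sub>R y))" for l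
  have "(H has_vector_derivative integral (cbox (-a) a) (\<lambda>y. K y * (\<Sum>i\<in>UNIV. y $ i * cderiv i h (1 *\<^sub>R y)))) (at 1 within {0<..})"
    unfolding H_def
  proof (rule leibniz_rule_vector_derivative[where fx="\<lambda>l y. K y * (\<Sum>i\<in>UNIV. y $ i * cderiv i h (l *\<^sub>R y))"])
    fix l :: real and y :: "real^'n"
    have "((\<lambda>l. h (l *\<^sub>R y)) has_derivative (\<lambda>c. frechet_derivative h (at (l *\<^sub>R y)) (c *\<^sub>R y))) (at l)"
      by (rule has_derivative_compose[OF _ has_frechet])
        (auto intro: bounded_linear_imp_has_derivative bounded_linear_scaleR_left smooth_differentiable[OF h(1)])
    then have "((\<lambda>l. h (l *\<^sub>R y)) has_real_derivative (\<Sum>i\<in>UNIV. y $ i * cderiv i h (l *\<^sub>R y))) (at l)"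
      unfolding has_field_derivative_def
      by (rule has_derivative_eq_rhs)
        (simp add: fun_eq_iff frechet_derivative_eq_sum_cderiv smooth_differentiable[OF h(1)] sum_distrib_left mult_ac)
    then show "((\<lambda>l. K y * h (l *\<^sub>R y)) has_vector_derivative K y * (\<Sum>i\<in>UNIV. y $ i * cderiv i h (l *\<^sub>R y))) (at l within {0<..})"
      unfolding has_real_derivative_iff_has_vector_derivative[symmetric]
      by (rule has_field_derivative_at_within[OF DERIV_cmult])
  next
    fix l :: real
    show "(\<lambda>y. K y * h (l *\<^sub>R y)) integrable_on cbox (-a) a"
      by (intro integrable_continuous continuous_intros contK continuous_on_compose2[OF conth[of UNIV]]) auto
  next
    show "continuous_on ({0<..} \<times> cbox (-a) a) (\<lambda>(l, y). K y * (\<Sum>i\<in>UNIV. y $ i * cderiv i h (l *\<^sub>R y)))"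
      unfolding case_prod_beta
      by (intro continuous_intros continuous_on_compose2[OF contd[of UNIV]] continuous_on_compose2[OF contK[of UNIV]]) auto
  qed auto
  then have D1: "(H has_real_derivative cone_int (euler h) s) (at 1)"
    using lint[OF contE] by (simp add: has_real_derivative_iff_has_vector_derivative at_within_open[of 1 "{0<..}"]
        cone_int_def euler_def K_def)
  \<comment> \<open>The exponent n + 2 collects n from the volume element and 2 from the homogeneity
    of the cone weight.\<close>
  have Heq: "H l = inverse (l ^ (CARD('n) + 2)) * cone_int h (s * l\<^sup>2)" if pos: "l > 0" for l
  proof -
    have "H l = (LINT y|lborel. K y * h (l *\<^sub>R y))"
      unfolding H_def by (rule lint[symmetric]) (auto intro!: continuous_intros continuous_on_compose2[OF conth[of UNIV]])
    moreover have "(LINT z|lborel. max 0 (s * l\<^sup>2 - (norm z)\<^sup>2) * h z)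
      = l ^ CARD('n) * (LINT y|lborel. max 0 (s * l\<^sup>2 - (norm (l *\<^sub>R y))\<^sup>2) * h (l *\<^sub>R y))"
      by (subst lborel_integral_scale[OF _ pos])
        (auto intro!: borel_measurable_continuous_onI continuous_intros conth)
    moreover have "max 0 (s * l\<^sup>2 - (norm (l *\<^sub>R y))\<^sup>2) = l\<^sup>2 * K y" for y
    proof -
      have "s * l\<^sup>2 - (norm (l *\<^sub>R y))\<^sup>2 = l\<^sup>2 * (s - (norm y)\<^sup>2)"
        by (simp add: power_mult_distrib algebra_simps)
      then show ?thesis using pos by (auto simp: K_def max_def zero_le_mult_iff mult_le_0_iff)
    qed
    ultimately show ?thesis using pos
      by (simp add: cone_int_def mult.assoc field_simps power2_eq_square power_add)
  qed
  have "((\<lambda>l. inverse (l ^ (CARD('n) + 2)) * cone_int h (s * l\<^sup>2)) has_real_derivative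
      - (real CARD('n) + 2) * cone_int h s + 2 * s * ball_int h s) (at 1)"
    using s by (auto intro!: derivative_eq_intros DERIV_chain2[OF cone_int_deriv[OF conth h(2)]] simp: field_simps)
  then have "(H has_real_derivative - (real CARD('n) + 2) * cone_int h s + 2 * s * ball_int h s) (at 1)"
    by (rule has_field_derivative_transform_within_open[where S="{0<..}"]) (auto simp: Heq)
  from DERIV_unique[OF this D1] show ?thesis by (simp add: algebra_simps)
qed

text \<open>The divergence of \<open>y g / (2 |y|\<^sup>2)\<close>, a vector field along which \<open>|y|\<^sup>2\<close> grows at unit rate:
  its integral over a ball is the derivative of the integral of \<open>g\<close>.\<close>
definition radial_div :: "(real^'n::finite \<Rightarrow> real) \<Rightarrow> real^'n \<Rightarrow> real" where
  "radial_div g y = (1/2) * (real CARD('n) * (inverse ((norm y)\<^sup>2) * g y) + euler (\<lambda>y. inverse ((norm y)\<^sup>2) * g y) y)"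

lemma annular_mult_inverse_norm_sq:
  assumes "annular r R g" "r \<ge> 1"
  shows "annular r R (\<lambda>y. inverse ((norm y)\<^sup>2) * g y)"
  using assms by (auto simp: annular_def intro!: smooth_mult_inverse_norm_sq)

lemma annular_euler:
  assumes "annular r R h"
  shows "annular r R (euler h)"
proof -
  have "cderiv i h y = 0" if "norm y < r" for i y
    by (rule cderiv_zero_open[of "ball 0 r"]) (use that assms in \<open>auto simp: annular_def\<close>)
  moreover have "cderiv i h y = 0" if "norm y > R" for i y
    by (rule cderiv_zero_open[of "- cball 0 R"]) (use that assms in \<open>auto simp: annular_def\<close>)
  moreover have "smooth (euler h)"
    unfolding euler_def[abs_def] using assms
    by (intro smooth_sum smooth_mult smooth_component smooth_cderiv) (auto simp: annular_def)
  ultimately show ?thesis by (simp add: annular_def euler_def)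
qed

lemma annular_radial_div:
  assumes "annular r R g" "r \<ge> 1"
  shows "annular r R (radial_div g)"
  using annular_mult_inverse_norm_sq[OF assms] annular_euler[OF annular_mult_inverse_norm_sq[OF assms]]
    smooth_mult[OF smooth_const smooth_add[OF smooth_mult[OF smooth_const]], of "\<lambda>y. inverse ((norm y)\<^sup>2) * g y" "euler (\<lambda>y. inverse ((norm y)\<^sup>2) * g y)" "1/2" "real CARD('a)"]
  by (auto simp: annular_def radial_div_def[abs_def])

lemma annular_continuous: "annular r R g \<Longrightarrow> continuous_on A g"
  using continuous_on_subset[OF smooth_continuous] by (auto simp: annular_def)

lemma ball_int_zero:
  assumes "annular r R g" "s < r\<^sup>2" "r > 0"
  shows "ball_int g s = 0"
proof -
  have eq: "indicat_real {y. (norm y)\<^sup>2 \<le> s} y * g y = 0" for y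
  proof (cases "norm y < r")
    case False
    then have "r\<^sup>2 \<le> (norm y)\<^sup>2" using assms(3) by (intro power_mono) auto
    then show ?thesis using assms(2) by simp
  qed (use assms in \<open>auto simp: annular_def\<close>)
  show ?thesis unfolding ball_int_def eq by simp
qed

text \<open>With g = |y|^2 h, splitting the cone weight gives
  \<open>ball_int g s = s * ball_int h s - cone_int h s\<close>. Eliminating
  \<open>s * ball_int h s\<close> by Euler's identity leaves exactly
  \<open>cone_int (radial_div g) s\<close>, whose derivative is a ball integral.\<close>

lemma ball_int_deriv:
  fixes g :: "real^'n::finite \<Rightarrow> real"
  assumes g: "annular r R g" and r: "r \<ge> 1"
  shows "(ball_int g has_real_derivative ball_int (radial_div g) s) (at s)"
proof -
  define h where "h = (\<lambda>y. inverse ((norm y)\<^sup>2) * g y)"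
  have h: "annular r R h" unfolding h_def by (rule annular_mult_inverse_norm_sq[OF g r])
  have eh: "annular r R (euler h)" by (rule annular_euler[OF h])
  have supp: "norm y > R \<Longrightarrow> h y = 0" "norm y > R \<Longrightarrow> euler h y = 0" "norm y > R \<Longrightarrow> g y = 0" for y
    using h eh g by (auto simp: annular_def)
  note cont = annular_continuous[OF h, of UNIV] annular_continuous[OF eh, of UNIV] annular_continuous[OF g, of UNIV]
  have gh: "g y = (norm y)\<^sup>2 * h y" for y
    using g r by (cases "y = 0") (auto simp: h_def annular_def)
  have eq: "ball_int g s = cone_int (radial_div g) s" if s: "s > 0" for s
  proof -
    have i1: "integrable lborel (\<lambda>y. max 0 (s - (norm y)\<^sup>2) * h y)"
      by (rule integrable_mult_compact_support[OF cont(1) supp(1), where M=s])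
        (use s in auto)
    have i2: "integrable lborel (\<lambda>y. max 0 (s - (norm y)\<^sup>2) * euler h y)"
      by (rule integrable_mult_compact_support[OF cont(2) supp(2), where M=s])
        (use s in auto)
    have i3: "integrable lborel (\<lambda>y. indicator {y. (norm y)\<^sup>2 \<le> s} y * h y)"
      by (rule integrable_mult_compact_support[OF cont(1) supp(1), where M=1]) (auto simp: indicator_def)
    have i4: "integrable lborel (\<lambda>y. indicator {y. (norm y)\<^sup>2 \<le> s} y * g y)"
      by (rule integrable_mult_compact_support[OF cont(3) supp(3), where M=1]) (auto simp: indicator_def)
    have "cone_int h s = (LINT y|lborel. s * (indicator {y. (norm y)\<^sup>2 \<le> s} y * h y) - indicator {y. (norm y)\<^sup>2 \<le> s} y * g y)"
      unfolding cone_int_def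
      by (rule Bochner_Integration.integral_cong) (auto simp: indicator_def gh max_def algebra_simps)
    also have "\<dots> = s * ball_int h s - ball_int g s"
      using i3 i4 by (simp add: ball_int_def)
    finally have 1: "ball_int g s = s * ball_int h s - cone_int h s" by simp
    have "cone_int (radial_div g) s = (LINT y|lborel. (real CARD('n) / 2) * (max 0 (s - (norm y)\<^sup>2) * h y) + (1/2) * (max 0 (s - (norm y)\<^sup>2) * euler h y))"
      unfolding cone_int_def radial_div_def h_def[symmetric]
      by (rule Bochner_Integration.integral_cong) (auto simp: h_def algebra_simps)
    also have "\<dots> = (real CARD('n) / 2) * cone_int h s + (1/2) * cone_int (euler h) s"
      using i1 i2 by (simp add: cone_int_def)
    finally have 2: "cone_int (radial_div g) s = (real CARD('n) / 2) * cone_int h s + (1/2) * cone_int (euler h) s" .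
    have "2 * s * ball_int h s = cone_int (euler h) s + (real CARD('n) + 2) * cone_int h s"
      by (rule euler_cone_int[of h R]) (use h supp s in \<open>auto simp: annular_def\<close>)
    then show ?thesis using 1 2 by (simp add: field_simps)
  qed
  have L: "annular r R (radial_div g)" by (rule annular_radial_div[OF g r])
  show ?thesis
  proof (cases "s > 0")
    case True
    have "(cone_int (radial_div g) has_real_derivative ball_int (radial_div g) s) (at s)"
      by (rule cone_int_deriv[OF annular_continuous[OF L]]) (use L True in \<open>auto simp: annular_def\<close>)
    then show ?thesis
      by (rule has_field_derivative_transform_within_open[where S="{0<..}"]) (use True eq in auto)
  next
    case False
    have r2: "1 \<le> r\<^sup>2" using r by (simp add: one_le_power)
    have "((\<lambda>s. 0) has_real_derivative ball_int (radial_div g) s) (at s)"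
      using ball_int_zero[OF L, of s] False r r2 by simp
    then show ?thesis
      by (rule has_field_derivative_transform_within_open[where S="{..<1}"])
        (use False r ball_int_zero[OF g less_le_trans[OF _ r2]] in auto)
  qed
qed


section \<open>Fractional integrals and their continuation in the order\<close>

lemma continuous_on_of_real_powr:
  assumes "\<And>z. z \<in> A \<Longrightarrow> f z \<ge> 0" "\<And>z. z \<in> A \<Longrightarrow> f z = 0 \<Longrightarrow> Re (g z) > 0"
    "continuous_on A f" "continuous_on A g"
  shows "continuous_on A (\<lambda>z. complex_of_real (f z) powr g z)"
  using assms by (intro continuous_on_powr_complex continuous_on_of_real) auto

lemma has_vector_derivative_of_real_powr:
  assumes "u > 0"
  shows "((\<lambda>u. complex_of_real u powr \<gamma>) has_vector_derivative \<gamma> * complex_of_real u powr (\<gamma> - 1)) (at u)"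
proof -
  have "((\<lambda>z. z powr \<gamma>) has_field_derivative \<gamma> * complex_of_real u powr (\<gamma> - 1)) (at (complex_of_real u))"
    using assms by (intro has_field_derivative_powr) (auto simp: complex_nonpos_Reals_iff)
  from has_vector_derivative_real_field[OF this] show ?thesis by simp
qed

lemma powr_diff_one_mult:
  assumes "u \<ge> 0"
  shows "complex_of_real u powr (\<gamma> - 1) * of_real u = of_real u powr \<gamma>"
  by (cases "u = 0") (auto simp: powr_diff)

lemma continuous_on_mult_ln: "continuous_on {0..c} (\<lambda>u::real. u * ln u)"
proof (rule continuous_on_eq_continuous_within[THEN iffD2], rule ballI)
  fix u assume u: "u \<in> {0..c}"
  show "continuous (at u within {0..c}) (\<lambda>u. u * ln u)"
  proof (cases "u = 0")
    case False
    then have "isCont (\<lambda>u. u * ln u) u" using u by (intro continuous_intros) auto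
    then show ?thesis by (rule continuous_at_imp_continuous_at_within)
  next
    case True
    have "((\<lambda>u::real. u * ln u) \<longlongrightarrow> 0) (at_right 0)" by real_asymp
    then have "((\<lambda>u::real. u * ln u) \<longlongrightarrow> 0) (at 0 within {0..c})"
      by (rule tendsto_mono[rotated]) (unfold at_within_def, intro inf_mono order_refl, auto)
    then show ?thesis using True by (simp add: continuous_within)
  qed
qed

text \<open>For 0 < Re \<gamma> < 1 the integrand is unbounded at 0; it is dominated by a multiple
  of u^(Re \<gamma> - 1), which is integrable there.\<close>

lemma set_integrable_of_real_powr_mult:
  fixes F :: "real \<Rightarrow> complex"
  assumes F: "continuous_on {0..c} F" and \<gamma>: "Re \<gamma> > 0" and c: "c \<ge> 0"
  shows "set_integrable lborel {0..c} (\<lambda>u. complex_of_real u powr (\<gamma> - 1) * F u)"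
proof -
  have "bounded (F ` {0..c})"
    using F by (intro compact_imp_bounded compact_continuous_image) auto
  then obtain M where "\<forall>y\<in>F ` {0..c}. norm y \<le> M" unfolding bounded_iff by metis
  then have M: "norm (F u) \<le> M" if "u \<in> {0..c}" for u using that by simp
  obtain G where G: "G = (\<lambda>u. indicator {0..c} u *\<^sub>R F u)" by simp
  then have [measurable]: "G \<in> borel_measurable borel"
    using F by (auto intro!: borel_measurable_continuous_on_indicator)
  have pw: "set_integrable lborel {0..c} (\<lambda>u. u powr (Re \<gamma> - 1))"
  proof -
    have "(\<lambda>u. u powr (Re \<gamma> - 1)) absolutely_integrable_on {0..c}"
      using has_integral_powr_from_0[of "Re \<gamma> - 1" c] \<gamma> c
      by (intro nonnegative_absolutely_integrable_1) (auto simp: integrable_on_def)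
    then show ?thesis
      unfolding set_integrable_def by (subst (asm) integrable_completion) auto
  qed
  show ?thesis unfolding set_integrable_def
  proof (rule Bochner_Integration.integrable_bound)
    show "integrable lborel (\<lambda>u. M * (indicator {0..c} u *\<^sub>R u powr (Re \<gamma> - 1)))"
      using pw by (intro integrable_mult_right) (simp add: set_integrable_def)
    have eq: "indicator {0..c} u *\<^sub>R (complex_of_real u powr (\<gamma> - 1) * F u) = complex_of_real u powr (\<gamma> - 1) * G u" for u
      by (simp add: G)
    show "(\<lambda>u. indicator {0..c} u *\<^sub>R (complex_of_real u powr (\<gamma> - 1) * F u)) \<in> borel_measurable lborel"
      unfolding eq unfolding powr_def by measurable
    show "AE u in lborel. norm (indicator {0..c} u *\<^sub>R (complex_of_real u powr (\<gamma> - 1) * F u))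
       \<le> norm (M * (indicator {0..c} u *\<^sub>R u powr (Re \<gamma> - 1)))"
    proof (rule AE_I2)
      fix u :: real
      show "norm (indicator {0..c} u *\<^sub>R (complex_of_real u powr (\<gamma> - 1) * F u))
       \<le> norm (M * (indicator {0..c} u *\<^sub>R u powr (Re \<gamma> - 1)))"
      proof (cases "u \<in> {0..c}")
        case True
        then have "norm (F u) \<le> \<bar>M\<bar>" using M[OF True] by linarith
        then show ?thesis using True
          by (auto simp: norm_mult norm_powr_real_powr mult.commute abs_mult intro!: mult_right_mono)
      qed simp
    qed
  qed
qed

text \<open>The Riemann-Liouville integral of order \<gamma>. For \<open>W\<close> vanishing below 1
  and s <= 5 the integrand is zero beyond u = 5, so the fixed upper limit loses nothing and keeps
  the domain independent of \<open>s\<close>. Taking 5 rather than 4 leaves an open neighbourhood of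
  the squared times t^2 <= 4. With \<open>rGamma\<close> in place of 1/Gamma there are no poles to
  avoid.\<close>

definition frac_int :: "complex \<Rightarrow> (real \<Rightarrow> real) \<Rightarrow> real \<Rightarrow> complex" where
  "frac_int \<gamma> W s = rGamma \<gamma> * integral {0..5} (\<lambda>u. of_real u powr (\<gamma> - 1) * of_real (W (s - u)))"

lemma continuous_on_frac_kernel:
  assumes W: "continuous_on UNIV W" and \<gamma>: "Re \<gamma> > 1"
  shows "continuous_on (A \<times> {0..c}) (\<lambda>x. complex_of_real (snd x) powr (\<gamma> - 1) * of_real (W (fst x - snd x)))"
proof (intro continuous_on_mult continuous_on_of_real continuous_on_of_real_powr continuous_on_const)
  show "continuous_on (A \<times> {0..c}) (\<lambda>x. W (fst x - snd x))"
    by (rule continuous_on_compose2[OF W]) (intro continuous_intros, simp)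
qed (use \<gamma> in \<open>auto intro!: continuous_intros\<close>)

lemma continuous_on_frac_kernel':
  assumes W: "continuous_on UNIV W" and \<gamma>: "Re \<gamma> > 1"
  shows "continuous_on {0..c} (\<lambda>u. complex_of_real u powr (\<gamma> - 1) * of_real (W (s - u)))"
proof -
  have "continuous_on {0..c} (Pair s)" "Pair s ` {0..c} \<subseteq> {s} \<times> {0..c}"
    by (auto intro!: continuous_intros)
  from continuous_on_compose2[OF continuous_on_frac_kernel[OF assms, of "{s}" c] this] show ?thesis by simp
qed

text \<open>Integration by parts with u^\<gamma> W(s - u), which vanishes at u = 0 because Re
  \<gamma> > 0 and at u = 5 because W(s - 5) = 0. The factor \<gamma> is absorbed by the functional
  equation of \<open>rGamma\<close>.\<close>

lemma frac_int_shift: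
  assumes W: "\<And>x. (W has_real_derivative W' x) (at x)" "continuous_on UNIV W'"
    and s: "W (s - 5) = 0" and \<gamma>: "Re \<gamma> > 0"
  shows "frac_int \<gamma> W s = frac_int (\<gamma> + 1) W' s"
proof -
  have contW: "continuous_on A W" for A
    using W(1) by (intro continuous_at_imp_continuous_on) (auto intro: DERIV_isCont)
  have contW': "continuous_on A W'" for A using W(2) continuous_on_subset by blast
  define I1 where "I1 = (\<lambda>u. complex_of_real u powr (\<gamma> - 1) * of_real (W (s - u)))"
  define I2 where "I2 = (\<lambda>u. complex_of_real u powr \<gamma> * of_real (W' (s - u)))"
  define f where "f u = complex_of_real u powr \<gamma> * of_real (W (s - u))" for u
  have i1: "I1 integrable_on {0..5}" unfolding I1_def
    by (intro set_borel_integral_eq_integral set_integrable_of_real_powr_mult \<gamma> continuous_on_of_real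
        continuous_on_compose2[OF contW[of UNIV]]) (auto intro!: continuous_intros)
  have i2: "I2 integrable_on {0..5}" unfolding I2_def
    using continuous_on_frac_kernel'[OF contW', of "\<gamma> + 1" 5 s] \<gamma> by (intro integrable_continuous_interval) simp
  have "((\<lambda>u. \<gamma> * I1 u - I2 u) has_integral f 5 - f 0) {0..5}"
  proof (rule fundamental_theorem_of_calculus_interior)
    show "continuous_on {0..5} f" unfolding f_def
      using continuous_on_frac_kernel'[OF contW, of "\<gamma> + 1" 5 s] \<gamma> by simp
  next
    fix u :: real assume u: "u \<in> {0<..<5}"
    have "((\<lambda>u. W (s - u)) has_real_derivative W' (s - u) * (0 - 1)) (at u)"
      by (rule DERIV_chain2[OF W(1)]) (auto intro!: derivative_eq_intros)
    then have "((\<lambda>u. W (s - u)) has_vector_derivative - W' (s - u)) (at u)"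
      by (simp add: has_real_derivative_iff_has_vector_derivative)
    then have "((\<lambda>u. complex_of_real (W (s - u))) has_vector_derivative of_real (- W' (s - u))) (at u)"
      by (rule bounded_linear.has_vector_derivative[OF bounded_linear_of_real])
    from has_vector_derivative_mult[OF has_vector_derivative_of_real_powr this, of \<gamma>] u
    show "(f has_vector_derivative \<gamma> * I1 u - I2 u) (at u)"
      unfolding f_def I1_def I2_def by (simp add: algebra_simps)
  qed auto
  moreover have "f 5 - f 0 = 0" by (simp add: f_def s)
  ultimately have "integral {0..5} (\<lambda>u. \<gamma> * I1 u - I2 u) = 0" by (simp add: integral_unique)
  then have eq: "\<gamma> * integral {0..5} I1 = integral {0..5} I2"
    using integral_diff[OF integrable_on_mult_right[OF i1] i2, of \<gamma>] by simp
  have "frac_int \<gamma> W s = (\<gamma> * rGamma (\<gamma> + 1)) * integral {0..5} I1"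
    by (simp only: frac_int_def rGamma_plus1 I1_def)
  also have "\<dots> = rGamma (\<gamma> + 1) * integral {0..5} I2"
    by (simp add: eq[symmetric] mult_ac)
  finally show ?thesis by (simp add: frac_int_def I2_def)
qed

text \<open>Differentiation under the integral sign. The margin Re \<gamma> > 2 is generous so that
  the logarithm produced by the derivative is tamed up to u = 0.\<close>

lemma frac_int_holomorphic:
  assumes W: "continuous_on UNIV W"
  shows "(\<lambda>\<gamma>. frac_int \<gamma> W s) holomorphic_on {\<gamma>. Re \<gamma> > 2}"
proof -
  have "(\<lambda>\<gamma>. integral (cbox 0 5) (\<lambda>u. of_real u powr (\<gamma> - 1) * complex_of_real (W (s - u)))) holomorphic_on {\<gamma>. Re \<gamma> > 2}"
  proof (rule leibniz_rule_holomorphic[where fx="\<lambda>\<gamma> u. Ln (of_real u) * of_real u powr (\<gamma> - 1) * of_real (W (s - u))"])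
    fix \<gamma> and u :: real assume "\<gamma> \<in> {\<gamma>. Re \<gamma> > 2}" "u \<in> cbox 0 5"
    show "((\<lambda>\<gamma>. complex_of_real u powr (\<gamma> - 1) * of_real (W (s - u))) has_field_derivative
       Ln (of_real u) * of_real u powr (\<gamma> - 1) * of_real (W (s - u))) (at \<gamma> within {\<gamma>. Re \<gamma> > 2})"
    proof (cases "u = 0")
      case False
      have "((\<lambda>\<gamma>. complex_of_real u powr (\<gamma> - 1)) has_field_derivative Ln (of_real u) * of_real u powr (\<gamma> - 1) * 1) (at \<gamma>)"
        by (rule DERIV_chain2[OF has_field_derivative_powr_right]) (use False in \<open>auto intro!: derivative_eq_intros\<close>)
      then show ?thesis
        by (intro DERIV_cmult_right) (simp add: has_field_derivative_at_within)
    qed simp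
  next
    fix \<gamma> assume "\<gamma> \<in> {\<gamma>. Re \<gamma> > 2}"
    then show "(\<lambda>u. of_real u powr (\<gamma> - 1) * complex_of_real (W (s - u))) integrable_on cbox 0 5"
      unfolding cbox_interval
      by (intro integrable_continuous_interval continuous_on_frac_kernel'[OF W]) auto
  next
    \<comment> \<open>The logarithm is paired with one factor \<open>u\<close>: both
      \<open>u * ln u\<close> and u^(\<gamma>-2) extend continuously to u = 0.\<close>
    have "continuous_on ({\<gamma>. Re \<gamma> > 2} \<times> cbox 0 5) (\<lambda>x. complex_of_real (snd x * ln (snd x)) * (of_real (snd x) powr (fst x - 2) * of_real (W (s - snd x))))"
    proof -
      have 1: "continuous_on ({\<gamma>. Re \<gamma> > 2} \<times> cbox 0 5) (\<lambda>x. snd x * ln (snd x :: real))"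
        by (rule continuous_on_compose2[OF continuous_on_mult_ln[of 5]]) (auto intro!: continuous_intros)
      have 2: "continuous_on ({\<gamma>. Re \<gamma> > 2} \<times> cbox 0 5) (\<lambda>x. W (s - snd x))"
        by (rule continuous_on_compose2[OF W]) (auto intro!: continuous_intros)
      have 3: "continuous_on ({\<gamma>. Re \<gamma> > 2} \<times> cbox 0 5) (\<lambda>x. complex_of_real (snd x) powr (fst x - 2))"
        by (rule continuous_on_of_real_powr) (auto intro!: continuous_intros)
      show ?thesis by (rule continuous_on_mult[OF continuous_on_of_real[OF 1] continuous_on_mult[OF 3 continuous_on_of_real[OF 2]]])
    qed
    then show "continuous_on ({\<gamma>. Re \<gamma> > 2} \<times> cbox 0 5) (\<lambda>(\<gamma>, u). Ln (complex_of_real u) * of_real u powr (\<gamma> - 1) * of_real (W (s - u)))"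
    proof (rule continuous_on_eq)
      fix x assume x: "x \<in> {\<gamma>. 2 < Re \<gamma>} \<times> cbox (0::real) 5"
      obtain \<gamma> u where xx: "x = (\<gamma>, u)" by (cases x)
      have u: "u \<ge> 0" using x xx by simp
      have p: "complex_of_real u powr (\<gamma> - 1) = of_real u powr (\<gamma> - 2) * of_real u"
        using powr_diff_one_mult[OF u, of "\<gamma> - 1"] by simp
      show "complex_of_real (snd x * ln (snd x)) * (of_real (snd x) powr (fst x - 2) * of_real (W (s - snd x))) =
        (case x of (\<gamma>, u) \<Rightarrow> Ln (complex_of_real u) * of_real u powr (\<gamma> - 1) * of_real (W (s - u)))"
        unfolding xx using u by (cases "u = 0") (auto simp: p Ln_of_real)
    qed
  qed (rule convex_halfspace_Re_gt)
  then show ?thesis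
    unfolding frac_int_def cbox_interval[symmetric] by (intro holomorphic_intros)
qed

lemma frac_int_deriv:
  assumes W: "\<And>x. (W has_real_derivative W' x) (at x)" "continuous_on UNIV W'" and \<gamma>: "Re \<gamma> > 1"
  shows "(frac_int \<gamma> W has_vector_derivative frac_int \<gamma> W' s) (at s)"
proof -
  have contW: "continuous_on A W" for A
    using W(1) by (intro continuous_at_imp_continuous_on) (auto intro: DERIV_isCont)
  have "((\<lambda>s. integral (cbox 0 5) (\<lambda>u. of_real u powr (\<gamma> - 1) * complex_of_real (W (s - u)))) has_vector_derivative
     integral (cbox 0 5) (\<lambda>u. of_real u powr (\<gamma> - 1) * complex_of_real (W' (s - u)))) (at s within UNIV)"
  proof (rule leibniz_rule_vector_derivative[where fx="\<lambda>s u. of_real u powr (\<gamma> - 1) * complex_of_real (W' (s - u))"])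
    fix s u :: real
    have "((\<lambda>s. W (s - u)) has_real_derivative W' (s - u) * 1) (at s)"
      by (rule DERIV_chain2[OF W(1)]) (auto intro!: derivative_eq_intros)
    then have "((\<lambda>s. W (s - u)) has_vector_derivative W' (s - u)) (at s)"
      by (simp add: has_real_derivative_iff_has_vector_derivative)
    then have "((\<lambda>s. complex_of_real (W (s - u))) has_vector_derivative of_real (W' (s - u))) (at s)"
      by (rule bounded_linear.has_vector_derivative[OF bounded_linear_of_real])
    then show "((\<lambda>s. of_real u powr (\<gamma> - 1) * complex_of_real (W (s - u))) has_vector_derivative of_real u powr (\<gamma> - 1) * of_real (W' (s - u))) (at s within UNIV)"
      by (rule has_vector_derivative_mult_right)
  next
    fix s
    show "(\<lambda>u. of_real u powr (\<gamma> - 1) * complex_of_real (W (s - u))) integrable_on cbox 0 5"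
      unfolding cbox_interval
      by (intro integrable_continuous_interval continuous_on_frac_kernel'[OF contW]) (use \<gamma> in auto)
  next
    show "continuous_on (UNIV \<times> cbox 0 5) (\<lambda>(s, u). of_real u powr (\<gamma> - 1) * complex_of_real (W' (s - u)))"
      unfolding case_prod_beta
      using continuous_on_frac_kernel[OF W(2) \<gamma>, of UNIV 5] by simp
  qed auto
  from has_vector_derivative_mult_right[OF this, of "rGamma \<gamma>"]
  show ?thesis unfolding frac_int_def by simp
qed

text \<open>Abstracts the ball integral \<open>W 0\<close> with all its derivatives. The means are
  fractional integrals of \<open>W 1\<close>, which is why orders raised by \<open>N\<close> are
  paired below with \<open>W (Suc N)\<close>.\<close>

locale flat_chain =
  fixes W :: "nat \<Rightarrow> real \<Rightarrow> real"
  assumes deriv: "\<And>k s. (W k has_real_derivative W (Suc k) s) (at s)"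
    and zero: "\<And>k s. s < 1 \<Longrightarrow> W k s = 0"
begin

lemma cont: "continuous_on A (W k)"
  using deriv by (intro continuous_at_imp_continuous_on) (auto intro: DERIV_isCont)

lemma frac_int_shift_add:
  assumes "Re \<gamma> > 0" "s \<le> 5"
  shows "frac_int \<gamma> (W k) s = frac_int (\<gamma> + of_nat M) (W (k + M)) s"
proof (induction M)
  case (Suc M)
  have "frac_int (\<gamma> + of_nat M) (W (k + M)) s = frac_int (\<gamma> + of_nat M + 1) (W (Suc (k + M))) s"
    by (rule frac_int_shift[OF deriv cont]) (use assms zero in auto)
  then show ?case using Suc by (simp add: add_ac)
qed simp

text \<open>The number of integrations by parts is chosen so large that the integral converges.\<close>
definition mean :: "complex \<Rightarrow> real \<Rightarrow> complex" where
  "mean \<beta> s = (let N = nat \<lceil>3 - Re \<beta>\<rceil> in frac_int (\<beta> + of_nat N) (W (Suc N)) s)"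

text \<open>Any two admissible numbers of integrations by parts differ by finitely many shifts, so
  the particular choice in \<open>mean\<close> is immaterial.\<close>

lemma mean_eq:
  assumes "Re \<beta> + real N > 0" "s \<le> 5"
  shows "mean \<beta> s = frac_int (\<beta> + of_nat N) (W (Suc N)) s"
proof -
  define N' where "N' = nat \<lceil>3 - Re \<beta>\<rceil>"
  have N': "Re \<beta> + real N' \<ge> 3" unfolding N'_def by linarith
  show ?thesis
  proof (cases "N \<le> N'")
    case True
    then show ?thesis
      using frac_int_shift_add[of "\<beta> + of_nat N" s "Suc N" "N' - N"] assms
      by (simp add: mean_def N'_def[symmetric] of_nat_diff)
  next
    case False
    then show ?thesis
      using frac_int_shift_add[of "\<beta> + of_nat N'" s "Suc N'" "N - N'"] assms N'
      by (simp add: mean_def N'_def[symmetric] of_nat_diff)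
  qed
qed

text \<open>The number of integrations by parts chosen in \<open>mean\<close> jumps with Re \<beta>.
  Around a given \<open>z\<close>, however, one fixed \<open>N\<close> serves the whole half plane
  Re \<beta> > 2 - N, where \<open>frac_int\<close> is holomorphic.\<close>

lemma mean_holomorphic:
  assumes "s \<le> 5"
  shows "(\<lambda>\<beta>. mean \<beta> s) holomorphic_on UNIV"
proof -
  have "(\<lambda>\<beta>. mean \<beta> s) field_differentiable (at z)" for z
  proof -
    define N where "N = nat \<lceil>3 - Re z\<rceil>"
    have N: "Re z + real N \<ge> 3" unfolding N_def by linarith
    have "(\<lambda>\<beta>. frac_int (\<beta> + of_nat N) (W (Suc N)) s) holomorphic_on {\<beta>. Re \<beta> > 2 - real N}"
      by (rule holomorphic_on_compose_gen[OF _ frac_int_holomorphic[OF cont], unfolded comp_def])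
        (auto intro!: holomorphic_intros)
    then have "(\<lambda>\<beta>. mean \<beta> s) holomorphic_on {\<beta>. Re \<beta> > 2 - real N}"
      by (rule holomorphic_transform) (use assms in \<open>auto intro!: mean_eq[symmetric]\<close>)
    then show ?thesis
      using N by (auto simp: holomorphic_on_open open_halfspace_Re_gt field_differentiable_def)
  qed
  then show ?thesis by (simp add: holomorphic_on_def field_differentiable_at_within)
qed

text \<open>Representing \<open>mean \<beta>\<close> with one more integration by parts than
  \<open>mean (\<beta> + 1)\<close> gives both the same fractional order, so differentiation only
  advances the index of \<open>W\<close>.\<close>

lemma mean_deriv:
  assumes "s < 5"
  shows "(mean (\<beta> + 1) has_vector_derivative mean \<beta> s) (at s)"
proof -
  define N where "N = nat \<lceil>3 - Re \<beta>\<rceil>"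
  have N: "Re \<beta> + real N \<ge> 3" unfolding N_def by linarith
  have "(frac_int (\<beta> + 1 + of_nat N) (W (Suc N)) has_vector_derivative frac_int (\<beta> + 1 + of_nat N) (W (Suc (Suc N))) s) (at s)"
    by (rule frac_int_deriv[OF deriv cont]) (use N in auto)
  moreover have "mean \<beta> s = frac_int (\<beta> + 1 + of_nat N) (W (Suc (Suc N))) s"
    using mean_eq[of \<beta> "Suc N" s] N assms by (simp add: add_ac)
  moreover have "mean (\<beta> + 1) s' = frac_int (\<beta> + 1 + of_nat N) (W (Suc N)) s'" if "s' < 5" for s'
    using mean_eq[of "\<beta> + 1" N s'] N that by (simp add: add_ac)
  ultimately show ?thesis
    using has_vector_derivative_transform_within_open[of "frac_int (\<beta> + 1 + of_nat N) (W (Suc N))" _ s "{..<5}" "mean (\<beta> + 1)"] assms by auto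
qed

lemma mean_zero:
  assumes "\<And>k x. x \<le> s \<Longrightarrow> W k x = 0"
  shows "mean \<beta> s = 0"
proof -
  have "integral {0..5} (\<lambda>u. of_real u powr (\<gamma> - 1) * complex_of_real (W k (s - u))) = 0" for \<gamma> k
    using integral_cong[of "{0..5}" "\<lambda>u. of_real u powr (\<gamma> - 1) * complex_of_real (W k (s - u))" "\<lambda>_. 0"] assms by simp
  then show ?thesis by (simp add: mean_def Let_def frac_int_def)
qed

end


section \<open>The means of a function supported away from the centre\<close>

lemma annular_radial_div_iter:
  "annular r R g \<Longrightarrow> r \<ge> 1 \<Longrightarrow> annular r R ((radial_div ^^ k) g)"
  by (induction k) (auto intro: annular_radial_div)

lemma flat_chain_ball_int:
  assumes "annular r R g" "r \<ge> 1"
  shows "flat_chain (\<lambda>k. ball_int ((radial_div ^^ k) g))"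
proof
  fix k s
  show "(ball_int ((radial_div ^^ k) g) has_real_derivative ball_int ((radial_div ^^ Suc k) g) s) (at s)"
    using ball_int_deriv[OF annular_radial_div_iter[OF assms] assms(2)] by simp
next
  fix k and s :: real assume "s < 1"
  moreover have "1 \<le> r\<^sup>2" using assms(2) by (simp add: one_le_power)
  ultimately have "s < r\<^sup>2" by linarith
  then show "ball_int ((radial_div ^^ k) g) s = 0"
    using assms(2) by (intro ball_int_zero[OF annular_radial_div_iter[OF assms]]) auto
qed

section \<open>Polar coordinates as an image measure, and identification with the means of
  Stein\<close>

lemma annular_integrable:
  assumes "annular r R g" "\<phi> \<in> borel_measurable borel" "\<And>y. \<bar>\<phi> y\<bar> \<le> M"
  shows "integrable lborel (\<lambda>y. \<phi> y * g y)"
  by (rule integrable_mult_compact_support[of g R \<phi> M])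
    (use assms annular_continuous[OF assms(1)] in \<open>auto simp: annular_def\<close>)

text \<open>The sign of \<open>radial_div g\<close> itself is unknown, but its ball integral is the
  derivative of the nondecreasing function \<open>ball_int g\<close>.\<close>

lemma ball_int_radial_div_nonneg:
  assumes g: "annular r R g" "r \<ge> 1" "\<And>y. g y \<ge> 0"
  shows "ball_int (radial_div g) s \<ge> 0"
proof (rule ccontr)
  assume "\<not> ball_int (radial_div g) s \<ge> 0"
  then obtain d where d: "d > 0" "\<And>h. h > 0 \<Longrightarrow> h < d \<Longrightarrow> ball_int g s > ball_int g (s + h)"
    using DERIV_neg_dec_right[OF ball_int_deriv[OF g(1,2), of s]] by auto
  have "ball_int g s \<le> ball_int g (s + d / 2)"
    unfolding ball_int_def
    by (intro integral_mono annular_integrable[OF g(1), where M=1])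
      (use d g(3) in \<open>auto simp: indicator_def\<close>)
  then show False using d(2)[of "d/2"] d(1) by simp
qed

text \<open>Replaces polar coordinates. Both measures are finite on half-lines and agree there: each
  gives the half-line above \<open>x\<close> the total mass minus \<open>ball_int g x\<close>, one
  by definition and the other by the fundamental theorem of calculus.\<close>

lemma distr_norm_sq:
  fixes g :: "real^'n::finite \<Rightarrow> real"
  assumes g: "annular r R g" "r \<ge> 1" "\<And>y. g y \<ge> 0"
  shows "distr (density lborel (\<lambda>y. ennreal (g y))) borel (\<lambda>y. (norm y)\<^sup>2)
    = density lborel (\<lambda>s. ennreal (ball_int (radial_div g) s))"
proof -
  define F where "F = ball_int g"
  define f where "f = ball_int (radial_div g)"
  have Ff: "(F has_real_derivative f s) (at s)" for s
    unfolding F_def f_def by (rule ball_int_deriv[OF g(1,2)])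
  have f0: "f s \<ge> 0" for s unfolding f_def by (rule ball_int_radial_div_nonneg[OF g])
  have [measurable]: "f \<in> borel_measurable borel"
    unfolding f_def using ball_int_deriv[OF annular_radial_div[OF g(1,2)] g(2)]
    by (intro borel_measurable_continuous_onI continuous_at_imp_continuous_on) (auto intro: DERIV_isCont)
  have [measurable]: "g \<in> borel_measurable borel"
    by (intro borel_measurable_continuous_onI annular_continuous[OF g(1)])
  have ig: "integrable lborel g" using annular_integrable[OF g(1), of "\<lambda>_. 1" 1] by simp
  define T where "T = (LINT y|lborel. g y)"
  have FT: "F s = T" if "s \<ge> (max R 0)\<^sup>2" for s
    unfolding F_def T_def ball_int_def
  proof (rule Bochner_Integration.integral_cong[OF refl])
    fix y :: "real^'n"
    show "indicator {y. (norm y)\<^sup>2 \<le> s} y * g y = g y"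
    proof (cases "norm y > R")
      case False
      then have "(norm y)\<^sup>2 \<le> (max R 0)\<^sup>2" by (intro power_mono) auto
      then have "(norm y)\<^sup>2 \<le> s" using that by linarith
      then show ?thesis by simp
    qed (use g in \<open>auto simp: annular_def\<close>)
  qed
  have lim: "(F \<longlongrightarrow> T) at_top"
    by (rule tendsto_eventually) (rule eventually_mono[OF eventually_ge_at_top FT])
  have L: "emeasure (distr (density lborel (\<lambda>y. ennreal (g y))) borel (\<lambda>y. (norm y)\<^sup>2)) {x<..} = ennreal (T - F x)" for x
  proof -
    have "emeasure (distr (density lborel (\<lambda>y. ennreal (g y))) borel (\<lambda>y. (norm y)\<^sup>2)) {x<..}
      = (\<integral>\<^sup>+y. ennreal (g y) * indicator {y. x < (norm y)\<^sup>2} y \<partial>lborel)"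
      by (subst emeasure_distr) (auto simp: emeasure_density greaterThan_def vimage_def)
    also have "\<dots> = (\<integral>\<^sup>+y. ennreal (indicator {y. x < (norm y)\<^sup>2} y * g y) \<partial>lborel)"
      by (intro nn_integral_cong) (auto simp: indicator_def)
    also have "\<dots> = ennreal (LINT y|lborel. indicator {y. x < (norm y)\<^sup>2} y * g y)"
      by (intro nn_integral_eq_integral annular_integrable[OF g(1), where M=1]) (auto simp: g(3) indicator_def)
    also have "(LINT y|lborel. indicator {y. x < (norm y)\<^sup>2} y * g y) = (LINT y|lborel. g y - indicator {y. (norm y)\<^sup>2 \<le> x} y * g y)"
      by (rule Bochner_Integration.integral_cong) (auto simp: indicator_def)
    also have "\<dots> = T - F x"
      unfolding T_def F_def ball_int_def
      by (intro Bochner_Integration.integral_diff ig annular_integrable[OF g(1), where M=1]) (auto simp: indicator_def)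
    finally show ?thesis .
  qed
  show ?thesis
    unfolding f_def[symmetric]
  proof (rule measure_eqI_lessThan)
    fix x
    show "emeasure (distr (density lborel (\<lambda>y. ennreal (g y))) borel (\<lambda>y. (norm y)\<^sup>2)) {x<..} < \<infinity>"
      by (simp add: L)
    have "emeasure (density lborel (\<lambda>s. ennreal (f s))) {x<..} = (\<integral>\<^sup>+s. ennreal (f s) * indicator {x<..} s \<partial>lborel)"
      by (simp add: emeasure_density)
    also have "\<dots> = (\<integral>\<^sup>+s. ennreal (f s) * indicator {x..} s \<partial>lborel)"
      by (rule nn_integral_cong_AE) (use AE_lborel_singleton[of x] in \<open>auto elim!: eventually_mono simp: indicator_def\<close>)
    also have "\<dots> = ennreal (T - F x)"
      by (rule nn_integral_FTC_atLeast[OF _ Ff f0 lim]) auto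
    finally show "emeasure (distr (density lborel (\<lambda>y. ennreal (g y))) borel (\<lambda>y. (norm y)\<^sup>2)) {x<..}
      = emeasure (density lborel (\<lambda>s. ennreal (f s))) {x<..}" by (simp add: L)
  qed auto
qed

lemma integral_radial_mult:
  fixes g :: "real^'n::finite \<Rightarrow> real" and \<phi> :: "real \<Rightarrow> complex"
  assumes g: "annular r R g" "r \<ge> 1" "\<And>y. g y \<ge> 0" and [measurable]: "\<phi> \<in> borel_measurable borel"
  shows "(LINT y|lborel. g y *\<^sub>R \<phi> ((norm y)\<^sup>2)) = (LINT s|lborel. ball_int (radial_div g) s *\<^sub>R \<phi> s)"
proof -
  have [measurable]: "ball_int (radial_div g) \<in> borel_measurable borel"
    using ball_int_deriv[OF annular_radial_div[OF g(1,2)] g(2)]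
    by (intro borel_measurable_continuous_onI continuous_at_imp_continuous_on) (auto intro: DERIV_isCont)
  have [measurable]: "g \<in> borel_measurable borel"
    by (intro borel_measurable_continuous_onI annular_continuous[OF g(1)])
  have "(LINT y|lborel. g y *\<^sub>R \<phi> ((norm y)\<^sup>2)) = (LINT y|density lborel (\<lambda>y. ennreal (g y)). \<phi> ((norm y)\<^sup>2))"
    by (subst integral_density) (auto simp: g)
  also have "\<dots> = (LINT s|distr (density lborel (\<lambda>y. ennreal (g y))) borel (\<lambda>y. (norm y)\<^sup>2). \<phi> s)"
    by (subst integral_distr) auto
  also have "\<dots> = (LINT s|lborel. ball_int (radial_div g) s *\<^sub>R \<phi> s)"
    unfolding distr_norm_sq[OF g]
    by (subst integral_density) (auto simp: ball_int_radial_div_nonneg[OF g])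
  finally show ?thesis .
qed

text \<open>The truncation has to be explicit, because the complex power of a negative real number
  is not zero.\<close>

definition ball_kernel :: "complex \<Rightarrow> real \<Rightarrow> real \<Rightarrow> complex" where
  "ball_kernel \<gamma> S s = (if s \<le> S then complex_of_real (S - s) powr (\<gamma> - 1) else 0)"

lemma ball_kernel_measurable [measurable]: "ball_kernel \<gamma> S \<in> borel_measurable borel"
  unfolding ball_kernel_def[abs_def] powr_def by measurable

locale annular_fun =
  fixes g :: "real^'n::finite \<Rightarrow> real" and r R :: real
  assumes annular: "annular r R g" and r: "r \<ge> 1" and nonneg: "\<And>y. g y \<ge> 0"

sublocale annular_fun \<subseteq> flat_chain "\<lambda>k. ball_int ((radial_div ^^ k) g)"
  by (rule flat_chain_ball_int[OF annular r])

context annular_fun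
begin

text \<open>For Re \<gamma> > 0 no integration by parts is needed, so this is \<open>mean_eq\<close>
  with N = 0 after passing to the image measure under |y|^2 and substituting u = S - s.\<close>

lemma mean_eq_integral:
  assumes \<gamma>: "Re \<gamma> > 0" and S: "S \<le> 5"
  shows "mean \<gamma> S = rGamma \<gamma> * (LINT y|lborel. g y *\<^sub>R ball_kernel \<gamma> S ((norm y)\<^sup>2))"
proof -
  define W where "W = ball_int (radial_div g)"
  have contW: "continuous_on A W" for A using cont[of A 1] by (simp add: W_def)
  have W0: "W s = 0" if "s < 1" for s using zero[OF that, of 1] by (simp add: W_def)
  have "(LINT y|lborel. g y *\<^sub>R ball_kernel \<gamma> S ((norm y)\<^sup>2)) = (LINT s|lborel. W s *\<^sub>R ball_kernel \<gamma> S s)"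
    unfolding W_def by (rule integral_radial_mult[OF annular r nonneg]) auto
  also have "\<dots> = (LINT u|lborel. W (S + (-1) * u) *\<^sub>R ball_kernel \<gamma> S (S + (-1) * u))"
    by (subst lborel_integral_real_affine[where c="-1" and t=S]) auto
  \<comment> \<open>The kernel cuts off u < 0, and for u > 5 the argument S - u is negative, where
    \<open>W\<close> vanishes.\<close>
  also have "\<dots> = (LINT u:{0..5}|lborel. complex_of_real u powr (\<gamma> - 1) * of_real (W (S - u)))"
    unfolding set_lebesgue_integral_def
    by (rule Bochner_Integration.integral_cong)
      (use S in \<open>auto simp: indicator_def ball_kernel_def scaleR_conv_of_real W0\<close>)
  also have "\<dots> = integral {0..5} (\<lambda>u. complex_of_real u powr (\<gamma> - 1) * of_real (W (S - u)))"
    by (intro set_borel_integral_eq_integral set_integrable_of_real_powr_mult \<gamma> continuous_on_of_real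
        continuous_on_compose2[OF contW[of UNIV]]) (auto intro!: continuous_intros)
  finally show ?thesis
    using mean_eq[of \<gamma> 0 S] assms by (simp add: frac_int_def W_def)
qed

text \<open>The function \<open>g\<close> is the given one reflected about \<open>x\<close>, so that
  f(x - t y) = g(t y). Scaling by \<open>t\<close> yields t^n from the volume and (t^2)^(\<beta>-1)
  from the kernel.\<close>

lemma ball_mean_eq:
  assumes \<beta>: "Re \<beta> > 0" and t: "t \<in> {1..2}"
  shows "ball_mean \<beta> t (\<lambda>z. complex_of_real (g (x - z))) x
    = inverse (of_real t ^ CARD('n) * complex_of_real (t\<^sup>2) powr (\<beta> - 1)) * mean \<beta> (t\<^sup>2)"
proof -
  have t2: "t\<^sup>2 \<le> 5" using t power_mono[of t 2 2] by simp
  have [measurable]: "g \<in> borel_measurable borel"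
    by (intro borel_measurable_continuous_onI annular_continuous[OF annular])
  define I where "I = (LINT y:cball 0 1|lborel. complex_of_real (1 - (norm y)\<^sup>2) powr (\<beta> - 1) * of_real (g (t *\<^sub>R y)))"
  have "(LINT y|lborel. g y *\<^sub>R ball_kernel \<beta> (t\<^sup>2) ((norm y)\<^sup>2))
     = t ^ CARD('n) *\<^sub>R (LINT y|lborel. g (t *\<^sub>R y) *\<^sub>R ball_kernel \<beta> (t\<^sup>2) ((norm (t *\<^sub>R y))\<^sup>2))"
    by (rule lborel_integral_scale) (use t in auto)
  also have "(LINT y|lborel. g (t *\<^sub>R y) *\<^sub>R ball_kernel \<beta> (t\<^sup>2) ((norm (t *\<^sub>R y))\<^sup>2))
     = (LINT y|lborel. complex_of_real (t\<^sup>2) powr (\<beta> - 1) * (indicator (cball 0 1) y *\<^sub>R (complex_of_real (1 - (norm y)\<^sup>2) powr (\<beta> - 1) * of_real (g (t *\<^sub>R y)))))"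
  proof (rule Bochner_Integration.integral_cong[OF refl])
    fix y :: "real^'n"
    have le: "(norm (t *\<^sub>R y))\<^sup>2 \<le> t\<^sup>2 \<longleftrightarrow> norm y \<le> 1"
      using t by (simp add: power_mult_distrib power_le_one_iff abs_square_le_1)
    show "g (t *\<^sub>R y) *\<^sub>R ball_kernel \<beta> (t\<^sup>2) ((norm (t *\<^sub>R y))\<^sup>2) =
      complex_of_real (t\<^sup>2) powr (\<beta> - 1) * (indicator (cball 0 1) y *\<^sub>R (complex_of_real (1 - (norm y)\<^sup>2) powr (\<beta> - 1) * of_real (g (t *\<^sub>R y))))"
    proof (cases "norm y \<le> 1")
      case True
      have "complex_of_real (t\<^sup>2 - (norm (t *\<^sub>R y))\<^sup>2) = complex_of_real (t\<^sup>2) * complex_of_real (1 - (norm y)\<^sup>2)"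
        by (simp add: power_mult_distrib algebra_simps)
      then have "complex_of_real (t\<^sup>2 - (norm (t *\<^sub>R y))\<^sup>2) powr (\<beta> - 1) = complex_of_real (t\<^sup>2) powr (\<beta> - 1) * complex_of_real (1 - (norm y)\<^sup>2) powr (\<beta> - 1)"
        by (simp add: powr_times_real_left del: of_real_power of_real_diff)
      then show ?thesis
        using True le unfolding ball_kernel_def by (simp add: scaleR_conv_of_real del: of_real_power of_real_diff)
    qed (use le in \<open>simp add: ball_kernel_def\<close>)
  qed
  also have "\<dots> = complex_of_real (t\<^sup>2) powr (\<beta> - 1) * I"
    unfolding I_def set_lebesgue_integral_def by (rule integral_mult_right_zero)
  finally have "mean \<beta> (t\<^sup>2) = rGamma \<beta> * (of_real (t ^ CARD('n)) * (complex_of_real (t\<^sup>2) powr (\<beta> - 1) * I))"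
    using mean_eq_integral[OF \<beta> t2] by (simp add: scaleR_conv_of_real)
  moreover have "ball_mean \<beta> t (\<lambda>z. complex_of_real (g (x - z))) x = rGamma \<beta> * I"
    unfolding ball_mean_def I_def by (simp add: rGamma_inverse_Gamma field_simps)
  ultimately show ?thesis using t by (simp add: field_simps)
qed

text \<open>The explicit right-hand side is entire in the order and agrees with
  \<open>ball_mean\<close> on the right half plane; the identity theorem makes it the only such
  function, which evaluates the definite description.\<close>

lemma stein_mean_eq:
  assumes t: "t \<in> {1..2}"
  shows "stein_mean \<alpha> t (\<lambda>z. complex_of_real (g (x - z))) x
    = inverse (of_real t ^ CARD('n) * complex_of_real (t\<^sup>2) powr (\<alpha> - 1)) * mean \<alpha> (t\<^sup>2)"
proof -
  define F where "F \<beta> = inverse (of_real t ^ CARD('n) * complex_of_real (t\<^sup>2) powr (\<beta> - 1)) * mean \<beta> (t\<^sup>2)" for \<beta>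
  have t2: "t\<^sup>2 \<le> 5" using t power_mono[of t 2 2] by simp
  have hol: "F holomorphic_on UNIV"
    unfolding F_def by (intro holomorphic_intros mean_holomorphic t2) (use t in auto)
  have eq: "F \<beta> = ball_mean \<beta> t (\<lambda>z. complex_of_real (g (x - z))) x" if "Re \<beta> > 0" for \<beta>
    unfolding F_def by (rule ball_mean_eq[OF that t, symmetric])
  have "(THE F. F holomorphic_on UNIV \<and> (\<forall>\<beta>. Re \<beta> > 0 \<longrightarrow> F \<beta> = ball_mean \<beta> t (\<lambda>z. complex_of_real (g (x - z))) x)) = F"
  proof (rule the_equality)
    fix G assume G: "G holomorphic_on UNIV \<and> (\<forall>\<beta>. Re \<beta> > 0 \<longrightarrow> G \<beta> = ball_mean \<beta> t (\<lambda>z. complex_of_real (g (x - z))) x)"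
    show "G = F"
    proof
      fix z
      have "{\<beta>. 0 < Re \<beta>} \<noteq> {}" by (auto intro: exI[of _ 1])
      then show "G z = F z"
        by (intro analytic_continuation_open[of "{\<beta>. 0 < Re \<beta>}" UNIV G F z])
          (use G hol eq in \<open>auto simp: open_halfspace_Re_gt\<close>)
    qed
  qed (use hol eq in auto)
  then show ?thesis by (simp add: stein_mean_def F_def)
qed

end


section \<open>A lower bound for the maximal function\<close>

lemma cos_ge_half:
  assumes "\<bar>x\<bar> \<le> (1::real)"
  shows "cos x \<ge> 1/2"
proof -
  have "\<bar>sin (x/2)\<bar> \<le> 1/2" using abs_sin_x_le_abs_x[of "x/2"] assms by simp
  then have "\<bar>sin (x/2)\<bar>\<^sup>2 \<le> (1/2)\<^sup>2" by (rule power_mono) simp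
  then show ?thesis using cos_double_sin[of "x/2"] by (simp add: power2_eq_square)
qed

text \<open>Over \<open>[(L - 1) w, (L + 1) w]\<close> the phase of \<open>\<rho>\<^bsup>i Im \<gamma>\<^esup>\<close> varies by at most one if \<open>L\<close> is large.\<close>
lemma Re_cis_powr_ge:
  assumes L: "L \<ge> 2" "L \<ge> 2 * \<bar>Im \<gamma>\<bar>" and w: "w > 0" and \<rho>: "(L - 1) * w \<le> \<rho>" "\<rho> \<le> (L + 1) * w"
    and \<gamma>: "Re \<gamma> \<ge> 1"
  shows "Re (cis (- (Im \<gamma> * ln (L * w))) * complex_of_real \<rho> powr (\<gamma> - 1)) \<ge> ((L - 1) * w) powr (Re \<gamma> - 1) / 2"
proof -
  have pos: "\<rho> > 0" using assms mult_pos_pos[of "L - 1" w] by linarith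
  have Lw: "L * w > 0" using assms by simp
  define q where "q = \<rho> / (L * w)"
  have q: "q > 0" using pos Lw by (simp add: q_def)
  have q1: "q \<le> 1 + 1 / L" using \<rho>(2) L w by (simp add: q_def field_simps)
  have q2: "1 - 1 / L \<le> q" 
  proof -
    have "(L - 1) * w / (L * w) \<le> q" unfolding q_def using \<rho>(1) Lw by (intro divide_right_mono) auto
    then show ?thesis using w L by (simp add: diff_divide_distrib)
  qed
  have "ln q \<le> 1 / L" using ln_le_minus_one[OF q] q1 by linarith
  moreover have "- (2 / L) \<le> ln q"
  proof -
    have "ln (inverse q) \<le> inverse q - 1" using q by (intro ln_le_minus_one) auto
    also have "inverse q \<le> inverse (1 - 1 / L)" using q2 L by (intro le_imp_inverse_le) auto
    also have "inverse (1 - 1 / L) \<le> 1 + 2 / L" using L by (simp add: field_simps)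
    finally show ?thesis using q by (simp add: ln_inverse)
  qed
  ultimately have lnq: "\<bar>ln q\<bar> \<le> 2 / L" using L by (auto simp: abs_le_iff field_simps)
  have "\<bar>Im \<gamma> * ln q\<bar> \<le> \<bar>Im \<gamma>\<bar> * (2 / L)" unfolding abs_mult by (intro mult_left_mono lnq) auto
  also have "\<dots> \<le> 1" using L by (simp add: field_simps)
  finally have c: "cos (Im \<gamma> * ln q) \<ge> 1/2" by (rule cos_ge_half)
  have "cis (- (Im \<gamma> * ln (L * w))) * complex_of_real \<rho> powr (\<gamma> - 1)
      = exp (\<i> * of_real (- (Im \<gamma> * ln (L * w))) + (\<gamma> - 1) * of_real (ln \<rho>))"
    using pos by (simp only: cis_conv_exp exp_add) (simp add: powr_def Ln_of_real)
  then have "Re (cis (- (Im \<gamma> * ln (L * w))) * complex_of_real \<rho> powr (\<gamma> - 1))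
      = exp ((Re \<gamma> - 1) * ln \<rho>) * cos (Im \<gamma> * ln \<rho> - Im \<gamma> * ln (L * w))"
    by (simp add: Re_exp)
  also have "Im \<gamma> * ln \<rho> - Im \<gamma> * ln (L * w) = Im \<gamma> * ln q"
    using pos Lw L w by (simp add: q_def ln_div algebra_simps)
  also have "exp ((Re \<gamma> - 1) * ln \<rho>) = \<rho> powr (Re \<gamma> - 1)"
    using pos by (simp add: powr_def)
  finally have "Re (cis (- (Im \<gamma> * ln (L * w))) * complex_of_real \<rho> powr (\<gamma> - 1)) = \<rho> powr (Re \<gamma> - 1) * cos (Im \<gamma> * ln q)" .
  moreover have "((L - 1) * w) powr (Re \<gamma> - 1) * (1/2) \<le> \<rho> powr (Re \<gamma> - 1) * cos (Im \<gamma> * ln q)"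
    using \<rho> \<gamma> L w c by (intro mult_mono powr_mono2) auto
  ultimately show ?thesis by simp
qed

lemma (in flat_chain) norm_mean_le:
  assumes M: "\<And>s. s \<in> {a..4} \<Longrightarrow> norm (mean \<alpha> s) \<le> M" and zero: "\<And>k x. x \<le> a \<Longrightarrow> W k x = 0"
  shows "s \<in> {a..4} \<Longrightarrow> norm (mean (\<alpha> + of_nat j) s) \<le> M * (s - a) ^ j"
proof (induction j arbitrary: s)
  case 0
  then show ?case using M by simp
next
  case (Suc j)
  have 0: "mean (\<alpha> + of_nat (Suc j)) a = 0" by (rule mean_zero) (use zero in auto)
  have M0: "M \<ge> 0" using M[OF Suc.prems] norm_ge_zero[of "mean \<alpha> s"] by linarith
  show ?case
  proof (cases "s = a")
    case True
    then show ?thesis using 0 by simp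
  next
    case False
    then have as: "a < s" using Suc.prems by simp
    have d: "(mean (\<alpha> + of_nat (Suc j)) has_derivative (\<lambda>h. h *\<^sub>R mean (\<alpha> + of_nat j) x)) (at x)" if "x < 5" for x
      using mean_deriv[OF that, of "\<alpha> + of_nat j"] by (simp add: has_vector_derivative_def add_ac)
    have "continuous_on {a..s} (mean (\<alpha> + of_nat (Suc j)))"
      by (intro continuous_at_imp_continuous_on ballI has_derivative_continuous[OF d]) (use Suc.prems in auto)
    then obtain x where x: "x \<in> {a<..<s}"
      "norm (mean (\<alpha> + of_nat (Suc j)) s - mean (\<alpha> + of_nat (Suc j)) a) \<le> norm ((s - a) *\<^sub>R mean (\<alpha> + of_nat j) x)"
      using mvt_general[OF as, where f="mean (\<alpha> + of_nat (Suc j))" and f'="\<lambda>x h. h *\<^sub>R mean (\<alpha> + of_nat j) x"] d Suc.prems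
      by fastforce
    have "norm (mean (\<alpha> + of_nat (Suc j)) s) \<le> (s - a) * norm (mean (\<alpha> + of_nat j) x)"
      using x(2) 0 as by simp
    also have "\<dots> \<le> (s - a) * (M * (x - a) ^ j)"
      using as x(1) Suc.prems by (intro mult_left_mono Suc.IH) auto
    also have "\<dots> \<le> (s - a) * (M * (s - a) ^ j)"
      using as x(1) M0 by (intro mult_left_mono power_mono) auto
    finally show ?thesis by (simp add: mult_ac)
  qed
qed

text \<open>Seen from S = B + L w, the visible mass sits at S - |y|^2 between (L - 1) w and (L + 1)
  w. After one common rotation the kernel has real part at least \<open>c\<close> there, so
  contributions cannot cancel.\<close>

lemma (in annular_fun) norm_mean_ge:
  assumes L: "L \<ge> 2" "L \<ge> 2 * \<bar>Im \<gamma>\<bar>" and w: "w > 0" and \<gamma>: "Re \<gamma> \<ge> 2" and S: "B + L * w \<le> 4" "B \<ge> 0"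
    and g: "\<And>y. g y \<noteq> 0 \<Longrightarrow> norm y \<le> 2 \<Longrightarrow> \<bar>(norm y)\<^sup>2 - B\<bar> \<le> w"
  shows "norm (mean \<gamma> (B + L * w)) \<ge> norm (rGamma \<gamma>) * (((L - 1) * w) powr (Re \<gamma> - 1) / 2 * (LINT y|lborel. indicator (cball 0 2) y * g y))"
proof -
  define S where "S = B + L * w"
  define K where "K = ball_kernel \<gamma> S"
  define \<theta> where "\<theta> = Im \<gamma> * ln (L * w)"
  define c where "c = ((L - 1) * w) powr (Re \<gamma> - 1) / 2"
  have K_meas [measurable]: "K \<in> borel_measurable borel" unfolding K_def by simp
  have S4: "S \<le> 4" using assms by (simp add: S_def)
  have S0: "S \<ge> 0" using S L w by (simp add: S_def)
  have Kb: "norm (K ((norm y)\<^sup>2)) \<le> 4 powr (Re \<gamma> - 1)" for y :: "real^'n"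
    unfolding K_def ball_kernel_def using \<gamma> S4
    by (auto simp: norm_powr_real_powr simp del: of_real_diff intro!: powr_mono2 order_trans[of _ S 4])
  have int: "integrable lborel (\<lambda>y. K ((norm y)\<^sup>2) * complex_of_real (g y))"
  proof (rule Bochner_Integration.integrable_bound)
    show "integrable lborel (\<lambda>y. 4 powr (Re \<gamma> - 1) * g y)"
      by (rule annular_integrable[OF annular, where M="4 powr (Re \<gamma> - 1)"]) auto
    have [measurable]: "g \<in> borel_measurable borel"
      by (intro borel_measurable_continuous_onI annular_continuous[OF annular])
    show "(\<lambda>y. K ((norm y)\<^sup>2) * complex_of_real (g y)) \<in> borel_measurable lborel" by measurable
    show "AE y in lborel. norm (K ((norm y)\<^sup>2) * complex_of_real (g y)) \<le> norm (4 powr (Re \<gamma> - 1) * g y)"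
      using Kb by (auto simp: norm_mult abs_mult intro!: mult_right_mono)
  qed
  define I where "I = (LINT y|lborel. cis (- \<theta>) * (K ((norm y)\<^sup>2) * complex_of_real (g y)))"
  have int': "integrable lborel (\<lambda>y. cis (- \<theta>) * (K ((norm y)\<^sup>2) * complex_of_real (g y)))"
    by (intro integrable_mult_right int)
  have "c * (LINT y|lborel. indicator (cball 0 2) y * g y) = (LINT y|lborel. c * (indicator (cball 0 2) y * g y))"
    by simp
  also have "\<dots> \<le> (LINT y|lborel. Re (cis (- \<theta>) * (K ((norm y)\<^sup>2) * complex_of_real (g y))))"
  proof (rule integral_mono)
    show "integrable lborel (\<lambda>y. c * (indicator (cball 0 2) y * g y))"
      by (intro integrable_mult_right annular_integrable[OF annular, where M=1]) (auto simp: indicator_def)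
    show "integrable lborel (\<lambda>y. Re (cis (- \<theta>) * (K ((norm y)\<^sup>2) * complex_of_real (g y))))"
      by (rule integrable_Re[OF int'])
    fix y :: "real^'n"
    show "c * (indicator (cball 0 2) y * g y) \<le> Re (cis (- \<theta>) * (K ((norm y)\<^sup>2) * complex_of_real (g y)))"
    proof (cases "g y = 0")
      case False
      show ?thesis
      proof (cases "norm y \<le> 2")
        case True
        from g[OF False True] have le: "(norm y)\<^sup>2 \<le> B + w" "(norm y)\<^sup>2 \<ge> B - w" by (auto simp: abs_le_iff)
        have "1 * w \<le> L * w" using L w by (intro mult_right_mono) auto
        then have K: "K ((norm y)\<^sup>2) = complex_of_real (S - (norm y)\<^sup>2) powr (\<gamma> - 1)"
          using le by (simp add: K_def ball_kernel_def S_def)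
        have "c \<le> Re (cis (- \<theta>) * K ((norm y)\<^sup>2))"
          unfolding c_def K \<theta>_def
          by (rule Re_cis_powr_ge[OF L w]) (use le \<gamma> in \<open>auto simp: S_def algebra_simps\<close>)
        then have "c * g y \<le> Re (cis (- \<theta>) * K ((norm y)\<^sup>2)) * g y"
          by (rule mult_right_mono[OF _ nonneg])
        also have "\<dots> = Re (cis (- \<theta>) * K ((norm y)\<^sup>2) * complex_of_real (g y))"
          by simp
        finally show ?thesis using True by (simp add: mult.assoc)
      next
        \<comment> \<open>Mass outside radius 2 may lie anywhere: |y|^2 > 4 >= S puts it beyond the
          reach of the kernel.\<close>
        case False
        then have "(norm y)\<^sup>2 > 2\<^sup>2" by (intro power_strict_mono) auto
        then have "K ((norm y)\<^sup>2) = 0 \<or> S = (norm y)\<^sup>2" using S4 by (auto simp: K_def ball_kernel_def)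
        then have "K ((norm y)\<^sup>2) = 0" by (auto simp: K_def ball_kernel_def)
        then show ?thesis using False by simp
      qed
    qed simp
  qed
  also have "\<dots> = Re I" unfolding I_def by (rule integral_Re[OF int'])
  also have "\<dots> \<le> norm I" by (rule complex_Re_le_cmod)
  also have "I = cis (- \<theta>) * (LINT y|lborel. K ((norm y)\<^sup>2) * complex_of_real (g y))"
    unfolding I_def by (rule integral_mult_right_zero)
  also have "norm \<dots> = norm (LINT y|lborel. K ((norm y)\<^sup>2) * complex_of_real (g y))"
    by (simp add: norm_mult)
  finally have *: "c * (LINT y|lborel. indicator (cball 0 2) y * g y) \<le> norm (LINT y|lborel. g y *\<^sub>R K ((norm y)\<^sup>2))"
    by (simp add: scaleR_conv_of_real mult.commute)
  have "mean \<gamma> S = rGamma \<gamma> * (LINT y|lborel. g y *\<^sub>R K ((norm y)\<^sup>2))"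
    unfolding K_def by (rule mean_eq_integral) (use \<gamma> S4 in auto)
  then show ?thesis
    using mult_left_mono[OF *, of "norm (rGamma \<gamma>)"] by (simp add: norm_mult c_def S_def)
qed

lemma lborel_integral_reflect:
  fixes F :: "real^'n::finite \<Rightarrow> real"
  assumes [measurable]: "F \<in> borel_measurable borel"
  shows "(LINT z|lborel. F z) = (LINT y|lborel. F (x - y))"
proof -
  have "(LINT z|lborel. F z) = (LINT z|density (distr lborel borel (\<lambda>y::real^'n. x + (-1) *\<^sub>R y)) (\<lambda>_. ennreal 1). F z)"
    using lborel_affine[of "-1" x] by simp
  also have "\<dots> = (LINT z|distr lborel borel (\<lambda>y::real^'n. x + (-1) *\<^sub>R y). 1 *\<^sub>R F z)"
    by (subst integral_density) auto
  also have "\<dots> = (LINT y|lborel. F (x + (-1) *\<^sub>R y))"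
    by (subst integral_distr) auto
  finally show ?thesis by simp
qed

text \<open>The constants depend only on \<alpha> and the dimension, as they must, since
  \<open>f\<close>, \<open>x\<close>, \<open>w\<close> and \<open>B\<close> vary with the small
  parameter of the tests. The shell condition is imposed only within distance 2 of \<open>x\<close>;
  this is what later admits many distant translates.\<close>

lemma stein_maximal_lower_bound:
  fixes \<alpha> :: complex
  shows "\<exists>c>0. \<exists>w0>0. \<forall>(f::real^'n::finite \<Rightarrow> real) x w B R.
    smooth f \<longrightarrow> (\<forall>z. f z \<ge> 0) \<longrightarrow> (\<forall>z. norm z > R \<longrightarrow> f z = 0) \<longrightarrow> 0 < w \<longrightarrow> w \<le> w0 \<longrightarrow> 5/4 \<le> B \<longrightarrow> B \<le> 3 \<longrightarrow>
    (\<forall>z. f z \<noteq> 0 \<longrightarrow> norm (x - z) \<le> 2 \<longrightarrow> \<bar>(norm (x - z))\<^sup>2 - B\<bar> \<le> w) \<longrightarrow>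
    ennreal (c * w powr (Re \<alpha> - 1) * (LINT z|lborel. indicator (cball x 2) z * f z))
      \<le> stein_maximal \<alpha> (\<lambda>z. complex_of_real (f z)) x"
proof -
  define m where "m = nat \<lceil>2 - Re \<alpha>\<rceil>"
  define \<gamma> where "\<gamma> = \<alpha> + of_nat m"
  have \<gamma>: "Re \<gamma> \<ge> 2" unfolding \<gamma>_def m_def by simp linarith
  define L where "L = max 2 (2 * \<bar>Im \<gamma>\<bar>)"
  have L: "L \<ge> 2" "L \<ge> 2 * \<bar>Im \<gamma>\<bar>" by (auto simp: L_def)
  \<comment> \<open>A lower bound for the modulus of the factor between \<open>stein_mean\<close>
    and \<open>mean\<close> over 1 <= t <= 2; the absolute value in the exponent covers both signs
    of Re \<alpha> - 1.\<close>
  define \<kappa> where "\<kappa> = inverse (2 ^ CARD('n) * 4 powr \<bar>Re \<alpha> - 1\<bar>)"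
  have \<kappa>: "\<kappa> > 0" by (simp add: \<kappa>_def)
  define c where "c = \<kappa> * (norm (rGamma \<gamma>) * ((L - 1) powr (Re \<gamma> - 1) / 2) / (L + 2) ^ m)"
  have "rGamma \<gamma> \<noteq> 0"
    using \<gamma> by (auto simp: rGamma_eq_zero_iff elim!: nonpos_Ints_cases)
  then have c: "c > 0" using L \<kappa> by (simp add: c_def)
  \<comment> \<open>This forces L w <= 1 and w <= 1/16, hence B + L w <= 4 and B - 2 w >= 1.\<close>
  define w0 where "w0 = 1 / (L + 16)"
  have w0: "w0 > 0" using L by (simp add: w0_def)
  show ?thesis
  proof (rule exI[of _ c], rule conjI[OF c], rule exI[of _ w0], rule conjI[OF w0], intro allI impI)
    fix f :: "real^'n \<Rightarrow> real" and x w B R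
    assume f: "smooth f" "\<forall>z. f z \<ge> 0" "\<forall>z. norm z > R \<longrightarrow> f z = 0" and w: "0 < w" "w \<le> w0" and B: "5/4 \<le> B" "B \<le> 3"
      and near: "\<forall>z. f z \<noteq> 0 \<longrightarrow> norm (x - z) \<le> 2 \<longrightarrow> \<bar>(norm (x - z))\<^sup>2 - B\<bar> \<le> w"
    have w16: "w * (L + 16) \<le> 1" using w L by (simp add: w0_def field_simps)
    have Lw0: "L * w \<ge> 0" using w(1) L by simp
    then have Lw: "L * w \<le> 1" "w \<le> 1/16" using w16 w(1) by (auto simp: algebra_simps)
    define g where "g y = f (x - y)" for y
    define r where "r = sqrt (B - w)"
    have r2: "r\<^sup>2 = B - w" using B Lw by (simp add: r_def)
    have r1: "r \<ge> 1" using B Lw by (simp add: r_def)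
    have nz: "\<bar>(norm y)\<^sup>2 - B\<bar> \<le> w" if "g y \<noteq> 0" "norm y \<le> 2" for y
      using near[rule_format, of "x - y"] that by (simp add: g_def)
    have ann: "annular r (norm x + \<bar>R\<bar>) g"
      unfolding annular_def
    proof (intro conjI allI impI)
      show "smooth g"
        using smooth_compose_affine[OF f(1), of x "-1"] by (simp add: g_def[abs_def])
    next
      fix y :: "real^'n" assume y: "norm y < r"
      have "(norm y)\<^sup>2 < r\<^sup>2" using y by (intro power_strict_mono) auto
      then have lt: "(norm y)\<^sup>2 < B - w" by (simp add: r2)
      then have "(norm y)\<^sup>2 \<le> 2\<^sup>2" using B w by simp
      then have "norm y \<le> 2" by (rule power2_le_imp_le) simp
      then show "g y = 0" using nz[of y] lt by fastforce
    next
      fix y :: "real^'n" assume y: "norm y > norm x + \<bar>R\<bar>"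
      have "norm (x - y) > R" using y norm_triangle_ineq2[of y x] by (simp add: norm_minus_commute)
      then show "g y = 0" using f(3) by (simp add: g_def)
    qed
    interpret annular_fun g r "norm x + \<bar>R\<bar>"
      by unfold_locales (use ann r1 f(2) in \<open>auto simp: g_def\<close>)
    have fg: "f z = g (x - z)" for z by (simp add: g_def)
    define J where "J = (LINT z|lborel. indicator (cball x 2) z * f z)"
    have Jg: "J = (LINT y|lborel. indicator (cball 0 2) y * g y)"
    proof -
      have "continuous_on UNIV f" using f(1) by (rule smooth_continuous)
      then have "f \<in> borel_measurable borel" by (rule borel_measurable_continuous_onI)
      then have "(\<lambda>z. indicator (cball x 2) z * f z) \<in> borel_measurable borel"
        by (intro borel_measurable_times borel_measurable_indicator) auto
      then have "J = (LINT y|lborel. indicator (cball x 2) (x - y) * f (x - y))"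
        unfolding J_def by (rule lborel_integral_reflect)
      also have "\<dots> = (LINT y|lborel. indicator (cball 0 2) y * g y)"
        by (rule Bochner_Integration.integral_cong) (auto simp: g_def indicator_def dist_norm)
      finally show ?thesis .
    qed
    show "ennreal (c * w powr (Re \<alpha> - 1) * (LINT z|lborel. indicator (cball x 2) z * f z))
      \<le> stein_maximal \<alpha> (\<lambda>z. complex_of_real (f z)) x"
    \<comment> \<open>An infinite maximal function satisfies the bound trivially; otherwise its
      value \<open>M\<close> bounds all means with s in [1, 4].\<close>
    proof (cases "stein_maximal \<alpha> (\<lambda>z. complex_of_real (f z)) x")
      case (real M)
      have M: "norm (stein_mean \<alpha> t (\<lambda>z. complex_of_real (f z)) x) \<le> M" if "t \<in> {1..2}" for t
      proof -
        have "ennreal (norm (stein_mean \<alpha> t (\<lambda>z. complex_of_real (f z)) x)) \<le> ennreal M"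
          unfolding real(2)[symmetric] stein_maximal_def by (rule SUP_upper[OF that])
        then show ?thesis using real(1) by simp
      qed
      have mean_le: "norm (mean \<alpha> s) \<le> M / \<kappa>" if s: "s \<in> {1..4}" for s
      proof -
        define t where "t = sqrt s"
        have t: "t \<in> {1..2}" "t\<^sup>2 = s" using s real_sqrt_le_mono[of s 4] by (auto simp: t_def)
        have "norm (stein_mean \<alpha> t (\<lambda>z. complex_of_real (f z)) x) = inverse (t ^ CARD('n) * s powr (Re \<alpha> - 1)) * norm (mean \<alpha> s)"
          unfolding fg stein_mean_eq[OF t(1)] t(2) using t(1) s
          by (simp add: norm_mult norm_inverse norm_power norm_powr_real_powr)
        moreover have "\<kappa> \<le> inverse (t ^ CARD('n) * s powr (Re \<alpha> - 1))"
        proof -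
          have "s powr (Re \<alpha> - 1) \<le> s powr \<bar>Re \<alpha> - 1\<bar>" using s by (intro powr_mono) auto
          also have "\<dots> \<le> 4 powr \<bar>Re \<alpha> - 1\<bar>" using s by (intro powr_mono2) auto
          finally have "t ^ CARD('n) * s powr (Re \<alpha> - 1) \<le> 2 ^ CARD('n) * 4 powr \<bar>Re \<alpha> - 1\<bar>"
            using t(1) by (intro mult_mono power_mono) auto
          then show ?thesis unfolding \<kappa>_def using t(1) s by (intro le_imp_inverse_le mult_pos_pos) auto
        qed
        then have "\<kappa> * norm (mean \<alpha> s) \<le> inverse (t ^ CARD('n) * s powr (Re \<alpha> - 1)) * norm (mean \<alpha> s)"
          by (intro mult_right_mono) auto
        ultimately show ?thesis using M[OF t(1)] \<kappa> by (simp add: field_simps)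
      qed
      \<comment> \<open>Two widths below \<open>B\<close> rather than one, so that \<open>a\<close>
        is strictly less than r^2 = B - w and every ball integral vanishes up to and including
        \<open>a\<close>.\<close>
      define a where "a = B - 2 * w"
      have a: "a \<ge> 1" "a < r\<^sup>2" using B Lw w by (auto simp: a_def r2)
      define S where "S = B + L * w"
      have S: "S \<in> {a..4}" using B Lw Lw0 w by (auto simp: S_def a_def)
      have Sa: "(L + 2) * w = S - a" by (simp add: S_def a_def algebra_simps)
      have "norm (mean \<gamma> S) \<le> M / \<kappa> * ((L + 2) * w) ^ m"
        unfolding \<gamma>_def Sa
      proof (rule norm_mean_le[OF _ _ S])
        show "ball_int ((radial_div ^^ k) g) y = 0" if "y \<le> a" for k y
          using that a r1 by (intro ball_int_zero[OF annular_radial_div_iter[OF ann]]) auto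
      qed (use mean_le a in auto)
      moreover have "norm (mean \<gamma> S) \<ge> norm (rGamma \<gamma>) * (((L - 1) * w) powr (Re \<gamma> - 1) / 2 * J)"
        unfolding S_def Jg by (rule norm_mean_ge[OF L w(1) \<gamma>]) (use B Lw nz in auto)
      ultimately have "norm (rGamma \<gamma>) * (((L - 1) * w) powr (Re \<gamma> - 1) / 2 * J) \<le> M / \<kappa> * ((L + 2) * w) ^ m"
        by linarith
      \<comment> \<open>Since Re \<gamma> = Re \<alpha> + m, this isolates the factor
        \<open>w ^ m\<close> that cancels against the one in the upper bound.\<close>
      moreover have "((L - 1) * w) powr (Re \<gamma> - 1) = (L - 1) powr (Re \<gamma> - 1) * (w powr (Re \<alpha> - 1) * w ^ m)"
      proof -
        have "w powr (Re \<gamma> - 1) = w powr (Re \<alpha> - 1) * w ^ m"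
          using w(1) by (simp add: \<gamma>_def powr_add[symmetric] powr_realpow[symmetric] algebra_simps)
        moreover have "((L - 1) * w) powr (Re \<gamma> - 1) = (L - 1) powr (Re \<gamma> - 1) * w powr (Re \<gamma> - 1)"
          by (rule powr_mult)
        ultimately show ?thesis by simp
      qed
      ultimately have "norm (rGamma \<gamma>) * ((L - 1) powr (Re \<gamma> - 1) * w powr (Re \<alpha> - 1) / 2 * J) * w ^ m \<le> M / \<kappa> * (L + 2) ^ m * w ^ m"
        by (simp add: power_mult_distrib mult_ac)
      then have "norm (rGamma \<gamma>) * ((L - 1) powr (Re \<gamma> - 1) * w powr (Re \<alpha> - 1) / 2 * J) \<le> M / \<kappa> * (L + 2) ^ m"
        by (rule mult_right_le_imp_le) (use w(1) in simp)
      moreover have "(L + 2) ^ m > 0" using L by simp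
      ultimately have "c * w powr (Re \<alpha> - 1) * J \<le> M"
        using \<kappa> by (simp add: c_def field_simps)
      then show ?thesis using real by (simp add: J_def ennreal_leI)
    qed simp
  qed
qed


section \<open>Testing the maximal inequality\<close>

lemma ennreal_pow_mono:
  assumes "a \<le> b" "r \<ge> 0"
  shows "ennreal_pow a r \<le> ennreal_pow b r"
proof (cases "b = \<infinity>")
  case False
  then have "enn2real a \<le> enn2real b" using assms(1) by (intro enn2real_mono) (auto simp: less_top)
  moreover have "a \<noteq> \<infinity>" using False assms(1) by (auto simp: top_unique)
  ultimately show ?thesis
    using False assms(2) by (auto simp: ennreal_pow_def intro!: ennreal_leI powr_mono2)
qed (simp add: ennreal_pow_def)

lemma ennreal_pow_ennreal: "u \<ge> 0 \<Longrightarrow> ennreal_pow (ennreal u) r = ennreal (u powr r)"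
  by (simp add: ennreal_pow_def)

lemma enn2real_inverse_finite:
  assumes "r \<ge> 1"
  shows "enn2real (1 / ennreal r) = 1 / r"
proof -
  have "1 / ennreal r = ennreal (1 / r)"
    using assms divide_ennreal[of 1 r] by simp
  then show ?thesis using assms by simp
qed

text \<open>Chebyshev's inequality for finite exponents. For the infinite one the power of the
  measure is 1, where positive measure matters because \<open>0 powr 0 = 0\<close>.\<close>

lemma Lnorm_ge:
  fixes F :: "real^'n::finite \<Rightarrow> ennreal"
  assumes q: "1 \<le> q" and A: "A \<in> sets borel" "emeasure lborel A < \<infinity>" "measure lborel A > 0"
    and c: "c \<ge> 0" "\<And>x. x \<in> A \<Longrightarrow> ennreal c \<le> F x"
  shows "ennreal (c * measure lborel A powr enn2real (1 / q)) \<le> Lnorm q F"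
proof (cases q)
  case top
  have "ennreal c \<le> esssup lborel F"
  proof (rule ccontr)
    assume neg: "\<not> ennreal c \<le> esssup lborel F"
    have "AE x in lborel. x \<notin> A"
      using esssup_AE[of F lborel]
    proof eventually_elim
      case (elim x)
      then show "x \<notin> A" using order_trans[OF c(2)[of x] elim] neg by blast
    qed
    then have "emeasure lborel A = 0" using A(1) AE_iff_measurable[of A lborel "\<lambda>x. x \<notin> A"] by simp
    then show False using A(3) by (simp add: measure_def)
  qed
  then show ?thesis using top A(3) by (simp add: Lnorm_def)
next
  case (real r)
  then have r: "r \<ge> 1" using q by simp
  have mA: "emeasure lborel A = ennreal (measure lborel A)"
    using A(2) by (simp add: emeasure_eq_ennreal_measure less_top)
  have "ennreal (c powr r * measure lborel A) = (\<integral>\<^sup>+x. ennreal (c powr r) * indicator A x \<partial>lborel)"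
    using A(1) by (simp add: nn_integral_cmult_indicator mA ennreal_mult)
  also have "\<dots> \<le> (\<integral>\<^sup>+x. ennreal_pow (F x) r \<partial>lborel)"
  proof (rule nn_integral_mono)
    fix x
    show "ennreal (c powr r) * indicator A x \<le> ennreal_pow (F x) r"
      using ennreal_pow_mono[OF c(2)[of x], of r] r c(1) by (auto simp: ennreal_pow_ennreal indicator_def)
  qed
  finally have "ennreal_pow (ennreal (c powr r * measure lborel A)) (1 / r) \<le> ennreal_pow (\<integral>\<^sup>+x. ennreal_pow (F x) r \<partial>lborel) (1 / r)"
    using r by (intro ennreal_pow_mono) auto
  also have "ennreal_pow (ennreal (c powr r * measure lborel A)) (1 / r) = ennreal (c * measure lborel A powr (1 / r))"
    using r c(1) by (simp add: ennreal_pow_ennreal powr_mult powr_powr)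
  finally show ?thesis
    using real r by (simp add: Lnorm_def enn2real_inverse_finite)
qed

text \<open>Positive measure of \<open>D\<close> again serves the infinite exponent, where the bound
  has to be 1 and not \<open>0 powr 0\<close>.\<close>

lemma Lnorm_le:
  fixes f :: "real^'n::finite \<Rightarrow> real"
  assumes p: "1 \<le> p" and D: "D \<in> sets borel" "emeasure lborel D < \<infinity>" "measure lborel D > 0"
    and f: "continuous_on UNIV f" "\<And>x. 0 \<le> f x" "\<And>x. f x \<le> 1" "\<And>x. x \<notin> D \<Longrightarrow> f x = 0"
  shows "Lnorm p (\<lambda>x. ennreal (norm (complex_of_real (f x)))) \<le> ennreal (measure lborel D powr enn2real (1 / p))"
proof (cases p)
  case top
  have [measurable]: "f \<in> borel_measurable borel" using f(1) by (rule borel_measurable_continuous_onI)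
  have "esssup lborel (\<lambda>x. ennreal (norm (complex_of_real (f x)))) \<le> 1"
    by (rule esssup_I) (use f in \<open>auto simp: ennreal_le_1\<close>)
  then show ?thesis using top D(3) by (simp add: Lnorm_def)
next
  case (real r)
  then have r: "r \<ge> 1" using p by simp
  have mD: "emeasure lborel D = ennreal (measure lborel D)"
    using D(2) by (simp add: emeasure_eq_ennreal_measure less_top)
  have "(\<integral>\<^sup>+x. ennreal_pow (ennreal (norm (complex_of_real (f x)))) r \<partial>lborel) \<le> (\<integral>\<^sup>+x. indicator D x \<partial>lborel)"
  proof (rule nn_integral_mono)
    fix x
    show "ennreal_pow (ennreal (norm (complex_of_real (f x)))) r \<le> indicator D x"
      using f(2-4)[of x] r powr_mono2[of r "f x" 1]
      by (auto simp: ennreal_pow_ennreal indicator_def ennreal_le_1)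
  qed
  also have "\<dots> = ennreal (measure lborel D)" using D(1) mD by simp
  finally have "ennreal_pow (\<integral>\<^sup>+x. ennreal_pow (ennreal (norm (complex_of_real (f x)))) r \<partial>lborel) (1 / r) \<le> ennreal_pow (ennreal (measure lborel D)) (1 / r)"
    using r by (intro ennreal_pow_mono) auto
  then show ?thesis
    using real r by (simp add: Lnorm_def enn2real_inverse_finite ennreal_pow_ennreal)
qed

text \<open>The type argument records the dimension, which the exponents and \<alpha> do not
  determine.\<close>

definition maximal_bound :: "'n::finite itself \<Rightarrow> ennreal \<Rightarrow> ennreal \<Rightarrow> complex \<Rightarrow> bool" where
  "maximal_bound _ p q \<alpha> \<longleftrightarrow> 1 \<le> p \<and> 1 \<le> q \<and> (\<exists>C::real. \<forall>f :: real^'n \<Rightarrow> complex. schwartz f \<longrightarrow>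
           Lnorm q (stein_maximal \<alpha> f) \<le> ennreal C * Lnorm p (\<lambda>x. ennreal (norm (f x))))"

text \<open>Reduces the maximal inequality to geometry: only sizes of sets, the width
  \<open>w\<close> and the visible mass \<open>J\<close> remain. The squared radius \<open>B\<close>
  may vary with the centre; \<open>w\<close> and \<open>J\<close> may not.\<close>

lemma maximal_bound_test:
  assumes "maximal_bound TYPE('n::finite) p q \<alpha>"
  shows "\<exists>C>0. \<exists>w0>0. \<forall>(f::real^'n \<Rightarrow> real) R A D w J. smooth f \<longrightarrow> (\<forall>z. 0 \<le> f z) \<longrightarrow> (\<forall>z. f z \<le> 1) \<longrightarrow> (\<forall>z. norm z > R \<longrightarrow> f z = 0) \<longrightarrow>
    A \<in> sets borel \<longrightarrow> emeasure lborel A < \<infinity> \<longrightarrow> measure lborel A > 0 \<longrightarrow>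
    D \<in> sets borel \<longrightarrow> emeasure lborel D < \<infinity> \<longrightarrow> measure lborel D > 0 \<longrightarrow> (\<forall>z. z \<notin> D \<longrightarrow> f z = 0) \<longrightarrow>
    0 < w \<longrightarrow> w \<le> w0 \<longrightarrow> 0 \<le> J \<longrightarrow>
    (\<forall>x\<in>A. \<exists>B. 5/4 \<le> B \<and> B \<le> 3 \<and> (\<forall>z. f z \<noteq> 0 \<longrightarrow> norm (x - z) \<le> 2 \<longrightarrow> \<bar>(norm (x - z))\<^sup>2 - B\<bar> \<le> w)
       \<and> J \<le> (LINT z|lborel. indicator (cball x 2) z * f z)) \<longrightarrow>
    w powr (Re \<alpha> - 1) * J * measure lborel A powr enn2real (1 / q) \<le> C * measure lborel D powr enn2real (1 / p)"
proof -
  from assms obtain C0 :: real where pq: "1 \<le> p" "1 \<le> q" and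
    C0: "\<And>f :: real^'n \<Rightarrow> complex. schwartz f \<Longrightarrow>
           Lnorm q (stein_maximal \<alpha> f) \<le> ennreal C0 * Lnorm p (\<lambda>x. ennreal (norm (f x)))"
    unfolding maximal_bound_def by blast
  \<comment> \<open>The given constant may be negative, in which case \<open>ennreal\<close> sends
    it to 0; a positive one is needed to return to the reals.\<close>
  define C1 where "C1 = max C0 1"
  have C1: "C1 > 0" "C0 \<le> C1" by (auto simp: C1_def)
  obtain c w0 where c: "c > 0" and w0: "w0 > 0" and low: "\<And>(f::real^'n \<Rightarrow> real) x w B R.
    smooth f \<Longrightarrow> (\<forall>z. f z \<ge> 0) \<Longrightarrow> (\<forall>z. norm z > R \<longrightarrow> f z = 0) \<Longrightarrow> 0 < w \<Longrightarrow> w \<le> w0 \<Longrightarrow> 5/4 \<le> B \<Longrightarrow> B \<le> 3 \<Longrightarrow>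
    (\<forall>z. f z \<noteq> 0 \<longrightarrow> norm (x - z) \<le> 2 \<longrightarrow> \<bar>(norm (x - z))\<^sup>2 - B\<bar> \<le> w) \<Longrightarrow>
    ennreal (c * w powr (Re \<alpha> - 1) * (LINT z|lborel. indicator (cball x 2) z * f z))
      \<le> stein_maximal \<alpha> (\<lambda>z. complex_of_real (f z)) x"
    using stein_maximal_lower_bound[of \<alpha>, where 'n='n] by blast
  show ?thesis
  proof (rule exI[of _ "C1 / c"], rule conjI, use c C1 in simp, rule exI[of _ w0], rule conjI[OF w0], intro allI impI)
    fix f :: "real^'n \<Rightarrow> real" and R A D w J
    assume f: "smooth f" "\<forall>z. 0 \<le> f z" "\<forall>z. f z \<le> 1" "\<forall>z. norm z > R \<longrightarrow> f z = 0"
      and A: "A \<in> sets borel" "emeasure lborel A < \<infinity>" "measure lborel A > 0"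
      and D: "D \<in> sets borel" "emeasure lborel D < \<infinity>" "measure lborel D > 0" "\<forall>z. z \<notin> D \<longrightarrow> f z = 0"
      and w: "0 < w" "w \<le> w0" and J: "0 \<le> J"
      and B: "\<forall>x\<in>A. \<exists>B. 5/4 \<le> B \<and> B \<le> 3 \<and> (\<forall>z. f z \<noteq> 0 \<longrightarrow> norm (x - z) \<le> 2 \<longrightarrow> \<bar>(norm (x - z))\<^sup>2 - B\<bar> \<le> w)
         \<and> J \<le> (LINT z|lborel. indicator (cball x 2) z * f z)"
    define K where "K = c * w powr (Re \<alpha> - 1) * J"
    have K: "ennreal K \<le> stein_maximal \<alpha> (\<lambda>z. complex_of_real (f z)) x" if x: "x \<in> A" for x
    proof -
      obtain B' where B': "5/4 \<le> B'" "B' \<le> 3" "\<forall>z. f z \<noteq> 0 \<longrightarrow> norm (x - z) \<le> 2 \<longrightarrow> \<bar>(norm (x - z))\<^sup>2 - B'\<bar> \<le> w"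
        "J \<le> (LINT z|lborel. indicator (cball x 2) z * f z)"
        using B x by blast
      have "K \<le> c * w powr (Re \<alpha> - 1) * (LINT z|lborel. indicator (cball x 2) z * f z)"
        unfolding K_def using c by (intro mult_left_mono B'(4)) auto
      then have "ennreal K \<le> ennreal (c * w powr (Re \<alpha> - 1) * (LINT z|lborel. indicator (cball x 2) z * f z))"
        by (rule ennreal_leI)
      also have "\<dots> \<le> stein_maximal \<alpha> (\<lambda>z. complex_of_real (f z)) x"
        by (rule low[OF f(1,2,4) w B'(1,2,3)])
      finally show ?thesis .
    qed
    have sch: "schwartz (\<lambda>z. complex_of_real (f z))"
      by (rule schwartz_compact_support[of _ R]) (use f smooth_of_real[OF f(1)] in auto)
    have "ennreal (K * measure lborel A powr enn2real (1 / q)) \<le> Lnorm q (stein_maximal \<alpha> (\<lambda>z. complex_of_real (f z)))"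
      by (rule Lnorm_ge[OF pq(2) A _ K]) (use c J in \<open>simp add: K_def\<close>)
    also have "\<dots> \<le> ennreal C0 * Lnorm p (\<lambda>x. ennreal (norm (complex_of_real (f x))))" by (rule C0[OF sch])
    also have "\<dots> \<le> ennreal C1 * ennreal (measure lborel D powr enn2real (1 / p))"
      by (intro mult_mono ennreal_leI C1 Lnorm_le[OF pq(1) D(1-3) smooth_continuous[OF f(1)]]) (use f D in auto)
    also have "\<dots> = ennreal (C1 * measure lborel D powr enn2real (1 / p))"
      using C1 by (simp add: ennreal_mult)
    finally have "K * measure lborel A powr enn2real (1 / q) \<le> C1 * measure lborel D powr enn2real (1 / p)"
      using C1 by (subst (asm) ennreal_le_iff) auto
    then show "w powr (Re \<alpha> - 1) * J * measure lborel A powr enn2real (1 / q) \<le> C1 / c * measure lborel D powr enn2real (1 / p)"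
      using c by (simp add: K_def field_simps)
  qed
qed

subsection \<open>Thickened spheres\<close>

lemma measure_norm_sq_shell:
  assumes "0 \<le> s" "s \<le> t"
  shows "measure lborel {z::real^'n::finite. s \<le> (norm z)\<^sup>2 \<and> (norm z)\<^sup>2 \<le> t}
    = unit_ball_vol (real CARD('n)) * (sqrt t ^ CARD('n) - sqrt s ^ CARD('n))"
proof -
  have "{z::real^'n. s \<le> (norm z)\<^sup>2 \<and> (norm z)\<^sup>2 \<le> t} = cball 0 (sqrt t) - ball 0 (sqrt s)"
  proof -
    have "norm z \<le> sqrt t \<longleftrightarrow> (norm z)\<^sup>2 \<le> t" for z :: "real^'n"
      using real_sqrt_le_iff[of "(norm z)\<^sup>2" t] by simp
    moreover have "norm z < sqrt s \<longleftrightarrow> (norm z)\<^sup>2 < s" for z :: "real^'n"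
      using real_sqrt_less_iff[of "(norm z)\<^sup>2" s] by simp
    ultimately show ?thesis by auto
  qed
  moreover have "measure lborel (cball 0 (sqrt t) - ball (0::real^'n) (sqrt s)) = measure lborel (cball (0::real^'n) (sqrt t)) - measure lborel (ball (0::real^'n) (sqrt s))"
    by (rule measure_Diff)
      (use assms emeasure_lborel_cball_finite[of "0::real^'n"] emeasure_lborel_ball_finite[of "0::real^'n"] in \<open>auto simp: less_top infinity_ennreal_def intro: order_trans[OF less_imp_le real_sqrt_le_mono]\<close>)
  ultimately show ?thesis
    using assms by (simp add: content_cball content_ball algebra_simps)
qed

lemma power_diff_le:
  fixes x y :: real
  assumes "0 \<le> x" "x \<le> y" "y \<le> 2"
  shows "y ^ m - x ^ m \<le> real m * 2 ^ m * (y - x)"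
proof (induction m)
  case (Suc m)
  have "y ^ Suc m - x ^ Suc m = y * (y ^ m - x ^ m) + x ^ m * (y - x)" by (simp add: algebra_simps)
  also have "\<dots> \<le> 2 * (real m * 2 ^ m * (y - x)) + 2 ^ m * (y - x)"
    using assms Suc by (intro add_mono mult_mono power_mono) (auto simp: power_mono)
  also have "\<dots> \<le> real (Suc m) * 2 ^ Suc m * (y - x)"
    using assms by (simp add: algebra_simps)
  finally show ?case .
qed simp

text \<open>The function lives on the shell of squared radii within \<open>d\<close> of 2 and is
  observed from centres in a ball of radius d/5. Width, visible mass and |D| are comparable to
  \<open>d\<close>, and |A| to d^n.\<close>

lemma sphere_test:
  assumes bd: "maximal_bound TYPE('n::finite) p q \<alpha>" and n: "CARD('n) \<ge> 2"
  shows "\<exists>C>0. \<exists>d0>0. \<forall>d. 0 < d \<longrightarrow> d \<le> d0 \<longrightarrow>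
    d powr (Re \<alpha>) * d powr (real CARD('n) * enn2real (1 / q)) \<le> C * d powr enn2real (1 / p)"
proof -
  define a b where "a = enn2real (1 / p)" and "b = enn2real (1 / q)"
  define n where "n = CARD('n)"
  define V where "V = unit_ball_vol (real n)"
  have V: "V > 0" by (simp add: V_def)
  obtain C w0 where C: "C > 0" "w0 > 0" and test: "\<And>(f::real^'n \<Rightarrow> real) R A D w J. smooth f \<Longrightarrow> (\<forall>z. 0 \<le> f z) \<Longrightarrow> (\<forall>z. f z \<le> 1) \<Longrightarrow> (\<forall>z. norm z > R \<longrightarrow> f z = 0) \<Longrightarrow>
    A \<in> sets borel \<Longrightarrow> emeasure lborel A < \<infinity> \<Longrightarrow> measure lborel A > 0 \<Longrightarrow>
    D \<in> sets borel \<Longrightarrow> emeasure lborel D < \<infinity> \<Longrightarrow> measure lborel D > 0 \<Longrightarrow> (\<forall>z. z \<notin> D \<longrightarrow> f z = 0) \<Longrightarrow>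
    0 < w \<Longrightarrow> w \<le> w0 \<Longrightarrow> 0 \<le> J \<Longrightarrow>
    (\<forall>x\<in>A. \<exists>B. 5/4 \<le> B \<and> B \<le> 3 \<and> (\<forall>z. f z \<noteq> 0 \<longrightarrow> norm (x - z) \<le> 2 \<longrightarrow> \<bar>(norm (x - z))\<^sup>2 - B\<bar> \<le> w)
       \<and> J \<le> (LINT z|lborel. indicator (cball x 2) z * f z)) \<Longrightarrow>
    w powr (Re \<alpha> - 1) * J * measure lborel A powr b \<le> C * measure lborel D powr a"
    using maximal_bound_test[OF bd] unfolding a_def b_def by blast
  define K1 where "K1 = 2 powr (Re \<alpha> - 1) * (exp (-2) * V) * (V * (1/5) ^ n) powr b"
  define K2 where "K2 = C * (V * (real n * 2 ^ n * 2)) powr a"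
  define C' where "C' = K2 / K1"
  have K1: "K1 > 0" using V by (simp add: K1_def)
  define d0 where "d0 = min (1/10) (w0 / 2)"
  have C': "C' > 0" using C V n K1 by (simp add: C'_def K2_def n_def)
  have d0: "d0 > 0" using C by (simp add: d0_def)
  have "d powr (Re \<alpha>) * d powr (real n * b) \<le> C' * d powr a" if d: "0 < d" "d \<le> d0" for d
  proof -
    have d': "d \<le> 1/10" "2 * d \<le> w0" using d by (auto simp: d0_def)
    define f where "f z = cutoff (1 + (-1) * ((1 / d * (z \<bullet> z + (-2))) * (1 / d * (z \<bullet> z + (-2)))))" for z :: "real^'n"
    \<comment> \<open>With |z| <= 3/2 and |x| <= d/5, moving the centre changes the squared distance
      by at most 3d/5 + d/5. Together with the shell's own \<open>d\<close> this stays below the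
      width 2 d used in the test.\<close>
    define A where "A = cball (0::real^'n) (d/5)"
    define shell where "shell e = {z::real^'n. 2 - e \<le> (norm z)\<^sup>2 \<and> (norm z)\<^sup>2 \<le> 2 + e}" for e
    have sm: "smooth f"
    proof -
      have "smooth (\<lambda>z::real^'n. \<Sum>i\<in>UNIV. z $ i * z $ i)"
        by (intro smooth_sum smooth_mult smooth_component)
      then have "smooth (\<lambda>z::real^'n. z \<bullet> z)" by (simp add: inner_vec_def)
      then have s1: "smooth (\<lambda>z::real^'n. 1 / d * (z \<bullet> z + (-2)))"
        by (intro smooth_mult smooth_add smooth_const)
      have "smooth (\<lambda>z::real^'n. 1 + (-1) * ((1 / d * (z \<bullet> z + (-2))) * (1 / d * (z \<bullet> z + (-2)))))"
        by (intro smooth_add smooth_const smooth_mult[of "\<lambda>_. -1"] smooth_mult[OF s1 s1])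
      then show ?thesis
        unfolding f_def[abs_def] by (rule smooth_cutoff_compose)
    qed
    have fz: "f z = cutoff (1 - (((norm z)\<^sup>2 - 2) / d)\<^sup>2)" for z
      unfolding f_def power2_norm_eq_inner by (simp add: power2_eq_square)
    have supp: "z \<in> shell d" if "f z \<noteq> 0" for z
    proof -
      have "(((norm z)\<^sup>2 - 2) / d)\<^sup>2 < 1" using that cutoff_eq_0[of "1 - (((norm z)\<^sup>2 - 2) / d)\<^sup>2"] by (force simp: fz)
      then have "\<bar>((norm z)\<^sup>2 - 2) / d\<bar> < 1" by (simp add: abs_square_less_1)
      then have "\<bar>(norm z)\<^sup>2 - 2\<bar> < d" using d by (simp add: abs_divide field_simps)
      then show ?thesis by (auto simp: shell_def abs_less_iff)
    qed
    have shell_norm: "norm z \<le> 3/2" if "z \<in> shell d" for z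
    proof (rule power2_le_imp_le)
      have "(norm z)\<^sup>2 \<le> 9/4" using that d' unfolding shell_def mem_Collect_eq by linarith
      then show "(norm z)\<^sup>2 \<le> (3/2)\<^sup>2" by (simp add: power_divide)
    qed simp
    have big: "f z \<ge> exp (-2)" if "z \<in> shell (d/2)" for z
    proof -
      have "\<bar>(norm z)\<^sup>2 - 2\<bar> \<le> d/2" using that unfolding shell_def mem_Collect_eq abs_le_iff by linarith
      then have "\<bar>((norm z)\<^sup>2 - 2) / d\<bar> \<le> 1/2" using d by (simp add: abs_divide field_simps)
      then have "\<bar>((norm z)\<^sup>2 - 2) / d\<bar>\<^sup>2 \<le> (1/2)\<^sup>2" by (intro power_mono) auto
      then have "(((norm z)\<^sup>2 - 2) / d)\<^sup>2 \<le> 1/4" by (simp add: power2_eq_square)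
      then show ?thesis unfolding fz by (intro cutoff_ge) auto
    qed
    have shell_closed: "closed (shell e)" for e
      unfolding shell_def by (intro closed_Collect_conj closed_Collect_le continuous_intros)
    have shell_bdd: "bounded (shell e)" for e
    proof (rule boundedI)
      fix z assume "z \<in> shell e"
      then show "norm z \<le> sqrt (2 + e)" by (simp add: shell_def real_le_rsqrt)
    qed
    have shell_meas: "measure lborel (shell e) = V * (sqrt (2 + e) ^ n - sqrt (2 - e) ^ n)" if "0 \<le> e" "e \<le> 1" for e
      using measure_norm_sq_shell[of "2 - e" "2 + e", where 'n='n] that by (simp add: shell_def V_def n_def)
    have shell_ge: "measure lborel (shell (d/2)) \<ge> V * d"
    proof -
      define x y where "x = sqrt (2 - d/2)" and "y = sqrt (2 + d/2)"
      have xy: "1 \<le> x" "x \<le> y" "y\<^sup>2 - x\<^sup>2 = d" using d d' by (auto simp: x_def y_def)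
      \<comment> \<open>Because n >= 2 and both radii are at least 1, y^n - x^n dominates y^2 - x^2,
        which equals \<open>d\<close>.\<close>
      obtain m where m: "n = m + 2" using n by (metis add.commute le_Suc_ex n_def)
      have "1 * (y\<^sup>2 - x\<^sup>2) \<le> y ^ m * (y\<^sup>2 - x\<^sup>2)"
        using xy d by (intro mult_right_mono one_le_power) auto
      also have "\<dots> \<le> y ^ n - x ^ n"
      proof -
        have "x ^ m * x\<^sup>2 \<le> y ^ m * x\<^sup>2" using xy by (intro mult_right_mono power_mono) auto
        then show ?thesis unfolding m power_add right_diff_distrib by linarith
      qed
      finally have "d \<le> y ^ n - x ^ n" unfolding xy(3) mult_1 .
      then have "V * d \<le> V * (y ^ n - x ^ n)" using V by (intro mult_left_mono) auto
      also have "\<dots> = measure lborel (shell (d/2))"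
        unfolding x_def y_def by (rule shell_meas[symmetric]) (use d d' in auto)
      finally show ?thesis .
    qed
    have shell_le: "measure lborel (shell d) \<le> V * (real n * 2 ^ n * 2) * d"
    proof -
      define x y where "x = sqrt (2 - d)" and "y = sqrt (2 + d)"
      have y2: "y \<le> 2" unfolding y_def by (rule real_le_lsqrt) (use d d' in auto)
      have xy: "1 \<le> x" "x \<le> y" "y\<^sup>2 - x\<^sup>2 = 2 * d" using d d' by (auto simp: x_def y_def)
      have "1 * (y - x) \<le> (y + x) * (y - x)" using xy by (intro mult_right_mono) auto
      also have "\<dots> = y\<^sup>2 - x\<^sup>2" by (simp add: power2_eq_square algebra_simps)
      also note xy(3)
      finally have yx: "y - x \<le> 2 * d" by simp
      have "y ^ n - x ^ n \<le> real n * 2 ^ n * (y - x)" by (rule power_diff_le) (use xy y2 in auto)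
      also have "\<dots> \<le> real n * 2 ^ n * (2 * d)" using yx by (intro mult_left_mono) auto
      finally have "V * (y ^ n - x ^ n) \<le> V * (real n * 2 ^ n * (2 * d))" using V by (intro mult_left_mono) auto
      also have "V * (y ^ n - x ^ n) = measure lborel (shell d)"
        unfolding x_def y_def by (rule shell_meas[symmetric]) (use d d' in auto)
      finally show ?thesis by (simp only: mult_ac)
    qed
    have sub: "shell (d/2) \<subseteq> shell d" using d by (auto simp: shell_def)
    have fin: "emeasure lborel (shell e) < \<infinity>" for e by (rule emeasure_bounded_finite[OF shell_bdd])
    have pos: "measure lborel (shell d) > 0"
    proof -
      have "measure lborel (shell (d/2)) \<le> measure lborel (shell d)"
        using sub fin[of d] shell_closed by (intro measure_mono_fmeasurable) (auto simp: fmeasurable_def)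
      then show ?thesis using shell_ge mult_pos_pos[OF V d(1)] by linarith
    qed
    define J where "J = exp (-2) * (V * d)"
    have mA: "measure lborel A = V * (d/5) ^ n" using d by (simp add: A_def content_cball V_def n_def)
    have near: "norm (x - z) \<le> 2 \<and> \<bar>(norm (x - z))\<^sup>2 - 2\<bar> \<le> 2 * d" if x: "x \<in> A" and z: "z \<in> shell d" for x z
    proof
      have xn: "norm x \<le> d/5" using x by (simp add: A_def)
      have zn: "norm z \<le> 3/2" by (rule shell_norm[OF z])
      show "norm (x - z) \<le> 2" using norm_triangle_ineq4[of x z] xn zn d' by linarith
      have "(norm (x - z))\<^sup>2 = (norm x)\<^sup>2 - 2 * (x \<bullet> z) + (norm z)\<^sup>2"
        by (simp add: power2_norm_eq_inner inner_diff inner_commute)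
      moreover have "\<bar>x \<bullet> z\<bar> \<le> d/5 * (3/2)"
        using Cauchy_Schwarz_ineq2[of x z] mult_mono[OF xn zn] d by simp
      moreover have "(norm x)\<^sup>2 \<le> d/5 * 1"
        unfolding power2_eq_square using xn d d' by (intro mult_mono) auto
      moreover have "(norm x)\<^sup>2 \<ge> 0" by simp
      moreover have "\<bar>(norm z)\<^sup>2 - 2\<bar> \<le> d" using z unfolding shell_def mem_Collect_eq abs_le_iff by linarith
      ultimately show "\<bar>(norm (x - z))\<^sup>2 - 2\<bar> \<le> 2 * d" unfolding abs_le_iff by linarith
    qed
    have int: "J \<le> (LINT z|lborel. indicator (cball x 2) z * f z)" if x: "x \<in> A" for x
    proof -
      have "J \<le> (LINT z|lborel. exp (-2) * indicator (shell (d/2)) z)"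
        using shell_ge shell_closed by (simp add: J_def)
      also have "\<dots> \<le> (LINT z|lborel. indicator (cball x 2) z * f z)"
      proof (rule integral_mono)
        show "integrable lborel (\<lambda>z. exp (-2) * indicator (shell (d/2)) z :: real)"
          using fin shell_closed by (intro integrable_mult_right integrable_real_indicator) auto
        show "integrable lborel (\<lambda>z. indicator (cball x 2) z * f z)"
          by (rule integrable_mult_compact_support[of f "3/2" _ 1])
            (use smooth_continuous[OF sm] supp shell_norm in \<open>force simp: indicator_def\<close>)+
        fix z
        show "exp (-2) * indicator (shell (d/2)) z \<le> indicator (cball x 2) z * f z"
          using big[of z] near[OF x, of z] sub cutoff_nonneg
          by (auto simp: indicator_def dist_norm fz)
      qed
      finally show ?thesis .
    qed
    have "(2 * d) powr (Re \<alpha> - 1) * J * measure lborel A powr b \<le> C * measure lborel (shell d) powr a"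
    proof (rule test[of f "3/2" A "shell d" "2 * d" J])
      show "smooth f" by (rule sm)
      show "\<forall>z. 0 \<le> f z" "\<forall>z. f z \<le> 1" by (auto simp: fz cutoff_nonneg cutoff_le_1)
      show "\<forall>z. norm z > 3/2 \<longrightarrow> f z = 0" using supp shell_norm by force
      show "emeasure lborel A < \<infinity>" unfolding A_def by (rule emeasure_lborel_cball_finite)
      show "measure lborel A > 0" using V d by (simp add: mA)
      show "\<forall>x\<in>A. \<exists>B. 5/4 \<le> B \<and> B \<le> 3 \<and> (\<forall>z. f z \<noteq> 0 \<longrightarrow> norm (x - z) \<le> 2 \<longrightarrow> \<bar>(norm (x - z))\<^sup>2 - B\<bar> \<le> 2 * d)
         \<and> J \<le> (LINT z|lborel. indicator (cball x 2) z * f z)"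
        using near supp int by (intro ballI exI[of _ 2]) auto
    qed (use d d' pos fin shell_closed supp V in \<open>auto simp: A_def J_def\<close>)
    also have "\<dots> \<le> C * (V * (real n * 2 ^ n * 2) * d) powr a"
      using C shell_le by (intro mult_left_mono powr_mono2) (auto simp: a_def)
    also have "\<dots> = K2 * d powr a" by (simp only: powr_mult K2_def mult.assoc)
    also have "measure lborel A powr b = (V * (1/5) ^ n) powr b * (d ^ n) powr b"
    proof -
      have "V * (d/5) ^ n = V * (1/5) ^ n * d ^ n" by (simp add: power_divide)
      then show ?thesis by (simp only: mA powr_mult)
    qed
    also have "(2 * d) powr (Re \<alpha> - 1) * J * ((V * (1/5) ^ n) powr b * (d ^ n) powr b) = K1 * (d powr (Re \<alpha> - 1) * d * (d ^ n) powr b)"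
    proof -
      have "(2 * d) powr (Re \<alpha> - 1) = 2 powr (Re \<alpha> - 1) * d powr (Re \<alpha> - 1)" by (rule powr_mult)
      then show ?thesis by (simp only: J_def K1_def mult_ac)
    qed
    also have "d powr (Re \<alpha> - 1) * d = d powr Re \<alpha>" using d by (simp add: powr_diff)
    also have "(d ^ n) powr b = d powr (real n * b)" using d by (simp add: powr_realpow[symmetric] powr_powr)
    finally show ?thesis unfolding C'_def using K1 by (simp add: field_simps)
  qed
  then show ?thesis using C' d0 unfolding a_def b_def n_def by blast
qed


subsection \<open>Translated ellipsoids\<close>

lemma measure_cbox_elongated:
  fixes l u :: "real^'n::finite"
  assumes "0 \<le> s" "0 \<le> t" "\<And>i. u $ i - l $ i = (if i = k then s else t)"
  shows "measure lborel (cbox l u) = s * t ^ (CARD('n) - 1)"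
proof -
  have le: "l $ i \<le> u $ i" for i
    using assms(3)[of i] assms(1,2) by (cases "i = k") auto
  then have "cbox l u \<noteq> {}" by (simp add: interval_ne_empty_cart)
  then have "measure lborel (cbox l u) = (\<Prod>i\<in>UNIV. if i = k then s else t)"
    by (simp add: content_cbox_cart assms(3))
  also have "\<dots> = s * (\<Prod>i\<in>UNIV - {k}. if i = k then s else t)"
    by (subst prod.remove[of _ k]) auto
  also have "(\<Prod>i\<in>UNIV - {k}. if i = k then s else t) = (\<Prod>i\<in>UNIV - {k}. t)"
    by (rule prod.cong) auto
  finally show ?thesis by simp
qed

lemma sum_le_exceptional:
  fixes g :: "'n::finite \<Rightarrow> real"
  assumes "g k \<le> P" "\<And>i. i \<noteq> k \<Longrightarrow> g i \<le> K" "K \<ge> 0"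
  shows "(\<Sum>i\<in>UNIV. g i) \<le> P + real CARD('n) * K"
proof -
  have "(\<Sum>i\<in>UNIV. g i) = g k + (\<Sum>i\<in>UNIV - {k}. g i)" by (rule sum.remove) auto
  also have "(\<Sum>i\<in>UNIV - {k}. g i) \<le> real (card (UNIV - {k})) * K"
    using assms(2) by (intro sum_bounded_above) auto
  also have "\<dots> \<le> real CARD('n) * K"
    using assms(3) by (intro mult_right_mono) (auto simp: card_Diff_subset)
  finally show ?thesis using assms(1) by simp
qed

text \<open>One family covers three examples: \<open>N\<close> ellipsoids with half-axis
  \<open>d\<close> along \<open>k\<close> and \<open>e\<close> across, observed from boxes of
  half-width \<rho> across and fixed length along \<open>k\<close>. The condition on \<rho> e bounds
  the transverse part of the cross term in |y - v|^2 and the one on e^2 the transverse part of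
  |v|^2, so the width is comparable to \<open>d\<close>; \<open>J\<close> is comparable to d
  e^(n-1).\<close>

lemma ellipsoid_test:
  assumes bd: "maximal_bound TYPE('n::finite) p q \<alpha>"
  shows "\<exists>C>0. \<exists>d0>0. \<forall>d e \<rho>. \<forall>N::nat. 0 < d \<longrightarrow> d \<le> d0 \<longrightarrow> 0 < e \<longrightarrow> e \<le> 1 / (2 * real CARD('n)) \<longrightarrow>
    0 < \<rho> \<longrightarrow> \<rho> \<le> 1 / (2 * real CARD('n)) \<longrightarrow> \<rho> * e \<le> d \<longrightarrow> e\<^sup>2 \<le> d \<longrightarrow> N \<ge> 1 \<longrightarrow>
    d powr (Re \<alpha>) * e ^ (CARD('n) - 1) * (real N * \<rho> ^ (CARD('n) - 1)) powr enn2real (1 / q)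
      \<le> C * (real N * (d * e ^ (CARD('n) - 1))) powr enn2real (1 / p)"
proof -
  define a b where "a = enn2real (1 / p)" and "b = enn2real (1 / q)"
  define n where "n = CARD('n)"
  have n: "n \<ge> 1" by (simp add: n_def Suc_le_eq)
  \<comment> \<open>An arbitrary coordinate direction; nothing distinguishes it.\<close>
  define k where "k = (undefined :: 'n)"
  obtain C w0 where C: "C > 0" "w0 > 0" and test: "\<And>(f::real^'n \<Rightarrow> real) R A D w J. smooth f \<Longrightarrow> (\<forall>z. 0 \<le> f z) \<Longrightarrow> (\<forall>z. f z \<le> 1) \<Longrightarrow> (\<forall>z. norm z > R \<longrightarrow> f z = 0) \<Longrightarrow>
    A \<in> sets borel \<Longrightarrow> emeasure lborel A < \<infinity> \<Longrightarrow> measure lborel A > 0 \<Longrightarrow>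
    D \<in> sets borel \<Longrightarrow> emeasure lborel D < \<infinity> \<Longrightarrow> measure lborel D > 0 \<Longrightarrow> (\<forall>z. z \<notin> D \<longrightarrow> f z = 0) \<Longrightarrow>
    0 < w \<Longrightarrow> w \<le> w0 \<Longrightarrow> 0 \<le> J \<Longrightarrow>
    (\<forall>x\<in>A. \<exists>B. 5/4 \<le> B \<and> B \<le> 3 \<and> (\<forall>z. f z \<noteq> 0 \<longrightarrow> norm (x - z) \<le> 2 \<longrightarrow> \<bar>(norm (x - z))\<^sup>2 - B\<bar> \<le> w)
       \<and> J \<le> (LINT z|lborel. indicator (cball x 2) z * f z)) \<Longrightarrow>
    w powr (Re \<alpha> - 1) * J * measure lborel A powr b \<le> C * measure lborel D powr a"
    using maximal_bound_test[OF bd] unfolding a_def b_def by blast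
  define K1 where "K1 = (5 * real n) powr (Re \<alpha> - 1) * (exp (-2) * (1 / real n * (1 / real n) ^ (n - 1))) * (1 / 10 * 2 ^ (n - 1)) powr b"
  define K2 where "K2 = C * (2 * 2 ^ (n - 1)) powr a"
  have K: "K1 > 0" "K2 > 0" using n C by (auto simp: K1_def K2_def)
  define d0 where "d0 = min (1/10) (w0 / (5 * real n))"
  have d0: "d0 > 0" using C n by (simp add: d0_def)
  have main: "d powr (Re \<alpha>) * e ^ (n - 1) * (real N * \<rho> ^ (n - 1)) powr b \<le> K2 / K1 * (real N * (d * e ^ (n - 1))) powr a"
    if d: "0 < d" "d \<le> d0" and e: "0 < e" "e \<le> 1 / (2 * real n)" and \<rho>: "0 < \<rho>" "\<rho> \<le> 1 / (2 * real n)"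
      and de: "\<rho> * e \<le> d" "e\<^sup>2 \<le> d" and N: "N \<ge> 1" for d e \<rho> :: real and N :: nat
  proof -
    have d': "d \<le> 1/10" "5 * real n * d \<le> w0" using d n by (auto simp: d0_def field_simps)
    define wd where "wd i = (if i = k then d else e)" for i :: 'n
    have wd: "wd i > 0" for i using d e by (simp add: wd_def)
    define bump where "bump v = cutoff (1 + (-1) * (\<Sum>i\<in>UNIV. (1 / wd i * v $ i) * (1 / wd i * v $ i)))" for v :: "real^'n"
    \<comment> \<open>Spacing 10 exceeds everything in play: an observer sits at most 13/10 beyond
      its centre, sees up to distance 2, and a bump reaches at most 1/10. Hence each observer sees
      one bump only.\<close>
    define ctr where "ctr j = (axis k (10 * real j) :: real^'n)" for j :: nat
    have ctr: "ctr j $ i = (if i = k then 10 * real j else 0)" for j i by (simp add: ctr_def axis_def)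
    \<comment> \<open>The shape \<open>- ctr j + 1 *\<^sub>R z\<close> is the one that
      \<open>smooth_compose_affine\<close> expects.\<close>
    define f where "f z = (\<Sum>j<N. bump (- ctr j + 1 *\<^sub>R z))" for z
    have f_eq: "f z = (\<Sum>j<N. bump (z - ctr j))" for z by (simp add: f_def)
    have sm_bump: "smooth bump"
      unfolding bump_def[abs_def]
      by (intro smooth_cutoff_compose smooth_add smooth_const smooth_mult[of "\<lambda>_. -1"] smooth_sum smooth_mult smooth_component)
    have sm: "smooth f" unfolding f_def[abs_def] by (intro smooth_sum smooth_compose_affine sm_bump)
    have bump01: "0 \<le> bump v" "bump v \<le> 1" for v by (auto simp: bump_def cutoff_nonneg cutoff_le_1)
    have bump_nz: "\<bar>v $ i\<bar> \<le> wd i" if "bump v \<noteq> 0" for v i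
    proof -
      have "(1 / wd i * v $ i) * (1 / wd i * v $ i) \<le> (\<Sum>i\<in>UNIV. (1 / wd i * v $ i) * (1 / wd i * v $ i))"
        by (rule member_le_sum[of i UNIV "\<lambda>i. (1 / wd i * v $ i) * (1 / wd i * v $ i)"]) auto
      also have "\<dots> < 1"
        using that cutoff_eq_0[of "1 + (-1) * (\<Sum>i\<in>UNIV. (1 / wd i * v $ i) * (1 / wd i * v $ i))"]
        unfolding bump_def by linarith
      finally have "(v $ i / wd i)\<^sup>2 < 1" by (simp add: power2_eq_square)
      then have "\<bar>v $ i / wd i\<bar> < 1" by (simp add: abs_square_less_1)
      then show ?thesis using wd[of i] by (simp add: abs_divide field_simps)
    qed
    \<comment> \<open>Shrinking every half-axis by 2n makes each of the n squares at most 1/(2n), so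
      their sum is at most 1/2.\<close>
    have bump_ge: "exp (-2) \<le> bump v" if "\<And>i. \<bar>v $ i\<bar> \<le> wd i / (2 * real n)" for v
    proof -
      have "(1 / wd i * v $ i) * (1 / wd i * v $ i) \<le> 1 / (2 * real n)" for i
      proof -
        have "\<bar>v $ i\<bar> / wd i \<le> (wd i / (2 * real n)) / wd i" using that[of i] wd[of i] by (intro divide_right_mono) auto
        then have le: "\<bar>v $ i\<bar> / wd i \<le> 1 / (2 * real n)" using wd[of i] by simp
        have "1 / (2 * real n) \<le> 1" using n by simp
        then have "\<bar>v $ i\<bar> / wd i \<le> 1" using le by (rule order_trans[rotated])
        then have "(\<bar>v $ i\<bar> / wd i) * (\<bar>v $ i\<bar> / wd i) \<le> 1 / (2 * real n) * 1"
          using le wd[of i] by (intro mult_mono) auto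
        then show ?thesis using abs_mult_self_eq[of "v $ i"] by simp
      qed
      then have "(\<Sum>i\<in>UNIV. (1 / wd i * v $ i) * (1 / wd i * v $ i)) \<le> real (card (UNIV :: 'n set)) * (1 / (2 * real n))"
        by (intro sum_bounded_above) auto
      also have "\<dots> = 1/2" using n by (simp add: n_def)
      finally show ?thesis unfolding bump_def by (intro cutoff_ge) auto
    qed
    have near_ctr: "\<bar>z $ k - 10 * real j\<bar> \<le> 1/10" if "bump (z - ctr j) \<noteq> 0" for z j
      using bump_nz[OF that, of k] d' by (simp add: ctr wd_def)
    have single: "f z = bump (z - ctr j)" if j: "j < N" "bump (z - ctr j) \<noteq> 0" for z j
    proof -
      have "bump (z - ctr j') = 0" if "j' \<noteq> j" for j'
      proof (rule ccontr)
        assume "bump (z - ctr j') \<noteq> 0"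
        from near_ctr[OF this] near_ctr[OF j(2)] have "\<bar>real j - real j'\<bar> < 1" by linarith
        then show False using \<open>j' \<noteq> j\<close> by linarith
      qed
      then have "(\<Sum>j'<N. bump (z - ctr j')) = (\<Sum>j'\<in>{j}. bump (z - ctr j'))"
        using j(1) by (intro sum.mono_neutral_right) auto
      then show ?thesis by (simp add: f_eq)
    qed
    have f_nz: "\<exists>j<N. bump (z - ctr j) \<noteq> 0" if "f z \<noteq> 0" for z
      using that unfolding f_eq by (metis lessThan_iff sum.neutral)
    have f01: "0 \<le> f z" "f z \<le> 1" for z
      unfolding f_eq using bump01 single[of _ z] f_nz[of z] by (auto intro!: sum_nonneg) (metis f_eq bump01(2) zero_le_one)
    have f_ge: "bump (z - ctr j) \<le> f z" if "j < N" for z j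
      unfolding f_eq using that bump01 by (intro member_le_sum[of j "{..<N}" "\<lambda>j. bump (z - ctr j)"]) auto
    define wv where "wv = (\<chi> i. wd i)"
    \<comment> \<open>The boxes \<open>Dj\<close> enclose the supports, \<open>Pj\<close> are cores
      on which the bumps are bounded below, and \<open>Aj\<close> hold the observers.\<close>
    define Dj where "Dj j = cbox (ctr j - wv) (ctr j + wv)" for j
    define Pj where "Pj j = cbox (ctr j - (1 / (2 * real n)) *\<^sub>R wv) (ctr j + (1 / (2 * real n)) *\<^sub>R wv)" for j
    define Aj where "Aj j = cbox (ctr j + (\<chi> i. if i = k then 6/5 else - \<rho>)) (ctr j + (\<chi> i. if i = k then 13/10 else \<rho>))" for j
    define D where "D = (\<Union>j<N. Dj j)"
    define A where "A = (\<Union>j<N. Aj j)"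
    have mDj: "measure lborel (Dj j) = 2 * d * (2 * e) ^ (n - 1)" for j
      unfolding Dj_def n_def using d e by (intro measure_cbox_elongated[of _ _ _ _ k]) (auto simp: wv_def wd_def)
    have mPj: "measure lborel (Pj j) = d / real n * (e / real n) ^ (n - 1)" for j
      unfolding Pj_def n_def using d e n by (intro measure_cbox_elongated[of _ _ _ _ k]) (auto simp: wv_def wd_def n_def field_simps)
    have mAj: "measure lborel (Aj j) = 1/10 * (2 * \<rho>) ^ (n - 1)" for j
      unfolding Aj_def n_def using \<rho> by (intro measure_cbox_elongated[of _ _ _ _ k]) auto
    have box: "Aj j \<in> sets lborel" "emeasure lborel (Aj j) \<noteq> \<infinity>" "Dj j \<in> sets lborel" "emeasure lborel (Dj j) \<noteq> \<infinity>"
      "bounded (Aj j)" "bounded (Dj j)" for j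
      by (simp_all add: Aj_def Dj_def emeasure_lborel_cbox_eq)
    have mA: "measure lborel A = real N * (1/10 * (2 * \<rho>) ^ (n - 1))"
    proof -
      have "disjoint_family_on Aj {..<N}"
      proof (unfold disjoint_family_on_def, intro ballI impI)
        fix i j :: nat assume "i \<noteq> j"
        show "Aj i \<inter> Aj j = {}"
        proof (rule ccontr)
          assume "Aj i \<inter> Aj j \<noteq> {}"
          then obtain x where "x \<in> Aj i" "x \<in> Aj j" by auto
          then have "10 * real i + 6/5 \<le> x $ k" "x $ k \<le> 10 * real i + 13/10" "10 * real j + 6/5 \<le> x $ k" "x $ k \<le> 10 * real j + 13/10"
            by (auto simp: Aj_def mem_box_cart ctr dest!: spec[of _ k])
          then have "\<bar>real i - real j\<bar> < 1" by linarith
          then show False using \<open>i \<noteq> j\<close> by linarith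
        qed
      qed
      then have "measure lborel A = (\<Sum>j<N. measure lborel (Aj j))"
        unfolding A_def using box by (intro measure_finite_Union) auto
      then show ?thesis unfolding mAj by simp
    qed
    \<comment> \<open>Only an upper bound is needed on this side, so subadditivity suffices;
      \<open>A\<close> needs a lower bound and hence disjointness.\<close>
    have mD: "measure lborel D \<le> real N * (2 * d * (2 * e) ^ (n - 1))"
    proof -
      have "measure lborel D \<le> (\<Sum>j<N. measure lborel (Dj j))"
        unfolding D_def using box by (intro measure_subadditive_finite) auto
      then show ?thesis unfolding mDj by simp
    qed
    have bdd: "bounded A" "bounded D"
      unfolding A_def D_def by (intro bounded_UN finite_lessThan ballI box)+
    have sets: "A \<in> sets borel" "D \<in> sets borel"
      unfolding A_def D_def using box by auto
    have fin: "emeasure lborel A < \<infinity>" "emeasure lborel D < \<infinity>"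
      by (intro emeasure_bounded_finite bdd)+
    have Dpos: "measure lborel D > 0"
    proof -
      have "Dj 0 \<subseteq> D" unfolding D_def using N by (intro UN_upper) auto
      then have "measure lborel (Dj 0) \<le> measure lborel D"
        using fin(2) sets(2) by (intro measure_mono_fmeasurable) (auto simp: fmeasurable_def Dj_def)
      moreover have "measure lborel (Dj 0) > 0" using d e by (simp add: mDj)
      ultimately show ?thesis by linarith
    qed
    have f_D: "z \<in> D" if nz: "f z \<noteq> 0" for z
    proof -
      obtain j where "j < N" "bump (z - ctr j) \<noteq> 0" using f_nz[OF nz] by auto
      then have "z \<in> Dj j" using bump_nz[of "z - ctr j"]
        by (auto simp: Dj_def mem_box_cart wv_def abs_le_iff algebra_simps)
      then show ?thesis using \<open>j < N\<close> by (auto simp: D_def)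
    qed
    obtain R where R: "\<And>z. z \<in> D \<Longrightarrow> norm z \<le> R" using bdd(2) by (auto simp: bounded_iff)
    define J where "J = exp (-2) * (d / real n * (e / real n) ^ (n - 1))"
    \<comment> \<open>Here \<open>y\<close> is the observer and \<open>v\<close> a point of the
      bump, both relative to the same centre. The numbers fit: 36/25 >= 5/4, 169/100 + 1/2 <= 3, and
      49/25 + 1 <= 4.\<close>
    have yv: "y \<bullet> y \<ge> 5/4 \<and> y \<bullet> y \<le> 3 \<and> norm (y - v) \<le> 2 \<and> \<bar>(norm (y - v))\<^sup>2 - y \<bullet> y\<bar> \<le> 5 * real n * d"
      if y: "6/5 \<le> y $ k" "y $ k \<le> 13/10" "\<And>i. i \<noteq> k \<Longrightarrow> \<bar>y $ i\<bar> \<le> \<rho>" and v: "\<And>i. \<bar>v $ i\<bar> \<le> wd i" for y v :: "real^'n"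
    proof (intro conjI)
      have "6/5 * (6/5) \<le> y $ k * y $ k" using y by (intro mult_mono) auto
      also have "\<dots> \<le> y \<bullet> y"
        unfolding inner_vec_def using member_le_sum[of k UNIV "\<lambda>i. y $ i * y $ i"] by simp
      finally show "y \<bullet> y \<ge> 5/4" by simp
      have half: "1 / (2 * real n) \<le> 1/2" using n by (simp add: field_simps)
      have nn: "real n * (1 / (2 * real n)) = 1/2" using n by simp
      have "y \<bullet> y \<le> 13/10 * (13/10) + real CARD('n) * (1 / (2 * real n))"
        unfolding inner_vec_def
      proof (rule sum_le_exceptional[of _ k])
        have "y $ k * y $ k \<le> 13/10 * (13/10)" using y(1,2) by (intro mult_mono) auto
        then show "y $ k \<bullet> y $ k \<le> 13/10 * (13/10)" by (simp only: inner_real_def)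
        fix i assume i: "i \<noteq> k"
        have "\<bar>y $ i\<bar> * \<bar>y $ i\<bar> \<le> 1 / (2 * real n) * 1"
          using y(3)[OF i] \<rho> half by (intro mult_mono) auto
        then show "y $ i \<bullet> y $ i \<le> 1 / (2 * real n)" using abs_mult_self_eq[of "y $ i"] by simp
      qed simp
      then show "y \<bullet> y \<le> 3" using nn by (simp add: n_def)
      have v1: "\<bar>v $ k\<bar> \<le> d" using v[of k] by (simp add: wd_def)
      have v2: "\<bar>v $ i\<bar> \<le> e" if "i \<noteq> k" for i using v[of i] that by (simp add: wd_def)
      note v' = v1 v2
      have "(y - v) \<bullet> (y - v) \<le> 7/5 * (7/5) + real CARD('n) * (2 * (1 / (2 * real n)))"
        unfolding inner_vec_def
      proof (rule sum_le_exceptional[of _ k])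
        have "\<bar>y $ k - v $ k\<bar> \<le> 7/5" using y v'(1) d' by linarith
        then have "\<bar>y $ k - v $ k\<bar> * \<bar>y $ k - v $ k\<bar> \<le> 7/5 * (7/5)" by (intro mult_mono) auto
        then show "(y - v) $ k \<bullet> (y - v) $ k \<le> 7/5 * (7/5)" using abs_mult_self_eq[of "y $ k - v $ k"] by simp
        fix i assume i: "i \<noteq> k"
        have le: "\<bar>y $ i - v $ i\<bar> \<le> 2 * (1 / (2 * real n))" using y(3)[OF i] v'(2)[OF i] \<rho> e by linarith
        moreover have "\<bar>y $ i - v $ i\<bar> \<le> 1" using le half by linarith
        ultimately have "\<bar>y $ i - v $ i\<bar> * \<bar>y $ i - v $ i\<bar> \<le> 2 * (1 / (2 * real n)) * 1" by (intro mult_mono) auto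
        then show "(y - v) $ i \<bullet> (y - v) $ i \<le> 2 * (1 / (2 * real n))" using abs_mult_self_eq[of "y $ i - v $ i"] by simp
      qed simp
      then have "(norm (y - v))\<^sup>2 \<le> 2\<^sup>2" unfolding power2_norm_eq_inner using n by (simp add: n_def)
      then show "norm (y - v) \<le> 2" by (rule power2_le_imp_le) simp
      \<comment> \<open>Each coordinate contributes at most 2 d. Twice the resulting 2 n d, plus n d
        from |v|^2, explains the width 5 n d.\<close>
      have "\<bar>y \<bullet> v\<bar> \<le> (\<Sum>i\<in>UNIV. \<bar>y $ i * v $ i\<bar>)" unfolding inner_vec_def by (simp add: sum_abs)
      also have "\<dots> \<le> real (card (UNIV :: 'n set)) * (2 * d)"
      proof (rule sum_bounded_above)
        fix i
        show "\<bar>y $ i * v $ i\<bar> \<le> 2 * d"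
        proof (cases "i = k")
          case True
          have "\<bar>y $ k\<bar> * \<bar>v $ k\<bar> \<le> 2 * d" using y v'(1) by (intro mult_mono) auto
          then show ?thesis using True by (simp add: abs_mult)
        next
          case False
          have "\<bar>y $ i\<bar> * \<bar>v $ i\<bar> \<le> \<rho> * e" using y(3)[OF False] v'(2)[OF False] \<rho> by (intro mult_mono) auto
          then show ?thesis using de(1) d(1) by (simp add: abs_mult)
        qed
      qed
      finally have 1: "\<bar>y \<bullet> v\<bar> \<le> 2 * (real n * d)" by (simp add: n_def)
      have "v \<bullet> v \<le> real (card (UNIV :: 'n set)) * d"
        unfolding inner_vec_def
      proof (rule sum_bounded_above)
        fix i
        show "v $ i \<bullet> v $ i \<le> d"
        proof (cases "i = k")
          case True
          have "\<bar>v $ k\<bar> * \<bar>v $ k\<bar> \<le> d * 1" using v'(1) d' d by (intro mult_mono) auto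
          then show ?thesis using True abs_mult_self_eq[of "v $ k"] by simp
        next
          case False
          have "\<bar>v $ i\<bar> * \<bar>v $ i\<bar> \<le> e * e" using v'(2)[OF False] e by (intro mult_mono) auto
          then show ?thesis using de(2) abs_mult_self_eq[of "v $ i"] by (simp add: power2_eq_square)
        qed
      qed
      then have 2: "v \<bullet> v \<le> real n * d" by (simp add: n_def)
      have "(norm (y - v))\<^sup>2 - y \<bullet> y = v \<bullet> v - 2 * (y \<bullet> v)"
        by (simp add: power2_norm_eq_inner inner_diff inner_commute)
      then show "\<bar>(norm (y - v))\<^sup>2 - y \<bullet> y\<bar> \<le> 5 * real n * d"
        using 1 2 inner_ge_zero[of v] unfolding abs_le_iff by linarith
    qed
    have Aj: "6/5 \<le> (x - ctr j) $ k" "(x - ctr j) $ k \<le> 13/10" "i \<noteq> k \<Longrightarrow> \<bar>(x - ctr j) $ i\<bar> \<le> \<rho>" if "x \<in> Aj j" for x j i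
    proof -
      from that have *: "\<And>i. (ctr j + (\<chi> i. if i = k then 6/5 else - \<rho>)) $ i \<le> x $ i \<and> x $ i \<le> (ctr j + (\<chi> i. if i = k then 13/10 else \<rho>)) $ i"
        unfolding Aj_def mem_box_cart by blast
      show "6/5 \<le> (x - ctr j) $ k" "(x - ctr j) $ k \<le> 13/10" using *[of k] by auto
      show "\<bar>(x - ctr j) $ i\<bar> \<le> \<rho>" if "i \<noteq> k" using *[of i] that by (auto simp: abs_le_iff)
    qed
    have Pj: "\<bar>(z - ctr j) $ i\<bar> \<le> wd i / (2 * real n)" if "z \<in> Pj j" for z j i
    proof -
      from that have "(ctr j - (1 / (2 * real n)) *\<^sub>R wv) $ i \<le> z $ i \<and> z $ i \<le> (ctr j + (1 / (2 * real n)) *\<^sub>R wv) $ i"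
        unfolding Pj_def mem_box_cart by blast
      then show ?thesis by (auto simp: wv_def abs_le_iff)
    qed
    have int: "J \<le> (LINT z|lborel. indicator (cball x 2) z * f z)" if x: "x \<in> Aj j" and j: "j < N" for x j
    proof -
      have "J = (LINT z|lborel. exp (-2) * indicator (Pj j) z)"
        using mPj[of j] by (simp add: J_def Pj_def)
      also have "\<dots> \<le> (LINT z|lborel. indicator (cball x 2) z * f z)"
      proof (rule integral_mono)
        show "integrable lborel (\<lambda>z. exp (-2) * indicator (Pj j) z :: real)"
          by (intro integrable_mult_right integrable_real_indicator) (auto simp: Pj_def emeasure_lborel_cbox_eq)
        show "integrable lborel (\<lambda>z. indicator (cball x 2) z * f z)"
          by (rule integrable_mult_compact_support[of f R _ 1])
            (use smooth_continuous[OF sm] f_D R in \<open>force simp: indicator_def\<close>)+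
        fix z
        show "exp (-2) * indicator (Pj j) z \<le> indicator (cball x 2) z * f z"
        proof (cases "z \<in> Pj j")
          case True
          have small: "\<bar>(z - ctr j) $ i\<bar> \<le> wd i" for i
          proof -
            have "wd i / (2 * real n) \<le> wd i / 1" using wd[of i] n by (intro divide_left_mono) auto
            then show ?thesis using Pj[OF True, of i] by simp
          qed
          have "norm ((x - ctr j) - (z - ctr j)) \<le> 2" using yv[OF Aj[OF x] small] by blast
          then have "z \<in> cball x 2" by (simp add: dist_norm)
          moreover have "exp (-2) \<le> f z" using bump_ge[OF Pj[OF True]] f_ge[OF j, of z] by linarith
          ultimately show ?thesis using True by simp
        qed (use f01 in simp)
      qed
      finally show ?thesis .
    qed
    have ball: "\<exists>B. 5/4 \<le> B \<and> B \<le> 3 \<and> (\<forall>z. f z \<noteq> 0 \<longrightarrow> norm (x - z) \<le> 2 \<longrightarrow> \<bar>(norm (x - z))\<^sup>2 - B\<bar> \<le> 5 * real n * d)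
       \<and> J \<le> (LINT z|lborel. indicator (cball x 2) z * f z)" if xA: "x \<in> A" for x
    proof -
      obtain j where j: "j < N" and x: "x \<in> Aj j" using xA by (auto simp: A_def)
      define y where "y = x - ctr j"
      note y = Aj[OF x, folded y_def]
      \<comment> \<open>The squared radius is chosen separately for each observer, so the
        observation boxes can keep a fixed length along \<open>k\<close>.\<close>
      have B: "y \<bullet> y \<ge> 5/4" "y \<bullet> y \<le> 3" using yv[OF y, of 0] wd by (auto simp: less_imp_le)
      have "\<bar>(norm (x - z))\<^sup>2 - y \<bullet> y\<bar> \<le> 5 * real n * d" if z: "f z \<noteq> 0" "norm (x - z) \<le> 2" for z
      proof -
        obtain j' where j': "j' < N" "bump (z - ctr j') \<noteq> 0" using f_nz[OF z(1)] by auto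
        have "\<bar>(x - z) $ k\<bar> \<le> 2" using component_le_norm_cart[of "x - z" k] z(2) by linarith
        then have "\<bar>real j - real j'\<bar> < 1"
        proof -
          have "6/5 \<le> x $ k - 10 * real j" "x $ k - 10 * real j \<le> 13/10" using Aj(1,2)[OF x] by (simp_all add: ctr)
          moreover have "x $ k - z $ k \<le> 2" "- 2 \<le> x $ k - z $ k" using \<open>\<bar>(x - z) $ k\<bar> \<le> 2\<close> by (auto simp: abs_le_iff)
          moreover have "z $ k - 10 * real j' \<le> 1/10" "- (1/10) \<le> z $ k - 10 * real j'" using near_ctr[OF j'(2)] by linarith+
          ultimately show ?thesis unfolding abs_less_iff by linarith
        qed
        then have "j' = j" by linarith
        then have "\<bar>(z - ctr j) $ i\<bar> \<le> wd i" for i using bump_nz[OF j'(2)] by simp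
        from yv[OF y this] show ?thesis by (simp add: y_def)
      qed
      then show ?thesis using B int[OF x j] by blast
    qed
    have "(5 * real n * d) powr (Re \<alpha> - 1) * J * measure lborel A powr b \<le> C * measure lborel D powr a"
    proof (rule test[of f R A D "5 * real n * d" J])
      show "\<forall>z. norm z > R \<longrightarrow> f z = 0" using f_D R by force
      show "measure lborel A > 0" unfolding mA using N \<rho> by simp
    qed (use sm f01 sets fin Dpos f_D d d' e n ball in \<open>auto simp: J_def\<close>)
    also have "\<dots> \<le> C * (real N * (2 * d * (2 * e) ^ (n - 1))) powr a"
      using C mD by (intro mult_left_mono powr_mono2) (auto simp: a_def)
    also have "real N * (2 * d * (2 * e) ^ (n - 1)) = (2 * 2 ^ (n - 1)) * (real N * (d * e ^ (n - 1)))"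
      by (simp add: power_mult_distrib)
    also have "C * ((2 * 2 ^ (n - 1)) * (real N * (d * e ^ (n - 1)))) powr a = K2 * (real N * (d * e ^ (n - 1))) powr a"
      unfolding K2_def powr_mult[of "2 * 2 ^ (n - 1)"] by (rule mult.assoc[symmetric])
    also have "measure lborel A powr b = (1 / 10 * 2 ^ (n - 1)) powr b * (real N * \<rho> ^ (n - 1)) powr b"
    proof -
      have "measure lborel A = (1 / 10 * 2 ^ (n - 1)) * (real N * \<rho> ^ (n - 1))"
        by (simp add: mA power_mult_distrib)
      then show ?thesis by (simp only: powr_mult[of "1 / 10 * 2 ^ (n - 1)"])
    qed
    also have "J = exp (-2) * (1 / real n * (1 / real n) ^ (n - 1)) * (d * e ^ (n - 1))"
      by (simp add: J_def power_divide)
    also have "(5 * real n * d) powr (Re \<alpha> - 1) = (5 * real n) powr (Re \<alpha> - 1) * d powr (Re \<alpha> - 1)"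
      by (rule powr_mult)
    finally have "K1 * ((d powr (Re \<alpha> - 1) * d) * e ^ (n - 1) * (real N * \<rho> ^ (n - 1)) powr b) \<le> K2 * (real N * (d * e ^ (n - 1))) powr a"
      by (simp only: K1_def mult_ac)
    also have "d powr (Re \<alpha> - 1) * d = d powr Re \<alpha>" using d by (simp add: powr_diff)
    finally show ?thesis using K by (simp add: field_simps)
  qed
  show ?thesis
    by (rule exI[of _ "K2 / K1"], rule conjI, use K in simp, rule exI[of _ d0], rule conjI[OF d0], intro allI impI)
      (use main in \<open>simp add: a_def b_def n_def\<close>)
qed

text \<open>Letting d tend to 0 compares exponents. The witness makes d^(s-t) at least C + 1, which
  contradicts the bound by \<open>C\<close>.\<close>

lemma powr_exponent_le:
  assumes "d0 > (0::real)" "\<And>d. 0 < d \<Longrightarrow> d \<le> d0 \<Longrightarrow> d powr s \<le> C * d powr t"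
  shows "t \<le> s"
proof (rule ccontr)
  assume "\<not> t \<le> s"
  then have u: "t - s > 0" by simp
  have "0 < d0 powr s" using assms(1) by simp
  also have "\<dots> \<le> C * d0 powr t" using assms by simp
  finally have C: "C > 0" using assms(1) by (simp add: zero_less_mult_iff)
  define d where "d = min d0 ((C + 1) powr (- 1 / (t - s)))"
  have d: "0 < d" "d \<le> d0" using assms(1) C by (auto simp: d_def)
  have "C + 1 = ((C + 1) powr (- 1 / (t - s))) powr (- (t - s))"
  proof -
    have "(- 1 / x) * (- x) = 1" if "x > 0" for x :: real using that by simp
    from this[OF u] show ?thesis using C by (simp only: powr_powr) simp
  qed
  also have "\<dots> \<le> d powr (- (t - s))"
    using d(1) u by (intro powr_mono2') (auto simp: d_def)
  finally have "(C + 1) * d powr t \<le> d powr (- (t - s)) * d powr t" by (intro mult_right_mono) auto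
  also have "\<dots> = d powr s" by (simp add: powr_add[symmetric])
  also have "\<dots> \<le> C * d powr t" by (rule assms(2)[OF d])
  finally show False using d(1) by (simp add: algebra_simps)
qed

lemma powr_nat_exponent_le:
  assumes "\<And>N::nat. N \<ge> 1 \<Longrightarrow> real N powr s \<le> C * real N powr t"
  shows "s \<le> t"
proof (rule ccontr)
  assume "\<not> s \<le> t"
  then have u: "s - t > 0" by simp
  define x where "x = max 1 ((\<bar>C\<bar> + 1) powr (1 / (s - t)))"
  obtain N :: nat where N: "real N \<ge> x" using real_arch_simple by blast
  then have N1: "N \<ge> 1" by (simp add: x_def)
  have "\<bar>C\<bar> + 1 = ((\<bar>C\<bar> + 1) powr (1 / (s - t))) powr (s - t)"
    using u by (simp add: powr_powr)
  also have "\<dots> \<le> real N powr (s - t)"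
    using N u by (intro powr_mono2) (auto simp: x_def)
  finally have "(\<bar>C\<bar> + 1) * real N powr t \<le> real N powr (s - t) * real N powr t" by (intro mult_right_mono) auto
  also have "\<dots> = real N powr s" using N1 by (simp add: powr_add[symmetric])
  also have "\<dots> \<le> C * real N powr t" by (rule assms[OF N1])
  also have "\<dots> \<le> \<bar>C\<bar> * real N powr t" by (intro mult_right_mono) auto
  finally show False using N1 by (simp add: algebra_simps)
qed

section \<open>The necessary conditions\<close>

theorem theorem1p1:
  fixes p q :: ennreal and \<alpha> :: complex
  assumes "CARD('n::finite) \<ge> 2"
    and "1 \<le> p" and "1 \<le> q"
    and "\<exists>C::real. \<forall>f :: real^'n \<Rightarrow> complex. schwartz f \<longrightarrow>
           Lnorm q (stein_maximal \<alpha> f) \<le> ennreal C * Lnorm p (\<lambda>x. ennreal (norm (f x)))"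
  shows "q \<ge> p \<and> Re \<alpha> \<ge> sigma_exponent CARD('n) p q"
proof -
  define a b where "a = enn2real (1 / p)" and "b = enn2real (1 / q)"
  define n where "n = CARD('n)"
  have n: "n \<ge> 2" using assms(1) by (simp add: n_def)
  have bd: "maximal_bound TYPE('n) p q \<alpha>" unfolding maximal_bound_def by (intro conjI assms(2-4))
  obtain C d0 where C: "C > 0" "d0 > 0" and ell: "\<And>d e \<rho>. \<And>N::nat. 0 < d \<Longrightarrow> d \<le> d0 \<Longrightarrow> 0 < e \<Longrightarrow> e \<le> 1 / (2 * real n) \<Longrightarrow>
    0 < \<rho> \<Longrightarrow> \<rho> \<le> 1 / (2 * real n) \<Longrightarrow> \<rho> * e \<le> d \<Longrightarrow> e\<^sup>2 \<le> d \<Longrightarrow> N \<ge> 1 \<Longrightarrow>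
    d powr (Re \<alpha>) * e ^ (n - 1) * (real N * \<rho> ^ (n - 1)) powr b \<le> C * (real N * (d * e ^ (n - 1))) powr a"
    using ellipsoid_test[OF bd] unfolding a_def b_def n_def by blast
  \<comment> \<open>The square of 1/(2n) is used so that sqrt d, and not only \<open>d\<close>, is
    an admissible half-axis.\<close>
  define d1 where "d1 = min d0 (1 / (2 * real n) * (1 / (2 * real n)))"
  have d1: "d1 > 0" using C n by (simp add: d1_def)
  have half: "1 / (2 * real n) \<le> 1" using n by simp
  have d1_le: "d1 \<le> 1 / (2 * real n)"
    using mult_left_mono[OF half, of "1 / (2 * real n)"] by (simp add: d1_def min_le_iff_disj)
  have d: "d \<le> d0" "d \<le> 1 / (2 * real n)" "d * d \<le> d" "1 / (2 * real n) * d \<le> d" if "0 < d" "d \<le> d1" for d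
  proof -
    show "d \<le> d0" "d \<le> 1 / (2 * real n)" using that d1_le by (auto simp: d1_def)
    then show "d * d \<le> d" using that half mult_right_mono[of d 1 d] by linarith
    show "1 / (2 * real n) * d \<le> d" using that mult_right_mono[OF half, of d] by simp
  qed
  have r1: "0 < 1 / (2 * real n)" using n by simp
  \<comment> \<open>All lengths stay fixed and only the number of translates grows, comparing N^b
    with N^a.\<close>
  have ba: "b \<le> a"
  proof (rule powr_nat_exponent_le)
    fix N :: nat assume N: "N \<ge> 1"
    define X where "X = d1 powr Re \<alpha> * d1 ^ (n - 1) * ((1 / (2 * real n)) ^ (n - 1)) powr b"
    define Y where "Y = C * (d1 * d1 ^ (n - 1)) powr a"
    have X: "X > 0" using d1 n by (simp add: X_def)
    have "d1 powr (Re \<alpha>) * d1 ^ (n - 1) * (real N * (1 / (2 * real n)) ^ (n - 1)) powr b \<le> C * (real N * (d1 * d1 ^ (n - 1))) powr a"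
      by (rule ell[OF d1 d(1)[OF d1 order_refl] d1 d(2)[OF d1 order_refl] r1 order_refl d(4)[OF d1 order_refl] d(3)[OF d1 order_refl, folded power2_eq_square] N])
    then have "X * real N powr b \<le> Y * real N powr a"
      unfolding X_def Y_def powr_mult[of "real N"] by (simp only: mult_ac)
    then show "real N powr b \<le> Y / X * real N powr a"
      by (simp only: times_divide_eq_left pos_le_divide_eq[OF X] mult.commute[of _ X])
  qed
  \<comment> \<open>Balls: d = e, \<rho> fixed and N = 1. The left side has order Re \<alpha> + n -
    1 in \<open>d\<close>, the right side order n a.\<close>
  have c3: "a * real n \<le> Re \<alpha> + (real n - 1)"
  proof (rule powr_exponent_le[OF d1])
    fix e assume e: "0 < e" "e \<le> d1"
    define X where "X = ((1 / (2 * real n)) ^ (n - 1)) powr b"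
    have X: "X > 0" using n by (simp add: X_def)
    have "e powr (Re \<alpha>) * e ^ (n - 1) * (real 1 * (1 / (2 * real n)) ^ (n - 1)) powr b \<le> C * (real 1 * (e * e ^ (n - 1))) powr a"
      by (rule ell[OF e(1) d(1)[OF e] e(1) d(2)[OF e] r1 order_refl d(4)[OF e] d(3)[OF e, folded power2_eq_square]]) simp
    moreover have "e powr Re \<alpha> * e ^ (n - 1) = e powr (Re \<alpha> + (real n - 1))"
    proof -
      have "e ^ (n - 1) = e powr (real n - 1)"
        using powr_realpow[OF e(1), of "n - 1"] n by (simp add: of_nat_diff)
      then show ?thesis by (simp only: powr_add)
    qed
    moreover have "(e * e ^ (n - 1)) powr a = e powr (a * real n)"
    proof -
      have "e * e ^ (n - 1) = e ^ n" using n by (cases n) auto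
      also have "\<dots> = e powr real n" using e by (simp add: powr_realpow)
      finally show ?thesis by (simp add: powr_powr mult.commute)
    qed
    ultimately have "e powr (Re \<alpha> + (real n - 1)) * X \<le> C * e powr (a * real n)" by (simp add: X_def)
    then show "e powr (Re \<alpha> + (real n - 1)) \<le> C / X * e powr (a * real n)"
      by (simp only: times_divide_eq_left pos_le_divide_eq[OF X])
  qed
  \<comment> \<open>Plates: e = \<rho> = sqrt d and N = 1, the largest choice with both \<rho> e <=
    d and e^2 <= d when \<rho> = e.\<close>
  have c2: "a * ((real n + 1) / 2) \<le> Re \<alpha> + (real n - 1) / 2 + b * ((real n - 1) / 2)"
  proof (rule powr_exponent_le[OF d1])
    fix e assume e: "0 < e" "e \<le> d1"
    define s where "s = sqrt e"
    have s: "0 < s" "s * s = e" using e by (auto simp: s_def)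
    have s_le: "s \<le> 1 / (2 * real n)"
      unfolding s_def by (rule real_le_lsqrt) (use e in \<open>auto simp: d1_def power2_eq_square\<close>)
    have sp: "s ^ (n - 1) = e powr ((real n - 1) / 2)"
    proof -
      have "s ^ (n - 1) = s powr (real n - 1)" using powr_realpow[OF s(1), of "n - 1"] n by (simp add: of_nat_diff)
      also have "\<dots> = (e powr (1/2)) powr (real n - 1)" using e by (simp add: s_def powr_half_sqrt)
      finally show ?thesis by (simp only: powr_powr times_divide_eq_left mult_1_left)
    qed
    have "e powr (Re \<alpha>) * s ^ (n - 1) * (real 1 * s ^ (n - 1)) powr b \<le> C * (real 1 * (e * s ^ (n - 1))) powr a"
      by (rule ell[OF e(1) d(1)[OF e] s(1) s_le s(1) s_le]) (simp_all add: s(2) power2_eq_square)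
    moreover have "e powr (Re \<alpha>) * s ^ (n - 1) * (s ^ (n - 1)) powr b = e powr (Re \<alpha> + (real n - 1) / 2 + b * ((real n - 1) / 2))"
      unfolding sp by (simp only: powr_powr powr_add mult.commute[of b])
    moreover have "(e * s ^ (n - 1)) powr a = e powr (a * ((real n + 1) / 2))"
    proof -
      have "e * s ^ (n - 1) = e powr 1 * e powr ((real n - 1) / 2)" unfolding sp using e by simp
      also have "\<dots> = e powr ((real n + 1) / 2)" unfolding powr_add[symmetric] by (simp add: field_simps)
      finally show ?thesis by (simp add: powr_powr mult.commute)
    qed
    ultimately show "e powr (Re \<alpha> + (real n - 1) / 2 + b * ((real n - 1) / 2)) \<le> C * e powr (a * ((real n + 1) / 2))"
      by simp
  qed
  have c1: "a \<le> Re \<alpha> + real n * b"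
  proof -
    obtain C' d' where C': "C' > 0" "d' > 0" and sph: "\<And>d. 0 < d \<Longrightarrow> d \<le> d' \<Longrightarrow> d powr (Re \<alpha>) * d powr (real n * b) \<le> C' * d powr a"
      using sphere_test[OF bd assms(1)] unfolding a_def b_def n_def by blast
    show ?thesis
      by (rule powr_exponent_le[OF C'(2), of _ C']) (unfold powr_add, rule sph)
  qed
  have "p \<le> q"
  proof (cases q)
    case (real y)
    then have y: "y \<ge> 1" using assms(3) by simp
    have b: "b = 1 / y" unfolding b_def real(2) by (rule enn2real_inverse_finite[OF y])
    show ?thesis
    proof (cases p)
      case (real x)
      then have x: "x \<ge> 1" using assms(2) by simp
      have "a = 1 / x" unfolding a_def real(2) by (rule enn2real_inverse_finite[OF x])
      then have "inverse y \<le> inverse x" using ba by (simp add: b inverse_eq_divide)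
      then have "x \<le> y" by (rule inverse_le_imp_le) (use y in simp)
      then show ?thesis using \<open>q = ennreal y\<close> real by (simp add: ennreal_leI)
    next
      case top
      \<comment> \<open>An infinite \<open>p\<close> would give a = 0, but b = 1/y is positive and
        at most \<open>a\<close>.\<close>
      then show ?thesis using ba y by (simp add: a_def b)
    qed
  qed simp
  moreover have "sigma_exponent n p q \<le> Re \<alpha>"
  proof -
    have "a - real n * b \<le> Re \<alpha>" using c1 by linarith
    moreover have "(real n + 1) / 2 * a - (real n - 1) / 2 * (b + 1) \<le> Re \<alpha>"
    proof -
      have "(real n + 1) / 2 * a = a * ((real n + 1) / 2)" by (rule mult.commute)
      moreover have "(real n - 1) / 2 * (b + 1) = b * ((real n - 1) / 2) + (real n - 1) / 2"
        unfolding mult.commute[of "(real n - 1) / 2"] distrib_right by simp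
      ultimately show ?thesis using c2 by linarith
    qed
    moreover have "real n * a - real n + 1 \<le> Re \<alpha>" using c3 by (simp only: mult.commute[of a])
    ultimately show ?thesis
      unfolding sigma_exponent_def Let_def a_def[symmetric] b_def[symmetric] by simp
  qed
  ultimately show ?thesis by (simp add: n_def)
qed


end
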